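(* Let $(|X|,S,\{F_j\}_{j\in S})$ be a cellular self-similar structure in $\mathbb{R}^2$ with $\#S\ge 2$ and cellular self-similar set $K_{|X|}$, and let $\alpha>0$ satisfy $2\alpha>\dim_H(K_{|X|})$. Let $\phi:C^{\alpha}(K_{|X|})\times C^{\alpha}(K_{|X|})\to\mathbb{C}$ be the bilinear map $\phi(f,g)=\lim_{n\to\infty}\phi_n(f,g)$. Then: (a) $\phi$ is a cyclic $1$-cocycle of the algebra $C^{\alpha}(K_{|X|})$. (b) If $|X|\neq|X_1|$, the cocycle $\phi$ represents a non-trivial element $[\phi]$ in the first cyclic cohomology group $HC^1(C^{\alpha}(K_{|X|}))$.
   Context: All spaces lie in $\mathbb{R}^2$ with the Euclidean metric; $\partial$ and $\operatorname{int}$ denote boundary and interior in $\mathbb{R}^2$; $\dim_H$ is the Hausdorff dimension. Cellular self-similar structure. A finite convex linear cell complex $X$ in $\mathbb{R}^2$ is a finite collection of convex cells (points, closed segments, closed convex polygons) closed under taking faces and such that any two cells meet in a common face or not at all; $|X|$ is its union and $sk_k(|X|)$ the union of its cells of dimension $\le k$. A similitude $F:|X|\to|X|$ is a map with $|F(x)-F(y)|=r|x-y|$ for all $x,y$, for some constant $0<r\le 1$. Let $|X|$ be a 2-dimensional finite convex linear cell complex, $S$ a finite set, $\{F_j\}_{j\in S}$ similitudes $F_j:|X|\to|X|$, and $|X_1|=\bigcup_{j\in S}F_j(|X|)$. The triple $(|X|,S,\{F_j\}_{j\in S})$ is a cellular self-similar structure if (a) $\partial|X|\subset\partial|X_1|$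 and (b) $\operatorname{int}F_i(|X|)\cap\operatorname{int}F_j(|X|)=\emptyset$ for all $i\ne j\in S$. The cellular self-similar set $K_{|X|}$ is the unique non-empty compact set $K\subset |X|$ with $K=\bigcup_{j\in S}F_j(K)$. The complexes $|X_n|$. For $\omega=(j_1,\dots,j_n)\in S^{\times n}$ put $F_\omega=F_{j_1}\circ\cdots\circ F_{j_n}$. The cell complex $|X_n|$ has skeleta $sk_k(|X_n|)=\bigcup_{\omega\in S^{\times n}}F_\omega(sk_k(|X|))$, $k=0,1,2$ (so $|X_n|=\bigcup_\omega F_\omega(|X|)$ and $|X_0|=|X|$); its 1-cells are the closures of the connected components of $sk_1(|X_n|)-sk_0(|X_n|)$. Subdivide $|X_n|$ into a simplicial complex $X_n^s$ without introducing new vertices. Chains. $S_p(X_n^s)$ is the set of ordered $(p+1)$-tuples of vertices of $X_n^s$ contained in a common simplex; a tuple with a repeated vertex is called degenerate. $\tilde S_p(X_n^s;\mathbb{C})$ is the free $\mathbb{C}$-module on $S_p(X_n^s)$, with $\tilde\partial_p(x_0,\dots,x_p)=\sum_j(-1)^j(x_0,\dots,\hat x_j,\dots,x_p)$, and $\pi$ is the quotient map onto the (oriented) simplicial chain complex $C_*(X_n^s;\mathbb{C})$. Let $c_n\in C_2(X_n^s;\mathbb{C})$ be the sum of all 2-simplices, each oriented counterclockwise. Choose $s_n\in\pi^{-1}(c_n)$ containing no degenerate simplices and such that each simplex occurring in $\tilde\partial_2(s_n)$ lies on $\partial|X_n|$. Put $b_n=\tilde\partial_2(s_n)$, let $\epsilon(b_n)$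 be the set of $1$-simplices occurring in $b_n$, let $\operatorname{sgn}(\sigma)$ be the sign (coefficient) with which $\sigma$ occurs in $b_n$, and let $\epsilon(o_n)=\{\sigma\in\epsilon(b_n): |\sigma|\subset\partial|X|\}$, where $|\sigma|$ is the segment spanned by $\sigma$. Put $o_n=\sum_{\sigma\in\epsilon(o_n)}\operatorname{sgn}(\sigma)\,\sigma$ and $I_n=b_n-o_n\in\tilde S_1(X_n^s;\mathbb{C})$. The map $\phi$. $C^\alpha(K_{|X|})$ is the algebra (pointwise operations) of functions $f:K_{|X|}\to\mathbb{C}$ for which there is a constant $c_f$ with $|f(x)-f(y)|\le c_f|x-y|^\alpha$ for all $x,y$. The vertices occurring in $I_n$ lie in $K_{|X|}$. For $f,g\in C^\alpha(K_{|X|})$ let $\omega_n(f,g)$ be the linear functional on 1-chains determined by $\omega_n(f,g)(x,y)=f(x)(g(y)-g(x))-g(x)(f(y)-f(x))$, and set $\phi_n(f,g)=\omega_n(f,g)(I_n)\in\mathbb{C}$. When $\#S\ge2$ and $2\alpha>\dim_H(K_{|X|})$ the sequence $\{\phi_n(f,g)\}_n$ converges, and $\phi(f,g)$ denotes its limit. Cyclic cohomology. For a unital $\mathbb{C}$-algebra $A$, a cyclic $1$-cocycle is a bilinear map $\varphi:A\times A\to\mathbb{C}$ with $\varphi(f,g)=-\varphi(g,f)$ and $(b\varphi)(f,g,h)=\varphi(fg,h)-\varphi(f,gh)+\varphi(hf,g)=0$ for all $f,g,h\in A$. $HC^1(A)$ is the space of cyclic $1$-cocycles modulo the coboundaries $(b\psi)(f,g)=\psi(fg)-\psi(gf)$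 of linear functionals $\psi:A\to\mathbb{C}$.
   Formalization: Part (b) is stated only for α ≤ 1; for α > 1 it fails, since functions in C^α(K) are then constant on segments in K, so φ = 0 and [φ] = 0 (e.g. the square Sierpiński carpet with α = 3/2). *)

theory Defs
  imports "HOL-Analysis.Analysis" "HOL-Library.Poly_Mapping" "HOL-Combinatorics.Permutations"
begin

section \<open>Hausdorff dimension\<close>

text \<open>The term \<open>diam(U)\<^sup>s\<close> with the usual conventions \<open>diam({})\<^sup>s = 0\<close> and \<open>0\<^sup>0 = 1\<close>
  for non-empty \<open>U\<close> (note that \<open>0 powr 0 = 0\<close>).\<close>

definition hausdorff_weight :: "real \<Rightarrow> 'a::metric_space set \<Rightarrow> ennreal" where
  "hausdorff_weight s U =
     (if U = {} then 0 else if s = 0 then 1 else ennreal (diameter U powr s))"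

definition hausdorff_premeasure :: "real \<Rightarrow> real \<Rightarrow> 'a::metric_space set \<Rightarrow> ennreal" where
  "hausdorff_premeasure s \<delta> A =
     Inf {suminf (\<lambda>i. hausdorff_weight s (U i)) | U :: nat \<Rightarrow> 'a set.
            A \<subseteq> (\<Union>i. U i) \<and> (\<forall>i. bounded (U i) \<and> diameter (U i) \<le> \<delta>)}"

definition hausdorff_measure :: "real \<Rightarrow> 'a::metric_space set \<Rightarrow> ennreal" where
  "hausdorff_measure s A = (SUP \<delta>\<in>{0<..}. hausdorff_premeasure s \<delta> A)"

definition hausdorff_dim :: "'a::metric_space set \<Rightarrow> ereal" where
  "hausdorff_dim A = Inf {ereal s | s. 0 \<le> s \<and> hausdorff_measure s A = 0}"


section \<open>Cellular self-similar structures\<close>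

type_synonym plane = "real^2"

text \<open>Cells are non-empty; \<^const>\<open>face_of\<close> counts the empty set as a face, so it is excluded.\<close>

definition convex_cell_complex :: "plane set set \<Rightarrow> bool" where
  "convex_cell_complex X \<longleftrightarrow>
     finite X \<and>
     (\<forall>C\<in>X. polytope C \<and> C \<noteq> {}) \<and>
     (\<forall>C\<in>X. \<forall>D. D face_of C \<and> D \<noteq> {} \<longrightarrow> D \<in> X) \<and>
     (\<forall>C\<in>X. \<forall>D\<in>X. C \<inter> D \<noteq> {} \<longrightarrow> (C \<inter> D) face_of C \<and> (C \<inter> D) face_of D)"

definition similitude_on :: "plane set \<Rightarrow> (plane \<Rightarrow> plane) \<Rightarrow> bool" where
  "similitude_on A F \<longleftrightarrow>
     F ` A \<subseteq> A \<and> (\<exists>r. 0 < r \<and> r \<le> 1 \<and> (\<forall>x\<in>A. \<forall>y\<in>A. dist (F x) (F y) = r * dist x y))"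

text \<open>Only the restrictions of the maps \<open>F j\<close> to \<open>\<Union>X\<close> matter.\<close>

definition cellular_self_similar_structure ::
  "plane set set \<Rightarrow> 'j set \<Rightarrow> ('j \<Rightarrow> plane \<Rightarrow> plane) \<Rightarrow> bool" where
  "cellular_self_similar_structure X S F \<longleftrightarrow>
     convex_cell_complex X \<and> (\<exists>C\<in>X. aff_dim C = 2) \<and>
     finite S \<and> (\<forall>j\<in>S. similitude_on (\<Union>X) (F j)) \<and>
     frontier (\<Union>X) \<subseteq> frontier (\<Union>j\<in>S. F j ` \<Union>X) \<and>
     (\<forall>i\<in>S. \<forall>j\<in>S. i \<noteq> j \<longrightarrow> interior (F i ` \<Union>X) \<inter> interior (F j ` \<Union>X) = {})"

definition cellular_self_similar_set ::
  "plane set set \<Rightarrow> 'j set \<Rightarrow> ('j \<Rightarrow> plane \<Rightarrow> plane) \<Rightarrow> plane set" where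
  "cellular_self_similar_set X S F =
     (THE K. K \<noteq> {} \<and> compact K \<and> K \<subseteq> \<Union>X \<and> K = (\<Union>j\<in>S. F j ` K))"


section \<open>The complexes of level n and their simplicial subdivisions\<close>

definition words :: "'j set \<Rightarrow> nat \<Rightarrow> 'j list set" where
  "words S n = {w. length w = n \<and> set w \<subseteq> S}"

primrec word_map :: "('j \<Rightarrow> plane \<Rightarrow> plane) \<Rightarrow> 'j list \<Rightarrow> plane \<Rightarrow> plane" where
  "word_map F [] = id"
| "word_map F (j # w) = F j \<circ> word_map F w"

definition cell_skeleton :: "plane set set \<Rightarrow> nat \<Rightarrow> plane set" where
  "cell_skeleton X k = \<Union>{C \<in> X. aff_dim C \<le> int k}"

definition level_skeleton ::
  "plane set set \<Rightarrow> 'j set \<Rightarrow> ('j \<Rightarrow> plane \<Rightarrow> plane) \<Rightarrow> nat \<Rightarrow> nat \<Rightarrow> plane set" where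
  "level_skeleton X S F n k = (\<Union>w\<in>words S n. word_map F w ` cell_skeleton X k)"

definition level_space ::
  "plane set set \<Rightarrow> 'j set \<Rightarrow> ('j \<Rightarrow> plane \<Rightarrow> plane) \<Rightarrow> nat \<Rightarrow> plane set" where
  "level_space X S F n = (\<Union>w\<in>words S n. word_map F w ` \<Union>X)"

definition level_cells ::
  "plane set set \<Rightarrow> 'j set \<Rightarrow> ('j \<Rightarrow> plane \<Rightarrow> plane) \<Rightarrow> nat \<Rightarrow> plane set set" where
  "level_cells X S F n =
     (\<lambda>v. {v}) ` level_skeleton X S F n 0 \<union>
     closure ` components (level_skeleton X S F n 1 - level_skeleton X S F n 0) \<union>
     closure ` components (level_skeleton X S F n 2 - level_skeleton X S F n 1)"

definition complex_vertices :: "plane set set \<Rightarrow> plane set" where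
  "complex_vertices T = {v. {v} \<in> T}"

definition simplicial_subdivision :: "plane set set \<Rightarrow> plane set set \<Rightarrow> bool" where
  "simplicial_subdivision T Cs \<longleftrightarrow>
     simplicial_complex T \<and> \<Union>T = \<Union>Cs \<and>
     (\<forall>K\<in>T. \<exists>C\<in>Cs. K \<subseteq> C) \<and> (\<forall>C\<in>Cs. \<exists>\<K>\<subseteq>T. C = \<Union>\<K>)"

definition level_subdivision ::
  "plane set set \<Rightarrow> 'j set \<Rightarrow> ('j \<Rightarrow> plane \<Rightarrow> plane) \<Rightarrow> nat \<Rightarrow> plane set set \<Rightarrow> bool" where
  "level_subdivision X S F n T \<longleftrightarrow>
     simplicial_subdivision T (level_cells X S F n) \<and>
     complex_vertices T = level_skeleton X S F n 0"


section \<open>Ordered and oriented simplicial chains\<close>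

text \<open>An ordered simplex is the list of its vertices; an ordered chain is a finitely supported
  function on such lists.\<close>

type_synonym chain = "plane list \<Rightarrow>\<^sub>0 complex"

definition ordered_simplices :: "plane set set \<Rightarrow> nat \<Rightarrow> plane list set" where
  "ordered_simplices T p =
     {xs. length xs = p + 1 \<and> set xs \<subseteq> complex_vertices T \<and> (\<exists>K\<in>T. set xs \<subseteq> K)}"

definition ordered_chains :: "plane set set \<Rightarrow> nat \<Rightarrow> chain set" where
  "ordered_chains T p = {c. Poly_Mapping.keys c \<subseteq> ordered_simplices T p}"

definition chain_boundary :: "chain \<Rightarrow> chain" where
  "chain_boundary c =
     (\<Sum>xs\<in>Poly_Mapping.keys c. \<Sum>j<length xs.
        Poly_Mapping.single (take j xs @ drop (Suc j) xs) ((- 1) ^ j * Poly_Mapping.lookup c xs))"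

text \<open>The kernel of the projection of ordered onto oriented chains: the complex span of the
  degenerate simplices and of the differences \<open>\<tau>\<cdot>\<sigma> - sgn(\<tau>) \<sigma>\<close>.\<close>

inductive_set orientation_relations :: "plane set set \<Rightarrow> nat \<Rightarrow> chain set"
  for T :: "plane set set" and p :: nat where
  zero: "0 \<in> orientation_relations T p"
| degenerate: "c \<in> orientation_relations T p \<Longrightarrow> xs \<in> ordered_simplices T p \<Longrightarrow> \<not> distinct xs \<Longrightarrow>
     c + Poly_Mapping.single xs a \<in> orientation_relations T p"
| permuted: "c \<in> orientation_relations T p \<Longrightarrow> xs \<in> ordered_simplices T p \<Longrightarrow>
     \<tau> permutes {..<length xs} \<Longrightarrow>
     c + (Poly_Mapping.single (permute_list \<tau> xs) a
            - Poly_Mapping.single xs (of_int (sign \<tau>) * a)) \<in> orientation_relations T p"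

definition oriented_rel :: "plane set set \<Rightarrow> nat \<Rightarrow> (chain \<times> chain) set" where
  "oriented_rel T p =
     {(c, d). c \<in> ordered_chains T p \<and> d \<in> ordered_chains T p \<and> c - d \<in> orientation_relations T p}"

text \<open>The quotient map \<open>\<pi>\<close>; its values on \<^term>\<open>ordered_chains T p\<close> are the elements of the oriented
  chain group, that is, of \<^term>\<open>ordered_chains T p // oriented_rel T p\<close>.\<close>

definition oriented_class :: "plane set set \<Rightarrow> nat \<Rightarrow> chain \<Rightarrow> chain set" where
  "oriented_class T p c = oriented_rel T p `` {c}"

definition ccw :: "plane list \<Rightarrow> bool" where
  "ccw xs \<longleftrightarrow> (\<exists>a b c. xs = [a, b, c] \<and>
     (b - a) $ 1 * (c - a) $ 2 - (b - a) $ 2 * (c - a) $ 1 > 0)"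

text \<open>The sum of all 2-simplices oriented counterclockwise. The class does not depend on which of
  the three counterclockwise vertex orders is selected for each simplex.\<close>

definition ccw_chain :: "plane set set \<Rightarrow> chain set" where
  "ccw_chain T = oriented_class T 2
     (\<Sum>K\<in>{K \<in> T. 2 simplex K}.
        Poly_Mapping.single
          (SOME xs. xs \<in> ordered_simplices T 2 \<and> ccw xs \<and> convex hull set xs = K) 1)"

text \<open>The admissible choices of \<open>s\<^sub>n\<close>, for a subdivision \<open>T\<close> with underlying space \<open>P\<close>.\<close>

definition admissible_chain :: "plane set \<Rightarrow> plane set set \<Rightarrow> chain \<Rightarrow> bool" where
  "admissible_chain P T s \<longleftrightarrow>
     s \<in> ordered_chains T 2 \<and> oriented_class T 2 s = ccw_chain T \<and>
     (\<forall>xs\<in>Poly_Mapping.keys s. distinct xs) \<and>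
     (\<forall>xs\<in>Poly_Mapping.keys (chain_boundary s). convex hull set xs \<subseteq> frontier P)"

text \<open>With \<open>P = |X|\<close> and \<open>s = s\<^sub>n\<close> these are \<open>o\<^sub>n\<close> and \<open>I\<^sub>n\<close>.\<close>

definition outer_chain :: "plane set \<Rightarrow> chain \<Rightarrow> chain" where
  "outer_chain P s =
     (\<Sum>xs\<in>{xs \<in> Poly_Mapping.keys (chain_boundary s). convex hull set xs \<subseteq> frontier P}.
        Poly_Mapping.single xs (Poly_Mapping.lookup (chain_boundary s) xs))"

definition inner_chain :: "plane set \<Rightarrow> chain \<Rightarrow> chain" where
  "inner_chain P s = chain_boundary s - outer_chain P s"


section \<open>Hoelder functions and the map \<open>\<phi>\<close>\<close>

text \<open>Functions on \<open>K\<close> are represented by their extension by \<open>0\<close> to the plane; this is compatible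
  with all pointwise operations, and the unit of the algebra is the indicator function of \<open>K\<close>.
  The definition makes sense for every \<open>\<alpha> > 0\<close>, but for \<open>\<alpha> > 1\<close> an element is constant on each
  segment contained in \<open>K\<close>. Since the 1-simplices of \<open>I\<^sub>n\<close> lie in \<open>K\<close>, the map \<open>\<phi>\<close> then vanishes
  and only \<open>\<alpha> \<le> 1\<close> can give a non-trivial class.\<close>

definition hoelder_algebra :: "real \<Rightarrow> plane set \<Rightarrow> (plane \<Rightarrow> complex) set" where
  "hoelder_algebra \<alpha> K =
     {f. (\<forall>x. x \<notin> K \<longrightarrow> f x = 0) \<and>
         (\<exists>c. \<forall>x\<in>K. \<forall>y\<in>K. norm (f x - f y) \<le> c * dist x y powr \<alpha>)}"

definition edge_form :: "(plane \<Rightarrow> complex) \<Rightarrow> (plane \<Rightarrow> complex) \<Rightarrow> plane list \<Rightarrow> complex" where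
  "edge_form f g xs =
     (case xs of [x, y] \<Rightarrow> f x * (g y - g x) - g x * (f y - f x) | _ \<Rightarrow> 0)"

definition chain_eval :: "(plane list \<Rightarrow> complex) \<Rightarrow> chain \<Rightarrow> complex" where
  "chain_eval \<omega> c = (\<Sum>xs\<in>Poly_Mapping.keys c. Poly_Mapping.lookup c xs * \<omega> xs)"

definition phi_level ::
  "plane set set \<Rightarrow> (nat \<Rightarrow> chain) \<Rightarrow> nat \<Rightarrow> (plane \<Rightarrow> complex) \<Rightarrow> (plane \<Rightarrow> complex) \<Rightarrow> complex" where
  "phi_level X s n f g = chain_eval (edge_form f g) (inner_chain (\<Union>X) (s n))"

definition phi ::
  "plane set set \<Rightarrow> (nat \<Rightarrow> chain) \<Rightarrow> (plane \<Rightarrow> complex) \<Rightarrow> (plane \<Rightarrow> complex) \<Rightarrow> complex" where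
  "phi X s f g = lim (\<lambda>n. phi_level X s n f g)"


section \<open>First cyclic cohomology\<close>

text \<open>\<open>A\<close> is an algebra of complex functions under the pointwise operations. Functionals and
  bilinear maps on \<open>A\<close> are given by functions on the whole type, of which only the values on \<open>A\<close>
  count.\<close>

definition linear_functional_on :: "('a \<Rightarrow> complex) set \<Rightarrow> (('a \<Rightarrow> complex) \<Rightarrow> complex) \<Rightarrow> bool" where
  "linear_functional_on A \<psi> \<longleftrightarrow>
     (\<forall>f\<in>A. \<forall>g\<in>A. \<psi> (\<lambda>x. f x + g x) = \<psi> f + \<psi> g) \<and>
     (\<forall>c. \<forall>f\<in>A. \<psi> (\<lambda>x. c * f x) = c * \<psi> f)"

definition cyclic_1_cocycles ::
  "('a \<Rightarrow> complex) set \<Rightarrow> (('a \<Rightarrow> complex) \<Rightarrow> ('a \<Rightarrow> complex) \<Rightarrow> complex) set" where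
  "cyclic_1_cocycles A =
     {\<phi>. (\<forall>g\<in>A. linear_functional_on A (\<lambda>f. \<phi> f g)) \<and>
         (\<forall>f\<in>A. linear_functional_on A (\<lambda>g. \<phi> f g)) \<and>
         (\<forall>f\<in>A. \<forall>g\<in>A. \<phi> f g = - \<phi> g f) \<and>
         (\<forall>f\<in>A. \<forall>g\<in>A. \<forall>h\<in>A.
            \<phi> (\<lambda>x. f x * g x) h - \<phi> f (\<lambda>x. g x * h x) + \<phi> (\<lambda>x. h x * f x) g = 0)}"

definition HC1_rel ::
  "('a \<Rightarrow> complex) set \<Rightarrow>
     ((('a \<Rightarrow> complex) \<Rightarrow> ('a \<Rightarrow> complex) \<Rightarrow> complex) \<times>
      (('a \<Rightarrow> complex) \<Rightarrow> ('a \<Rightarrow> complex) \<Rightarrow> complex)) set" where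
  "HC1_rel A =
     {(\<phi>, \<phi>'). \<phi> \<in> cyclic_1_cocycles A \<and> \<phi>' \<in> cyclic_1_cocycles A \<and>
        (\<exists>\<psi>. linear_functional_on A \<psi> \<and>
           (\<forall>f\<in>A. \<forall>g\<in>A. \<phi> f g - \<phi>' f g = \<psi> (\<lambda>x. f x * g x) - \<psi> (\<lambda>x. g x * f x)))}"

definition HC1 ::
  "('a \<Rightarrow> complex) set \<Rightarrow> (('a \<Rightarrow> complex) \<Rightarrow> ('a \<Rightarrow> complex) \<Rightarrow> complex) set set" where
  "HC1 A = cyclic_1_cocycles A // HC1_rel A"

definition HC1_class ::
  "('a \<Rightarrow> complex) set \<Rightarrow> (('a \<Rightarrow> complex) \<Rightarrow> ('a \<Rightarrow> complex) \<Rightarrow> complex) \<Rightarrow>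
     (('a \<Rightarrow> complex) \<Rightarrow> ('a \<Rightarrow> complex) \<Rightarrow> complex) set" where
  "HC1_class A \<phi> = HC1_rel A `` {\<phi>}"

end

theory Submission
  imports Defs
begin

text \<open>The form \<open>\<omega>(x, y) = f x * g y - g x * f y\<close> is alternating, so \<open>\<phi>\<^sub>n(f, g)\<close> is the sum of \<open>\<omega>\<close> over the
  edges of all counterclockwise triangles of \<open>X\<^sub>n\<^sup>s\<close>, minus the part coming from edges in \<open>\<partial>|X|\<close>.

  Condition (a) forces \<open>\<partial>|X|\<close> to be covered by its images under the \<open>F\<^sub>j\<close>. Hence \<open>|X|\<close> is the closure
  of its interior and \<open>K\<close> contains \<open>\<partial>|X|\<close>, in particular a segment, so that \<open>2\<alpha> > 1\<close>. A mass
  distribution gives \<open>\<rho> = \<Sum>\<^sub>j r\<^sub>j\<^sup>2\<^sup>\<alpha> < 1\<close> for the contraction ratios \<open>r\<^sub>j\<close>.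

  Since \<open>2\<alpha> > 1\<close>, \<open>\<omega>\<close> has a Young integral \<open>Y\<close> along segments in \<open>K\<close>: an additive function of
  segments with \<open>Y(x, y) - \<omega>(x, y) = O(|x - y|\<^sup>2\<^sup>\<alpha>)\<close>. The triangles in one piece \<open>F\<^sub>w(|X|)\<close> contribute
  the sum of \<open>\<omega>\<close> over a subdivision of the boundary of that piece. It does not change when constants
  are subtracted from \<open>f\<close> and \<open>g\<close>, and is therefore \<open>O(r\<^sub>w\<^sup>2\<^sup>\<alpha>)\<close>; all pieces together give \<open>O(\<rho>\<^sup>n)\<close>.
  The edges in \<open>\<partial>|X|\<close> subdivide \<open>\<partial>|X|\<close> with mesh tending to 0. Consequently \<open>\<phi>(f, g)\<close> is minus the
  integral of \<open>Y\<close> over \<open>\<partial>|X|\<close>, that is, \<open>- \<integral> f dg - g df\<close>.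

  By the Leibniz rule the cocycle identity holds up to the integral of \<open>d(fgh)\<close> over a closed curve.
  On the coordinate functions \<open>\<phi>\<close> is \<open>-2\<close> times the area of \<open>|X|\<close>, whereas coboundaries vanish on the
  commutative algebra.\<close>


section \<open>Young integrals along segments\<close>

text \<open>The obstacle is that the subdivisions are arbitrary: nothing bounds the number of edges
  into which the boundary of a piece is cut, so the values of \<omega> on single edges cannot simply
  be estimated and added. Additivity of \<open>Y\<close> removes this. Its sum over any subdivision
  equals its sum over the image of one fixed subdivision of \<partial>|X|, which has a fixed number
  of edges, and the error of passing from \<omega> to \<open>Y\<close> is controlled by the mesh and
  the total length, which is itself additive. The boundary of |X| may be disconnected and is never
  parametrised. An edge is directed by a local condition instead: near its interior points the
  region is the half plane to its left. This is enough to see that overlapping edges of two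
  subdivisions run in the same direction, also after a reflection, and that an edge whose interior
  meets \<partial>|X| lies in \<partial>|X|. No canonical \<open>Y\<close> is singled out. Any
  additive function within order 2\<alpha> of \<omega> may be used, so linearity and the cocycle
  identity are checked on convenient choices.\<close>

lemma hoelder_exponent_gt_one_constant:
  fixes h :: "real \<Rightarrow> 'a::real_normed_vector"
  assumes \<theta>: "\<theta> > 1"
    and h: "\<And>a b. \<lbrakk>0 \<le> a; a \<le> b; b \<le> 1\<rbrakk> \<Longrightarrow> norm (h b - h a) \<le> C * (b - a) powr \<theta>"
  shows "h 1 = h 0"
proof -
  have bound: "norm (h 1 - h 0) \<le> C * real (Suc n) powr (1 - \<theta>)" for n
  proof -
    let ?N = "real (Suc n)"
    have "h 1 - h 0 = (\<Sum>k<Suc n. h (real (Suc k) / ?N) - h (real k / ?N))"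
      by (subst sum_lessThan_telescope) simp
    also have "norm \<dots> \<le> (\<Sum>k<Suc n. C * (1 / ?N) powr \<theta>)"
    proof (rule sum_norm_le)
      fix k assume "k \<in> {..<Suc n}"
      hence "norm (h (real (Suc k) / ?N) - h (real k / ?N))
          \<le> C * (real (Suc k) / ?N - real k / ?N) powr \<theta>"
        by (intro h) (auto simp: divide_simps)
      also have "real (Suc k) / ?N - real k / ?N = 1 / ?N"
        by (simp add: diff_divide_distrib[symmetric])
      finally show "norm (h (real (Suc k) / ?N) - h (real k / ?N)) \<le> C * (1 / ?N) powr \<theta>" .
    qed
    \<comment> \<open>The N steps of length 1 / N together cost N * (1 / N) powr \<theta>, a
      negative power of N.\<close>
    also have "\<dots> = C * (?N * (1 / ?N) powr \<theta>)" by simp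
    also have "?N * (1 / ?N) powr \<theta> = ?N powr (1 - \<theta>)"
      by (simp add: powr_diff powr_divide)
    finally show ?thesis .
  qed
  have "((\<lambda>x::real. x powr (1 - \<theta>)) \<longlongrightarrow> 0) at_top"
    using \<theta> by (intro tendsto_neg_powr filterlim_ident) auto
  moreover have "filterlim (\<lambda>n. real (Suc n)) at_top sequentially"
    by (rule filterlim_compose[OF filterlim_real_sequentially filterlim_Suc])
  ultimately have "(\<lambda>n. real (Suc n) powr (1 - \<theta>)) \<longlonglongrightarrow> 0"
    by (rule filterlim_compose)
  hence "(\<lambda>n. C * real (Suc n) powr (1 - \<theta>)) \<longlonglongrightarrow> 0"
    by (rule tendsto_mult_right_zero)
  hence "norm (h 1 - h 0) \<le> 0"
    by (rule LIMSEQ_le_const) (use bound in auto)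
  thus ?thesis by simp
qed

text \<open>The approximations sum the increments along the dyadic grid of mesh \<open>2\<^sup>-\<^sup>n\<close>; the difference
  of two consecutive ones consists of defects \<open>\<omega> a b + \<omega> b c - \<omega> a c\<close> at scale \<open>2\<^sup>-\<^sup>n\<close>.\<close>

lemma sewing:
  fixes \<omega> :: "real \<Rightarrow> real \<Rightarrow> 'a::banach"
  assumes \<theta>: "\<theta> > 1" and C: "C \<ge> 0"
    and defect: "\<And>a b c. \<lbrakk>0 \<le> a; a \<le> b; b \<le> c; c \<le> 1\<rbrakk>
        \<Longrightarrow> norm (\<omega> a b + \<omega> b c - \<omega> a c) \<le> C * (c - a) powr \<theta>"
  shows "\<exists>J. \<forall>a b. 0 \<le> a \<longrightarrow> a \<le> b \<longrightarrow> b \<le> 1 \<longrightarrow>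
      norm (J b - J a - \<omega> a b) \<le>
        (2 * 2 powr \<theta> + 7 * 2 powr (\<theta> - 1) / (1 - (1/2) powr (\<theta> - 1))) * C * (b - a) powr \<theta>"
proof -
  define h :: "nat \<Rightarrow> real" where "h n = (1/2) ^ n" for n
  define g where "g n k = real k * h n" for n k
  \<comment> \<open>\<open>N n t\<close> is the index of the last grid point not beyond
    \<open>t\<close>; \<open>J n t\<close> ends with the incomplete step from that point to
    \<open>t\<close>.\<close>
  define N where "N n t = nat \<lfloor>t / h n\<rfloor>" for n and t :: real
  define J where "J n t = (\<Sum>k<N n t. \<omega> (g n k) (g n (Suc k))) + \<omega> (g n (N n t)) t" for n t
  \<comment> \<open>The change caused by inserting the midpoint of the k-th cell.\<close>
  define \<delta> where "\<delta> n k = \<omega> (g n k) (g (Suc n) (2*k+1)) + \<omega> (g (Suc n) (2*k+1)) (g n (Suc k))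
      - \<omega> (g n k) (g n (Suc k))" for n k
  \<comment> \<open>The number of cells grows like \<open>1 / h n\<close> and each defect is at most
    \<open>C * h n powr \<theta>\<close>, so the corrections decay like
    \<open>q ^ n\<close>.\<close>
  define q where "q = (1/2::real) powr (\<theta> - 1)"
  have q: "0 < q" "q < 1" unfolding q_def using \<theta> powr_less_mono2_neg[of "-(\<theta> - 1)" 1 2] by (auto simp: powr_minus powr_divide inverse_eq_divide)
  have h0: "h n > 0" for n by (simp add: h_def)
  have hS: "h (Suc n) = h n / 2" for n by (simp add: h_def)
  have h_powr: "h n powr \<theta> = h n * q ^ n" for n
  proof -
    have "h n powr \<theta> = h n powr 1 * h n powr (\<theta> - 1)" by (subst powr_add[symmetric]) simp
    also have "h n powr (\<theta> - 1) = q ^ n"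
      by (simp add: h_def q_def powr_powr mult.commute flip: powr_realpow)
    finally show ?thesis using h0[of n] by simp
  qed
  have N: "g n (N n t) \<le> t" "t < g n (Suc (N n t))" if "0 \<le> t" for n t
  proof -
    have "real (N n t) \<le> t / h n" "t / h n < real (Suc (N n t))"
      using that h0[of n] unfolding N_def by (auto simp: of_nat_floor) linarith
    thus "g n (N n t) \<le> t" "t < g n (Suc (N n t))"
      using h0[of n] by (auto simp: g_def field_simps)
  qed
  have g_mono: "g n k \<le> g n l" if "k \<le> l" for n k l
    using that h0[of n] by (simp add: g_def mult_right_mono)
  have g_double: "g (Suc n) (2*k) = g n k" for n k by (simp add: g_def hS)
  have g_mid: "g n k \<le> g (Suc n) (2*k+1)" "g (Suc n) (2*k+1) \<le> g n (Suc k)" for n k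
    using g_mono[of "2*k" "2*k+1" "Suc n"] g_mono[of "2*k+1" "2*Suc k" "Suc n"]
      g_double[of n k] g_double[of n "Suc k"] by auto
  have g_nonneg: "g n k \<ge> 0" for n k using h0[of n] by (simp add: g_def)
  have g_step: "g n (Suc k) - g n k = h n" for n k by (simp add: g_def algebra_simps)
  have \<delta>: "norm (\<delta> n k) \<le> C * h n powr \<theta>" if "g n (Suc k) \<le> 1" for n k
    using defect[OF g_nonneg g_mid that] unfolding \<delta>_def by (simp add: g_step)
  have N_mono: "N n a \<le> N n b" if "a \<le> b" for n a b
    using that h0[of n] unfolding N_def by (intro nat_mono floor_mono divide_right_mono) auto
  have N_unique: "N n t = k" if "g n k \<le> t" "t < g n (Suc k)" for n t k
  proof -
    have "\<lfloor>t / h n\<rfloor> = int k"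
      using that h0[of n] by (intro floor_unique) (auto simp: g_def field_simps)
    thus ?thesis by (simp add: N_def)
  qed
  \<comment> \<open>Refinement inserts a midpoint into every complete cell below \<open>t\<close>;
    the last, incomplete cell adds one more defect if its midpoint is at most
    \<open>t\<close>.\<close>
  have D: "norm (J (Suc n) t - J n t - (\<Sum>k<N n t. \<delta> n k)) \<le> C * h n powr \<theta>"
    if t: "0 \<le> t" "t \<le> 1" for n t
  proof -
    let ?N = "N n t"
    have dbl: "(\<Sum>k<2*m. u k) = (\<Sum>k<m. u (2*k) + u (2*k+1))" for u :: "nat \<Rightarrow> 'a" and m
      by (induction m) (auto simp: algebra_simps)
    have sum2: "(\<Sum>k<2*?N. \<omega> (g (Suc n) k) (g (Suc n) (Suc k)))
        = (\<Sum>k<?N. \<omega> (g n k) (g n (Suc k))) + (\<Sum>k<?N. \<delta> n k)"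
      unfolding dbl sum.distrib[symmetric] \<delta>_def
      using g_double[of n] g_double[of n "Suc k" for k] by (intro sum.cong) auto
    show ?thesis
    proof (cases "t < g (Suc n) (2*?N+1)")
      case True
      hence "N (Suc n) t = 2 * ?N"
        using N[OF t(1), of n] g_double[of n ?N] by (intro N_unique) auto
      hence "J (Suc n) t - J n t - (\<Sum>k<?N. \<delta> n k) = 0"
        unfolding J_def by (simp add: sum2 g_double)
      thus ?thesis using C by simp
    next
      case False
      hence eq: "N (Suc n) t = 2 * ?N + 1"
        using N[OF t(1), of n] g_double[of n "Suc ?N"] by (intro N_unique) auto
      have "J (Suc n) t - J n t - (\<Sum>k<?N. \<delta> n k) =
          \<omega> (g n ?N) (g (Suc n) (2*?N+1)) + \<omega> (g (Suc n) (2*?N+1)) t - \<omega> (g n ?N) t"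
        unfolding J_def eq using sum2 g_double[of n ?N] by (simp add: algebra_simps)
      also have "norm \<dots> \<le> C * (t - g n ?N) powr \<theta>"
        using False t by (intro defect g_nonneg g_mid) auto
      also have "\<dots> \<le> C * h n powr \<theta>"
        using C N[OF t(1), of n] g_step[of n ?N] \<theta> by (intro mult_left_mono powr_mono2) auto
      finally show ?thesis .
    qed
  qed
  have N_diff: "real (N n b) - real (N n a) \<le> (b - a) / h n + 1" if "0 \<le> a" "a \<le> b" for n a b
  proof -
    have "b \<ge> 0" using that by simp
    have "g n (N n b) \<le> b" "a < g n (Suc (N n a))" using N that \<open>b \<ge> 0\<close> by auto
    hence "g n (N n b) - g n (N n a) - h n \<le> b - a" using g_step[of n "N n a"] by simp
    hence "(real (N n b) - real (N n a) - 1) * h n \<le> b - a" by (simp add: g_def algebra_simps)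
    thus ?thesis using h0[of n] by (simp add: field_simps)
  qed
  \<comment> \<open>Counting complete cells between \<open>a\<close> and \<open>b\<close> gives at
    most \<open>(b - a) / h n + 1\<close> defects; the incomplete cells at \<open>a\<close> and
    \<open>b\<close> contribute the other two.\<close>
  have Dab: "norm ((J (Suc n) b - J n b) - (J (Suc n) a - J n a))
      \<le> ((b - a) / h n + 3) * (C * h n powr \<theta>)" if ab: "0 \<le> a" "a \<le> b" "b \<le> 1" for n a b
  proof -
    let ?R = "\<lambda>t. J (Suc n) t - J n t - (\<Sum>k<N n t. \<delta> n k)"
    have "(\<Sum>k<N n b. \<delta> n k) = (\<Sum>k<N n a. \<delta> n k) + (\<Sum>k\<in>{N n a..<N n b}. \<delta> n k)"
      using sum.atLeastLessThan_concat[of 0 "N n a" "N n b" "\<delta> n"] N_mono[of a b n] ab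
      by (simp add: atLeast0LessThan)
    hence eq: "(J (Suc n) b - J n b) - (J (Suc n) a - J n a)
        = ?R b - ?R a + (\<Sum>k\<in>{N n a..<N n b}. \<delta> n k)"
      by (simp add: algebra_simps)
    have "norm ((J (Suc n) b - J n b) - (J (Suc n) a - J n a))
        \<le> norm (?R b) + norm (?R a) + norm (\<Sum>k\<in>{N n a..<N n b}. \<delta> n k)"
      unfolding eq using norm_triangle_ineq[of "?R b - ?R a"] norm_triangle_ineq4[of "?R b" "?R a"]
      by (meson add_right_mono order_trans)
    also have "\<dots> \<le> C * h n powr \<theta> + C * h n powr \<theta> +
        (\<Sum>k\<in>{N n a..<N n b}. C * h n powr \<theta>)"
    proof (intro add_mono sum_norm_le D \<delta>)
      fix k assume "k \<in> {N n a..<N n b}"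
      hence "g n (Suc k) \<le> g n (N n b)" by (intro g_mono) auto
      thus "g n (Suc k) \<le> 1" using N(1)[of b n] ab by simp
    qed (use ab in auto)
    also have "\<dots> = (real (N n b) - real (N n a) + 2) * (C * h n powr \<theta>)"
      using N_mono[of a b n] ab by (simp add: of_nat_diff algebra_simps)
    also have "\<dots> \<le> ((b - a) / h n + 3) * (C * h n powr \<theta>)"
      using N_diff[OF ab(1,2), of n] C by (intro mult_right_mono) auto
    finally show ?thesis .
  qed
  have conv: "convergent (\<lambda>n. J n t)" if t: "0 \<le> t" "t \<le> 1" for t
  proof -
    \<comment> \<open>At 0 all approximations coincide, so the estimate between 0 and
      \<open>t\<close> bounds the increments at \<open>t\<close> itself.\<close>
    have J00: "J n 0 = \<omega> 0 0" for n by (simp add: J_def N_def g_def)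
    have bound: "norm (J (Suc n) t - J n t) \<le> 4 * C * q ^ n" for n
    proof -
      have "norm (J (Suc n) t - J n t) \<le> (t / h n + 3) * (C * h n powr \<theta>)"
        using Dab[of 0 t n] t by (simp add: J00)
      also have "\<dots> \<le> (4 / h n) * (C * h n powr \<theta>)"
      proof (intro mult_right_mono)
        have "h n \<le> 1" by (simp add: h_def power_le_one)
        hence "t / h n \<le> 1 / h n" "3 \<le> 3 / h n"
          using h0[of n] t by (auto simp: le_divide_eq intro: divide_right_mono)
        thus "t / h n + 3 \<le> 4 / h n" using add_divide_distrib[of 1 3 "h n"] by linarith
      qed (use C in auto)
      also have "\<dots> = 4 * C * q ^ n" using h0[of n] by (simp add: h_powr)
      finally show ?thesis .
    qed
    have "summable (\<lambda>n. 4 * C * q ^ n)"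
      using q by (intro summable_mult summable_geometric) auto
    hence "summable (\<lambda>n. J (Suc n) t - J n t)"
      by (rule summable_comparison_test'[where N = 0]) (rule bound)
    hence "convergent (\<lambda>n. \<Sum>i<n. J (Suc i) t - J i t)"
      by (simp add: summable_iff_convergent)
    hence "convergent (\<lambda>n. J n t - J 0 t)" by (simp only: sum_lessThan_telescope[of "\<lambda>i. J i t"])
    thus ?thesis by (simp add: convergent_diff_const_right_iff)
  qed
  define L where "L t = lim (\<lambda>n. J n t)" for t
  have L: "(\<lambda>n. J n t) \<longlonglongrightarrow> L t" if "0 \<le> t" "t \<le> 1" for t
    using conv[OF that] by (simp add: L_def convergent_LIMSEQ_iff)
  show ?thesis
  proof (intro exI[of _ L] allI impI)
    fix a b :: real assume ab: "0 \<le> a" "a \<le> b" "b \<le> 1"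
    let ?M = "2 * 2 powr \<theta> + 7 * 2 powr (\<theta> - 1) / (1 - (1/2) powr (\<theta> - 1))"
    show "norm (L b - L a - \<omega> a b) \<le> ?M * C * (b - a) powr \<theta>"
    proof (cases "a = b")
      case True
      \<comment> \<open>The defect bound for three equal points reads
        \<open>C * 0 powr \<theta> = 0\<close>, so \<omega> vanishes on the diagonal.\<close>
      thus ?thesis using defect[of a a a] ab by simp
    next
      case False
      define d where "d = b - a"
      have d: "0 < d" "d \<le> 1" using ab False by (auto simp: d_def)
      \<comment> \<open>The scale satisfies \<open>d \<le> h n < 2 * d\<close>: coarse enough that
        at most one grid point separates \<open>a\<close> from \<open>b\<close>, fine enough that
        powers of \<open>h n\<close> are bounded by powers of \<open>2 * d\<close>.\<close>
      obtain n where n: "d \<le> h n" "h (Suc n) < d"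
      proof -
        have "h \<longlonglongrightarrow> 0" unfolding h_def[abs_def] by (intro LIMSEQ_power_zero) auto
        hence "eventually (\<lambda>n. h n < d) sequentially" using d by (auto simp: order_tendsto_iff)
        hence ex: "\<exists>n. h n < d" by (auto simp: eventually_sequentially)
        define m where "m = (LEAST n. h n < d)"
        have m: "h m < d" "\<And>k. k < m \<Longrightarrow> \<not> h k < d"
          using LeastI_ex[OF ex] not_less_Least unfolding m_def by auto
        have "m \<noteq> 0" using m(1) d by (auto simp: h_def intro: ccontr)
        then obtain k where "m = Suc k" using not0_implies_Suc by blast
        thus ?thesis using that[of k] m by force
      qed
      have b0: "b \<ge> 0" using ab by simp
      have base: "norm (J n b - J n a - \<omega> a b) \<le> 2 * C * h n powr \<theta>"
      proof -
        have Na: "g n (N n a) \<le> a" "a < g n (Suc (N n a))" using N[OF ab(1)] by auto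
        have Nb: "g n (N n b) \<le> b" "b < g n (Suc (N n b))" using N[OF b0] by auto
        have "g n (N n b) < g n (Suc (Suc (N n a)))"
          using Na Nb n(1) g_step[of n "Suc (N n a)"] by (simp add: d_def)
        hence "\<not> Suc (Suc (N n a)) \<le> N n b" using g_mono[of "Suc (Suc (N n a))" "N n b" n] by auto
        hence "N n b = N n a \<or> N n b = Suc (N n a)" using N_mono[OF ab(2), of n] by auto
        thus ?thesis
        proof
          assume eq: "N n b = N n a"
          have "J n b - J n a - \<omega> a b
              = - (\<omega> (g n (N n a)) a + \<omega> a b - \<omega> (g n (N n a)) b)"
            unfolding J_def eq by simp
          also have "norm \<dots> \<le> C * (b - g n (N n a)) powr \<theta>"
            unfolding norm_minus_cancel using ab Na by (intro defect g_nonneg) auto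
          also have "\<dots> \<le> C * h n powr \<theta>"
            using C Nb Na ab g_step[of n "N n a"] \<theta> eq by (intro mult_left_mono powr_mono2) auto
          also have "\<dots> \<le> 2 * C * h n powr \<theta>" using C by simp
          finally show ?thesis .
        next
          assume eq: "N n b = Suc (N n a)"
          let ?p = "g n (Suc (N n a))"
          have "J n b - J n a - \<omega> a b
              = (\<omega> a ?p + \<omega> ?p b - \<omega> a b) - (\<omega> (g n (N n a)) a + \<omega> a ?p - \<omega> (g n (N n a)) ?p)"
            unfolding J_def eq by simp
          also have "norm \<dots> \<le> C * (b - a) powr \<theta> + C * (?p - g n (N n a)) powr \<theta>"
            using ab Na Nb by (intro norm_triangle_le_diff add_mono defect g_nonneg) (auto simp: eq)
          also have "\<dots> \<le> C * h n powr \<theta> + C * h n powr \<theta>"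
            using C n(1) d \<theta> g_step[of n "N n a"]
            by (intro add_mono mult_left_mono powr_mono2) (auto simp: d_def)
          finally show ?thesis by simp
        qed
      qed
      have hn: "h n \<le> 2 * d" using n(2) by (simp add: hS)
      have tail: "norm (J (n + m) b - J (n + m) a - \<omega> a b)
          \<le> 2 * C * h n powr \<theta> + 7 * d * C * q ^ n / (1 - q)" for m
      proof -
        let ?D = "\<lambda>i. (J (Suc i) b - J i b) - (J (Suc i) a - J i a)"
        have tele: "J (n + m) b - J (n + m) a - \<omega> a b
            = (J n b - J n a - \<omega> a b) + (\<Sum>i<m. ?D (n + i))"
          by (induction m) (auto simp: algebra_simps)
        have Dn: "norm (?D (n + i)) \<le> 7 * d * C * q ^ n * q ^ i" for i
        proof -
          have hni: "h (n + i) \<le> 2 * d"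
          proof -
            have "h (n + i) \<le> h n" unfolding h_def by (intro power_decreasing) auto
            thus ?thesis using hn by simp
          qed
          have "norm (?D (n + i)) \<le> (d / h (n + i) + 3) * (C * h (n + i) powr \<theta>)"
            unfolding d_def by (rule Dab[OF ab])
          \<comment> \<open>Since \<open>h (n + i) \<le> 2 * d\<close>, the summand 3 is at most
            \<open>6 * d / h (n + i)\<close>; this is the origin of the 7.\<close>
          also have "\<dots> \<le> (7 * d / h (n + i)) * (C * h (n + i) powr \<theta>)"
            using hni h0[of "n + i"] C by (intro mult_right_mono) (auto simp: field_simps)
          also have "\<dots> = 7 * d * C * q ^ n * q ^ i"
            using h0[of "n + i"] by (simp add: h_powr power_add)
          finally show ?thesis .
        qed
        have geo: "(\<Sum>i<m. q ^ i) \<le> 1 / (1 - q)"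
        proof -
          have "(\<Sum>i<m. q ^ i) \<le> suminf ((^) q)"
            using q by (intro sum_le_suminf summable_geometric) auto
          thus ?thesis using q by (simp add: suminf_geometric)
        qed
        have "norm (\<Sum>i<m. ?D (n + i)) \<le> (\<Sum>i<m. 7 * d * C * q ^ n * q ^ i)"
          by (intro sum_norm_le Dn)
        also have "\<dots> = 7 * d * C * q ^ n * (\<Sum>i<m. q ^ i)" by (simp add: sum_distrib_left)
        also have "\<dots> \<le> 7 * d * C * q ^ n * (1 / (1 - q))"
          using geo d C q by (intro mult_left_mono) auto
        finally show ?thesis unfolding tele using base by (intro norm_triangle_le add_mono) auto
      qed
      have lim: "(\<lambda>m. J (n + m) b - J (n + m) a - \<omega> a b) \<longlonglongrightarrow> L b - L a - \<omega> a b"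
        using LIMSEQ_ignore_initial_segment[OF L[of b], of n]
          LIMSEQ_ignore_initial_segment[OF L[of a], of n] ab
        by (intro tendsto_diff tendsto_const) (auto simp: add.commute)
      have "norm (L b - L a - \<omega> a b) \<le> 2 * C * h n powr \<theta> + 7 * d * C * q ^ n / (1 - q)"
        by (rule LIMSEQ_le_const2[OF tendsto_norm[OF lim]]) (use tail in blast)
      \<comment> \<open>The two terms are the error at the starting scale and the geometric series
        of all finer scales.\<close>
      also have "\<dots> \<le> 2 * C * (2 powr \<theta> * d powr \<theta>)
          + 7 * d * C * (2 powr (\<theta> - 1) * d powr (\<theta> - 1)) / (1 - q)"
      proof (intro add_mono mult_left_mono divide_right_mono)
        show "h n powr \<theta> \<le> 2 powr \<theta> * d powr \<theta>"
          using powr_mono2[of \<theta> "h n" "2 * d"] hn h0[of n] d \<theta> by (simp add: powr_mult)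
        have "q ^ n = h n powr (\<theta> - 1)"
          by (simp add: h_def q_def powr_powr mult.commute flip: powr_realpow)
        thus "q ^ n \<le> 2 powr (\<theta> - 1) * d powr (\<theta> - 1)"
          using powr_mono2[of "\<theta> - 1" "h n" "2 * d"] hn h0[of n] d \<theta> by (simp add: powr_mult)
      qed (use C q d in auto)
      also have "\<dots> = ?M * C * (d powr \<theta>)"
      proof -
        have "d * d powr (\<theta> - 1) = d powr \<theta>" using d by (simp add: powr_diff)
        thus ?thesis by (simp add: q_def distrib_right)
      qed
      finally show ?thesis by (simp add: d_def)
    qed
  qed
qed


section \<open>Additive functions of segments and common refinements\<close>

definition additive_on :: "'a::euclidean_space set \<Rightarrow> ('a \<Rightarrow> 'a \<Rightarrow> 'b::real_normed_vector) \<Rightarrow> bool" where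
  "additive_on K Y \<longleftrightarrow>
     (\<forall>x y z. closed_segment x y \<subseteq> K \<longrightarrow> z \<in> closed_segment x y \<longrightarrow> Y x y = Y x z + Y z y)"

lemma additive_onD:
  "\<lbrakk>additive_on K Y; closed_segment x y \<subseteq> K; z \<in> closed_segment x y\<rbrakk> \<Longrightarrow> Y x y = Y x z + Y z y"
  unfolding additive_on_def by blast

text \<open>Additivity contains no sign rule for reversed segments. It therefore covers lengths too,
  and a comparison of two subdivisions also compares their total lengths.\<close>

lemma additive_on_dist: "additive_on K dist"
  unfolding additive_on_def using between[unfolded between_mem_segment] by metis

lemma linepath_eq: "linepath x y t = x + t *\<^sub>R (y - x)"
  by (simp add: linepath_def algebra_simps)

lemma linepath_linepath:
  "linepath (linepath x y a) (linepath x y b) t = linepath x y (a + t * (b - a))"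
  by (simp add: linepath_def algebra_simps)

lemma linepath_diff: "linepath x y b - linepath x y a = (b - a) *\<^sub>R (y - x)"
  by (simp add: linepath_eq algebra_simps)

lemma dist_linepath: "dist (linepath x y a) (linepath x y b) = \<bar>b - a\<bar> * dist x y"
proof -
  have "dist (linepath x y a) (linepath x y b) = norm (linepath x y b - linepath x y a)"
    by (simp add: dist_norm norm_minus_commute)
  thus ?thesis by (simp add: linepath_diff dist_norm norm_minus_commute)
qed

lemma linepath_image_interval:
  assumes "a \<le> b"
  shows "linepath x y ` {a..b} = closed_segment (linepath x y a) (linepath x y b)"
proof -
  let ?d = "y - x"
  have "closed_segment (a *\<^sub>R ?d) (b *\<^sub>R ?d) = (\<lambda>t. t *\<^sub>R ?d) ` closed_segment a b"
    by (rule closed_segment_linear_image) (auto intro!: linearI simp: algebra_simps)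
  hence "(+) x ` (\<lambda>t. t *\<^sub>R ?d) ` closed_segment a b = closed_segment (linepath x y a) (linepath x y b)"
    using closed_segment_translation[of x "a *\<^sub>R ?d" "b *\<^sub>R ?d"] by (simp add: linepath_eq)
  thus ?thesis
    using assms by (simp add: closed_segment_eq_real_ivl image_image linepath_eq)
qed

lemma linepath_in_segment: "\<lbrakk>0 \<le> t; t \<le> 1\<rbrakk> \<Longrightarrow> linepath x y t \<in> closed_segment x y"
  by (auto simp flip: linepath_image_01)

lemma additive_on_linepath:
  assumes Y: "additive_on K Y" and K: "closed_segment x y \<subseteq> K" and "0 \<le> a" "a \<le> b" "b \<le> 1"
  shows "Y (linepath x y a) (linepath x y b) = Y x (linepath x y b) - Y x (linepath x y a)"
proof -
  have "closed_segment x (linepath x y b) = linepath x y ` {0..b}"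
    using linepath_image_interval[of 0 b x y] assms by (simp add: linepath_eq)
  moreover have "\<dots> \<subseteq> closed_segment x y" using assms by (auto simp: linepath_in_segment)
  moreover have "linepath x y a \<in> linepath x y ` {0..b}" using assms by auto
  ultimately show ?thesis using additive_onD[OF Y, of x "linepath x y b" "linepath x y a"] K by auto
qed

definition chord_times :: "'a::euclidean_space \<Rightarrow> 'a \<Rightarrow> 'a set \<Rightarrow> real set" where
  "chord_times x y A = {t \<in> {0..1}. linepath x y t \<in> A}"

text \<open>The part of a chord inside a compact convex set is one segment; \<open>Y\<close> is
  evaluated on it in the direction of the chord. The empty case is separate because
  \<open>Inf\<close> and \<open>Sup\<close> of the empty set mean nothing here.\<close>

definition chord_value ::
  "('a::euclidean_space \<Rightarrow> 'a \<Rightarrow> 'b::real_normed_vector) \<Rightarrow> 'a \<Rightarrow> 'a \<Rightarrow> 'a set \<Rightarrow> 'b" where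
  "chord_value Y x y A = (let k = chord_times x y A in
     if k = {} then 0 else Y (linepath x y (Inf k)) (linepath x y (Sup k)))"

lemma chord_times_image: "linepath x y ` chord_times x y A = closed_segment x y \<inter> A"
  by (auto simp: chord_times_def simp flip: linepath_image_01)

lemma chord_times_interval:
  assumes "compact A" "convex A" "chord_times x y A \<noteq> {}"
  obtains a b where "chord_times x y A = {a..b}" "0 \<le> a" "a \<le> b" "b \<le> 1"
proof -
  have eq: "chord_times x y A = {0..1} \<inter> linepath x y -` A" by (auto simp: chord_times_def)
  have "closed (linepath x y -` A)"
    by (intro continuous_closed_vimage compact_imp_closed assms) (auto intro: continuous_intros)
  hence cpt: "compact (chord_times x y A)" unfolding eq by (intro compact_Int_closed) auto
  have "convex (linepath x y -` A)"
  proof (rule convexI)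
    fix s t u v :: real
    assume h: "s \<in> linepath x y -` A" "t \<in> linepath x y -` A" "0 \<le> u" "0 \<le> v" "u + v = 1"
    have "linepath x y (u *\<^sub>R s + v *\<^sub>R t) = (u + v) *\<^sub>R x + (u * s + v * t) *\<^sub>R (y - x)"
      using h by (simp add: linepath_eq)
    also have "\<dots> = u *\<^sub>R linepath x y s + v *\<^sub>R linepath x y t"
      by (simp add: linepath_eq algebra_simps)
    also have "\<dots> \<in> A" using h assms(2) by (auto simp: convex_def)
    finally show "u *\<^sub>R s + v *\<^sub>R t \<in> linepath x y -` A" by simp
  qed
  hence "connected (chord_times x y A)" unfolding eq
    by (intro convex_connected convex_Int) auto
  then obtain a b where ab: "chord_times x y A = {a..b}"
    using cpt connected_compact_interval_1 by blast
  with assms(3) have "a \<le> b" by auto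
  moreover have "0 \<le> a" "b \<le> 1"
    using ab \<open>a \<le> b\<close> by (auto simp: chord_times_def set_eq_iff)
  ultimately show ?thesis using ab that by blast
qed

text \<open>The sets \<open>A i\<close> cut parameter intervals out of \<open>{0..1}\<close> that
  overlap in finitely many points. They form a division, possibly with degenerate intervals, and the
  increments of \<open>Y x (linepath x y t)\<close> telescope over it.\<close>

lemma chord_value_sum:
  assumes Y: "additive_on K Y" and K: "closed_segment x y \<subseteq> K" and xy: "x \<noteq> y" and I: "finite I"
    and A: "\<And>i. i \<in> I \<Longrightarrow> compact (A i)" "\<And>i. i \<in> I \<Longrightarrow> convex (A i)"
    and overlap: "\<And>i j. \<lbrakk>i \<in> I; j \<in> I; i \<noteq> j\<rbrakk> \<Longrightarrow> finite (A i \<inter> A j)"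
    and cover: "finite (closed_segment x y - (\<Union>i\<in>I. A i))"
  shows "Y x y = (\<Sum>i\<in>I. chord_value Y x y (A i))"
proof -
  define k where "k i = chord_times x y (A i)" for i
  define I' where "I' = {i \<in> I. k i \<noteq> {}}"
  define J where "J t = Y x (linepath x y t)" for t
  define G where "G S = J (Sup S) - J (Inf S)" for S
  have inj: "inj (linepath x y)" using xy by (auto simp: inj_def linepath_eq)
  have k: "\<exists>a b. k i = {a..b} \<and> 0 \<le> a \<and> a \<le> b \<and> b \<le> 1" if "i \<in> I'" for i
  proof -
    have i: "i \<in> I" and ne: "chord_times x y (A i) \<noteq> {}" using that by (auto simp: I'_def k_def)
    show ?thesis unfolding k_def
      by (rule chord_times_interval[OF A(1)[OF i] A(2)[OF i] ne]) blast
  qed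
  have fin: "finite (k i \<inter> k j)" if "i \<in> I'" "j \<in> I'" "i \<noteq> j" for i j
  proof -
    have "linepath x y ` (k i \<inter> k j) \<subseteq> A i \<inter> A j" by (auto simp: k_def chord_times_def)
    moreover have "finite (A i \<inter> A j)" using overlap that by (simp add: I'_def)
    ultimately have "finite (linepath x y ` (k i \<inter> k j))" by (rule finite_subset)
    thus ?thesis using inj by (meson finite_imageD inj_on_subset subset_UNIV)
  qed
  have "(\<lambda>S. (Inf S, S)) ` k ` I' tagged_division_of {0..1::real}"
  proof (rule tagged_division_ofI)
    show "finite ((\<lambda>S. (Inf S, S)) ` k ` I')" using I by (auto simp: I'_def)
    fix t S assume S: "(t, S) \<in> (\<lambda>S. (Inf S, S)) ` k ` I'"
    then obtain i where i: "i \<in> I'" "S = k i" "t = Inf S" by auto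
    obtain a b where ab: "S = {a..b}" "0 \<le> a" "a \<le> b" "b \<le> 1" using k[OF i(1)] i(2) by auto
    show "t \<in> S" using ab i by simp
    show "S \<subseteq> {0..1}" using ab by auto
    show "\<exists>a b. S = cbox a b" using ab by auto
    fix t' S' assume S': "(t', S') \<in> (\<lambda>S. (Inf S, S)) ` k ` I'" and ne: "(t, S) \<noteq> (t', S')"
    then obtain j where j: "j \<in> I'" "S' = k j" "t' = Inf S'" by auto
    with ne i have "i \<noteq> j" by auto
    hence "interior (k i \<inter> k j) = {}" using fin i j by (intro empty_interior_finite) auto
    thus "interior S \<inter> interior S' = {}" using i j by simp
  next
    have closed: "closed (\<Union>i\<in>I'. k i)"
    proof (intro closed_UN)
      show "finite I'" using I by (simp add: I'_def)
      show "\<forall>i\<in>I'. closed (k i)" using k by (metis closed_atLeastAtMost)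
    qed
    have "t \<in> (\<Union>i\<in>I'. k i)" if "t \<in> {0..1}" "i \<in> I" "linepath x y t \<in> A i" for t i
    proof -
      have "t \<in> k i" using that by (simp add: k_def chord_times_def)
      thus ?thesis using that by (auto simp: I'_def)
    qed
    hence "linepath x y ` ({0..1} - (\<Union>i\<in>I'. k i)) \<subseteq> closed_segment x y - (\<Union>i\<in>I. A i)"
      by (fastforce simp: linepath_in_segment)
    hence "finite (linepath x y ` ({0..1} - (\<Union>i\<in>I'. k i)))" using cover finite_subset by blast
    hence fin': "finite ({0..1} - (\<Union>i\<in>I'. k i))"
      using inj by (meson finite_imageD inj_on_subset subset_UNIV)
    \<comment> \<open>The union is closed and misses only finitely many points, but a missed point
      would bring a whole interval with it.\<close>
    have "{0..1} \<subseteq> (\<Union>i\<in>I'. k i)"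
    proof
      fix t :: real assume t: "t \<in> {0..1}"
      show "t \<in> (\<Union>i\<in>I'. k i)"
      proof (rule ccontr)
        assume "t \<notin> (\<Union>i\<in>I'. k i)"
        then obtain e where e: "e > 0" "ball t e \<subseteq> - (\<Union>i\<in>I'. k i)"
          using closed by (metis ComplI open_Compl openE)
        have "\<exists>a b. a < b \<and> {a..b} \<subseteq> {0..1} \<inter> ball t e"
        proof (cases "t < 1")
          case True
          show ?thesis
            by (rule exI[of _ t], rule exI[of _ "min 1 (t + e/2)"])
              (use True t e in \<open>auto simp: ball_def dist_real_def min_def split: if_splits\<close>)
        next
          case False
          show ?thesis
            by (rule exI[of _ "max 0 (t - e/2)"], rule exI[of _ t])
              (use False t e in \<open>auto simp: ball_def dist_real_def max_def split: if_splits\<close>)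
        qed
        then obtain a b where ab: "a < b" "{a..b} \<subseteq> {0..1} \<inter> ball t e" by blast
        with e have "{a..b} \<subseteq> {0..1} - (\<Union>i\<in>I'. k i)" by blast
        hence "finite {a..b}" using fin' finite_subset by blast
        thus False using ab infinite_Icc by blast
      qed
    qed
    hence "(\<Union>i\<in>I'. k i) = {0..1}" by (auto simp: k_def chord_times_def)
    moreover have "{S. \<exists>t. (t, S) \<in> (\<lambda>S. (Inf S, S)) ` k ` I'} = k ` I'" by auto
    ultimately show "\<Union>{S. \<exists>t. (t, S) \<in> (\<lambda>S. (Inf S, S)) ` k ` I'} = {0..1}" by simp
  qed
  from additive_tagged_division_1[OF _ this, of J]
  have "J 1 - J 0 = (\<Sum>(t,S)\<in>(\<lambda>S. (Inf S, S)) ` k ` I'. J (Sup S) - J (Inf S))" by simp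
  also have "\<dots> = (\<Sum>S\<in>k ` I'. G S)"
    by (subst sum.reindex) (auto simp: inj_on_def G_def)
  also have "\<dots> = (\<Sum>i\<in>I'. G (k i))"
  proof (subst sum.reindex_nontrivial)
    \<comment> \<open>Distinct indices may cut out the same interval. It is then a single point,
      with zero increment.\<close>
    fix i j assume ij: "i \<in> I'" "j \<in> I'" "i \<noteq> j" "k i = k j"
    obtain a b where ab: "k i = {a..b}" "a \<le> b" using k[OF ij(1)] by auto
    have "finite {a..b}" using fin[OF ij(1-3)] ij(4) ab by simp
    hence "a = b" using ab infinite_Icc[of a b] by force
    thus "G (k i) = 0" using ab by (simp add: G_def)
  qed (use I in \<open>auto simp: I'_def\<close>)
  also have "\<dots> = (\<Sum>i\<in>I'. chord_value Y x y (A i))"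
  proof (intro sum.cong refl)
    fix i assume i: "i \<in> I'"
    obtain a b where ab: "k i = {a..b}" "0 \<le> a" "a \<le> b" "b \<le> 1" using k[OF i] by auto
    show "G (k i) = chord_value Y x y (A i)"
      using ab additive_on_linepath[OF Y K, of a b] by (simp add: G_def J_def chord_value_def k_def)
  qed
  also have "\<dots> = (\<Sum>i\<in>I. chord_value Y x y (A i))"
    by (rule sum.mono_neutral_left) (use I in \<open>auto simp: I'_def chord_value_def k_def\<close>)
  finally show ?thesis
    using additive_on_linepath[OF Y K, of 0 1] by (simp add: J_def linepath_eq)
qed

text \<open>Both values are taken on the common segment of the two chords. Its ends can be swapped
  only for chords of opposite directions, unless the common segment is a single point.\<close>

lemma chord_value_commute:
  assumes Y: "additive_on K Y" and K: "closed_segment x y \<subseteq> K" "closed_segment u v \<subseteq> K"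
    and direction: "infinite (closed_segment x y \<inter> closed_segment u v) \<Longrightarrow> (y - x) \<bullet> (v - u) > 0"
  shows "chord_value Y x y (closed_segment u v) = chord_value Y u v (closed_segment x y)"
proof (cases "closed_segment x y \<inter> closed_segment u v = {}")
  case True
  hence "chord_times x y (closed_segment u v) = {}" "chord_times u v (closed_segment x y) = {}"
    using chord_times_image[of x y "closed_segment u v"] chord_times_image[of u v "closed_segment x y"]
    by auto
  thus ?thesis by (simp add: chord_value_def)
next
  case False
  have ne: "chord_times x y (closed_segment u v) \<noteq> {}" "chord_times u v (closed_segment x y) \<noteq> {}"
    using False chord_times_image[of x y "closed_segment u v"]
      chord_times_image[of u v "closed_segment x y"] by auto
  obtain a b where ab: "chord_times x y (closed_segment u v) = {a..b}" "a \<le> b"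
    using chord_times_interval[OF _ _ ne(1)] by (metis compact_segment convex_closed_segment)
  obtain c d where cd: "chord_times u v (closed_segment x y) = {c..d}" "c \<le> d"
    using chord_times_interval[OF _ _ ne(2)] by (metis compact_segment convex_closed_segment)
  define p q r s where "p = linepath x y a" "q = linepath x y b" "r = linepath u v c" "s = linepath u v d"
  note defs = this
  have pq: "closed_segment p q = closed_segment x y \<inter> closed_segment u v"
    using chord_times_image[of x y "closed_segment u v"] ab by (simp add: linepath_image_interval defs)
  have rs: "closed_segment r s = closed_segment x y \<inter> closed_segment u v"
    using chord_times_image[of u v "closed_segment x y"] cd
    by (simp add: linepath_image_interval defs Int_commute)
  have val: "chord_value Y x y (closed_segment u v) = Y p q" "chord_value Y u v (closed_segment x y) = Y r s"
    using ab cd by (simp_all add: chord_value_def defs)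
  have "{p, q} = {r, s}" using pq rs by (metis closed_segment_eq)
  then consider "p = r" "q = s" | "p = s" "q = r" by (auto simp: doubleton_eq_iff)
  thus ?thesis
  proof cases
    case 2
    have "p = q"
    proof (rule ccontr)
      assume "p \<noteq> q"
      hence pos: "(y - x) \<bullet> (v - u) > 0" using direction pq by (metis finite_closed_segment)
      have "(q - p) \<bullet> (s - r) = (b - a) * (d - c) * ((y - x) \<bullet> (v - u))"
        by (simp add: defs linepath_diff)
      also have "\<dots> \<ge> 0" using ab cd pos by auto
      finally have "(q - p) \<bullet> (q - p) \<le> 0" using 2 inner_minus_right[of "q - p" "q - p"] by simp
      hence "(q - p) \<bullet> (q - p) = 0" using inner_ge_zero by (rule antisym)
      thus False using \<open>p \<noteq> q\<close> by (metis inner_eq_zero_iff right_minus_eq)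
    qed
    thus ?thesis using val 2 by simp
  qed (use val in simp)
qed

abbreviation edge_segment :: "'a::euclidean_space \<times> 'a \<Rightarrow> 'a set" where
  "edge_segment e \<equiv> closed_segment (fst e) (snd e)"

definition nonoverlapping :: "('a::euclidean_space \<times> 'a) set \<Rightarrow> bool" where
  "nonoverlapping E \<longleftrightarrow> finite E \<and> (\<forall>e\<in>E. fst e \<noteq> snd e) \<and>
     (\<forall>e\<in>E. \<forall>e'\<in>E. e \<noteq> e' \<longrightarrow> finite (edge_segment e \<inter> edge_segment e'))"

text \<open>Both sums equal the sum over the common refinement.\<close>

lemma additive_sum_edges_eq:
  assumes Y: "additive_on K Y" and E: "nonoverlapping E" and E': "nonoverlapping E'"
    and K: "\<Union>(edge_segment ` E) \<subseteq> K" "\<Union>(edge_segment ` E') \<subseteq> K"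
    and cover: "finite (\<Union>(edge_segment ` E) - \<Union>(edge_segment ` E'))"
      "finite (\<Union>(edge_segment ` E') - \<Union>(edge_segment ` E))"
    and direction: "\<And>x y u v. \<lbrakk>(x, y) \<in> E; (u, v) \<in> E';
        infinite (closed_segment x y \<inter> closed_segment u v)\<rbrakk> \<Longrightarrow> (y - x) \<bullet> (v - u) > 0"
  shows "(\<Sum>(x,y)\<in>E. Y x y) = (\<Sum>(x,y)\<in>E'. Y x y)"
proof -
  have split: "(\<Sum>(x,y)\<in>E. Y x y) =
      (\<Sum>e\<in>E. \<Sum>e'\<in>E'. chord_value Y (fst e) (snd e) (edge_segment e'))"
    if *: "nonoverlapping E" "nonoverlapping E'" "\<Union>(edge_segment ` E) \<subseteq> K"
      "finite (\<Union>(edge_segment ` E) - \<Union>(edge_segment ` E'))" for E E'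
  proof -
    have "Y (fst e) (snd e) = (\<Sum>e'\<in>E'. chord_value Y (fst e) (snd e) (edge_segment e'))"
      if e: "e \<in> E" for e
    proof (rule chord_value_sum[OF Y])
      show "finite (edge_segment e - \<Union>(edge_segment ` E'))"
        by (rule finite_subset[OF _ \<open>finite (\<Union>(edge_segment ` E) - _)\<close>]) (use e in blast)
    qed (use * e in \<open>auto simp: nonoverlapping_def\<close>)
    thus ?thesis by (simp add: case_prod_beta)
  qed
  have "(\<Sum>(x,y)\<in>E. Y x y) = (\<Sum>e\<in>E. \<Sum>e'\<in>E'. chord_value Y (fst e) (snd e) (edge_segment e'))"
    by (rule split) fact+
  also have "\<dots> = (\<Sum>e'\<in>E'. \<Sum>e\<in>E. chord_value Y (fst e) (snd e) (edge_segment e'))"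
    by (rule sum.swap)
  also have "\<dots> = (\<Sum>e'\<in>E'. \<Sum>e\<in>E. chord_value Y (fst e') (snd e') (edge_segment e))"
    using K direction by (intro sum.cong refl chord_value_commute[OF Y]) auto
  also have "\<dots> = (\<Sum>(x,y)\<in>E'. Y x y)"
    by (rule split[symmetric]) fact+
  finally show ?thesis .
qed


section \<open>Existence and uniqueness of the Young integral\<close>

definition hoelder_on :: "real \<Rightarrow> real \<Rightarrow> 'a::metric_space set \<Rightarrow> ('a \<Rightarrow> complex) \<Rightarrow> bool" where
  "hoelder_on \<alpha> c K f \<longleftrightarrow> (\<forall>x\<in>K. \<forall>y\<in>K. norm (f x - f y) \<le> c * dist x y powr \<alpha>)"

definition bracket :: "('a \<Rightarrow> complex) \<Rightarrow> ('a \<Rightarrow> complex) \<Rightarrow> 'a \<Rightarrow> 'a \<Rightarrow> complex" where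
  "bracket f g x y = f x * g y - g x * f y"

text \<open>Every term on the right is an increment of \<open>f\<close> times an increment of
  \<open>g\<close>, so for two functions of exponent \<alpha> the defect has order
  2\<alpha>.\<close>

lemma bracket_defect:
  "bracket f g a b + bracket f g b c - bracket f g a c =
     (f b - f a) * (g c - g b) - (g b - g a) * (f c - f b)"
  by (simp add: bracket_def algebra_simps)

text \<open>The uniqueness behind the Young integral: along a segment such a function has Hoelder
  exponent greater than 1. Identities between integrands thus need to hold only up to order
  \<theta>.\<close>

lemma additive_small_imp_zero:
  assumes "\<theta> > 1" and Z: "additive_on K Z"
    and small: "\<And>x y. closed_segment x y \<subseteq> K \<Longrightarrow> norm (Z x y) \<le> C * dist x y powr \<theta>"
    and K: "closed_segment x y \<subseteq> K"
  shows "Z x y = 0"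
proof -
  define h where "h t = Z x (linepath x y t)" for t
  have "h 1 = h 0"
  proof (rule hoelder_exponent_gt_one_constant[OF \<open>\<theta> > 1\<close>])
    fix a b :: real assume ab: "0 \<le> a" "a \<le> b" "b \<le> 1"
    have "closed_segment (linepath x y a) (linepath x y b) = linepath x y ` {a..b}"
      using ab by (simp add: linepath_image_interval)
    also have "\<dots> \<subseteq> closed_segment x y" using ab by (auto intro: linepath_in_segment)
    finally have "norm (Z (linepath x y a) (linepath x y b))
        \<le> C * dist (linepath x y a) (linepath x y b) powr \<theta>"
      using K by (intro small) auto
    thus "norm (h b - h a) \<le> C * dist x y powr \<theta> * (b - a) powr \<theta>"
      using ab additive_on_linepath[OF Z K ab] by (simp add: h_def dist_linepath powr_mult mult_ac)
  qed
  thus ?thesis using additive_on_linepath[OF Z K, of 0 1] by (simp add: h_def linepath_0' linepath_1')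
qed

text \<open>Sewing, applied to the bracket along each segment. \<open>M\<close> is chosen before the
  functions so that estimates are uniform over all pieces; its factor 2 counts the two products in
  \<open>bracket_defect\<close>.\<close>

lemma young_integral_exists:
  assumes \<alpha>: "2 * \<alpha> > 1"
  obtains M where "M \<ge> 0" "\<And>K f g cf cg. \<lbrakk>hoelder_on \<alpha> cf K f; hoelder_on \<alpha> cg K g; cf \<ge> 0; cg \<ge> 0\<rbrakk> \<Longrightarrow>
      \<exists>Y. additive_on K Y \<and> (\<forall>x y. closed_segment x y \<subseteq> K \<longrightarrow>
        norm (Y x y - bracket f g x (y::'a::euclidean_space)) \<le> M * (cf * cg) * dist x y powr (2 * \<alpha>))"
proof -
  define \<theta> where "\<theta> = 2 * \<alpha>"
  have \<theta>: "\<theta> > 1" using \<alpha> by (simp add: \<theta>_def)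
  define N where "N = 2 * 2 powr \<theta> + 7 * 2 powr (\<theta> - 1) / (1 - (1/2) powr (\<theta> - 1))"
  have "(1/2::real) powr (\<theta> - 1) < 1"
    using \<theta> powr_less_mono2_neg[of "-(\<theta> - 1)" 1 2] by (auto simp: powr_minus powr_divide inverse_eq_divide)
  hence N: "N \<ge> 0" by (simp add: N_def)
  show ?thesis
  proof (rule that[of "2 * N"])
    show "2 * N \<ge> 0" using N by simp
    fix K :: "'a set" and f g cf cg
    assume f: "hoelder_on \<alpha> cf K f" and g: "hoelder_on \<alpha> cg K g" and c: "cf \<ge> 0" "cg \<ge> 0"
    let ?w = "bracket f g"
    have "\<exists>J. \<forall>a b. 0 \<le> a \<longrightarrow> a \<le> b \<longrightarrow> b \<le> 1 \<longrightarrow>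
        norm (J b - J a - ?w (linepath x y a) (linepath x y b))
          \<le> N * (2 * (cf * cg) * dist x y powr \<theta>) * (b - a) powr \<theta>"
      if xy: "closed_segment x y \<subseteq> K" for x y
      unfolding N_def
    proof (rule sewing[OF \<theta>, of _ "\<lambda>a b. ?w (linepath x y a) (linepath x y b)"])
      show "0 \<le> 2 * (cf * cg) * dist x y powr \<theta>" using c by simp
      fix a b d :: real assume abd: "0 \<le> a" "a \<le> b" "b \<le> d" "d \<le> 1"
      let ?l = "linepath x y"
      have holder: "norm (u (?l t) - u (?l s)) \<le> k * (dist x y * (d - a)) powr \<alpha>"
        if "hoelder_on \<alpha> k K u" "k \<ge> 0" "a \<le> s" "s \<le> t" "t \<le> d" for u k s t
      proof -
        have "norm (u (?l t) - u (?l s)) \<le> k * dist (?l t) (?l s) powr \<alpha>"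
          using that abd xy by (auto simp: hoelder_on_def linepath_in_segment subset_iff)
        also have "\<dots> \<le> k * (dist x y * (d - a)) powr \<alpha>"
          using that abd \<alpha> by (intro mult_left_mono powr_mono2)
            (auto simp: dist_commute dist_linepath mult.commute intro!: mult_right_mono)
        finally show ?thesis .
      qed
      let ?D = "(dist x y * (d - a)) powr \<alpha>"
      have "norm (?w (?l a) (?l b) + ?w (?l b) (?l d) - ?w (?l a) (?l d))
          \<le> norm (f (?l b) - f (?l a)) * norm (g (?l d) - g (?l b))
            + norm (g (?l b) - g (?l a)) * norm (f (?l d) - f (?l b))"
        unfolding bracket_defect by (metis norm_mult norm_triangle_ineq4)
      also have "\<dots> \<le> (cf * ?D) * (cg * ?D) + (cg * ?D) * (cf * ?D)"
        using abd c by (intro add_mono mult_mono holder f g) auto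
      also have "\<dots> = 2 * (cf * cg) * (?D * ?D)" by simp
      also have "?D * ?D = dist x y powr \<theta> * (d - a) powr \<theta>"
      proof -
        have "\<alpha> + \<alpha> = \<theta>" by (simp add: \<theta>_def)
        thus ?thesis unfolding powr_add[symmetric] using abd by (simp add: powr_mult)
      qed
      finally show "norm (?w (?l a) (?l b) + ?w (?l b) (?l d) - ?w (?l a) (?l d))
          \<le> 2 * (cf * cg) * dist x y powr \<theta> * (d - a) powr \<theta>" by (simp add: mult.assoc)
    qed
    hence "\<forall>x y. \<exists>J. closed_segment x y \<subseteq> K \<longrightarrow> (\<forall>a b. 0 \<le> a \<longrightarrow> a \<le> b \<longrightarrow> b \<le> 1 \<longrightarrow>
        norm (J b - J a - ?w (linepath x y a) (linepath x y b))
          \<le> N * (2 * (cf * cg) * dist x y powr \<theta>) * (b - a) powr \<theta>)" by blast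
    then obtain J where J: "\<And>x y a b. \<lbrakk>closed_segment x y \<subseteq> K; 0 \<le> a; a \<le> b; b \<le> 1\<rbrakk> \<Longrightarrow>
        norm (J x y b - J x y a - ?w (linepath x y a) (linepath x y b))
          \<le> N * (2 * (cf * cg) * dist x y powr \<theta>) * (b - a) powr \<theta>" by metis
    define Y where "Y x y = J x y 1 - J x y 0" for x y
    \<comment> \<open>\<open>J\<close> was chosen for each segment separately, so the choice for a
      subsegment has to be compared with that for the whole. Both approximate the same bracket, and
      their difference has Hoelder exponent greater than 1.\<close>
    have sub: "Y (linepath x y a) (linepath x y b) = J x y b - J x y a"
      if xy: "closed_segment x y \<subseteq> K" and ab: "0 \<le> a" "a \<le> b" "b \<le> 1" for x y a b
    proof -
      let ?p = "linepath x y a" and ?q = "linepath x y b"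
      have "closed_segment ?p ?q = linepath x y ` {a..b}"
        using ab by (simp add: linepath_image_interval)
      also have "\<dots> \<subseteq> closed_segment x y" using ab by (auto intro: linepath_in_segment)
      finally have pq: "closed_segment ?p ?q \<subseteq> K" using xy by auto
      define h where "h t = J x y (a + t * (b - a)) - J ?p ?q t" for t
      have "h 1 = h 0"
      proof (rule hoelder_exponent_gt_one_constant[OF \<theta>])
        fix s t :: real assume st: "0 \<le> s" "s \<le> t" "t \<le> 1"
        let ?s = "a + s * (b - a)" and ?t = "a + t * (b - a)"
        let ?W = "?w (linepath ?p ?q s) (linepath ?p ?q t)"
        have "t * (b - a) \<le> 1 * (b - a)" using ab st by (intro mult_right_mono) auto
        hence ord: "0 \<le> ?s" "?s \<le> ?t" "?t \<le> 1" using ab st by (auto intro: mult_right_mono)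
        have "norm (h t - h s) = norm ((J x y ?t - J x y ?s - ?W) - (J ?p ?q t - J ?p ?q s - ?W))"
          by (simp add: h_def algebra_simps)
        also have "\<dots> \<le> N * (2 * (cf * cg) * dist x y powr \<theta>) * (?t - ?s) powr \<theta>
            + N * (2 * (cf * cg) * dist ?p ?q powr \<theta>) * (t - s) powr \<theta>"
          unfolding linepath_linepath
          by (rule order_trans[OF norm_triangle_ineq4
                add_mono[OF J[OF xy ord] J[OF pq st, unfolded linepath_linepath]]])
        also have "(?t - ?s) powr \<theta> = (b - a) powr \<theta> * (t - s) powr \<theta>"
        proof -
          have "?t - ?s = (b - a) * (t - s)" by (simp add: algebra_simps)
          thus ?thesis using ab st by (simp add: powr_mult)
        qed
        finally show "norm (h t - h s) \<le> (N * (2 * (cf * cg) * dist x y powr \<theta>) * (b - a) powr \<theta>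
            + N * (2 * (cf * cg) * dist ?p ?q powr \<theta>)) * (t - s) powr \<theta>"
          by (simp add: algebra_simps)
      qed
      thus ?thesis by (simp add: h_def Y_def algebra_simps)
    qed
    have "additive_on K Y" unfolding additive_on_def
    proof (intro allI impI)
      fix x y z assume xy: "closed_segment x y \<subseteq> K" and "z \<in> closed_segment x y"
      then obtain t where "0 \<le> t" "t \<le> 1" "z = linepath x y t" by (auto simp flip: linepath_image_01)
      thus "Y x y = Y x z + Y z y"
        using sub[OF xy, of 0 t] sub[OF xy, of t 1] by (simp add: Y_def linepath_0' linepath_1')
    qed
    moreover have "norm (Y x y - ?w x y) \<le> 2 * N * (cf * cg) * dist x y powr (2 * \<alpha>)"
      if "closed_segment x y \<subseteq> K" for x y
      using J[OF that, of 0 1] by (simp add: Y_def \<theta>_def mult_ac linepath_0' linepath_1')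
    ultimately show "\<exists>Y. additive_on K Y \<and> (\<forall>x y. closed_segment x y \<subseteq> K \<longrightarrow>
        norm (Y x y - ?w x y) \<le> 2 * N * (cf * cg) * dist x y powr (2 * \<alpha>))" by blast
  qed
qed


section \<open>Triangulations in the plane\<close>

text \<open>Twice the signed area of the triangle, positive for counterclockwise vertices; as a
  function of \<open>c\<close> it is affine and vanishes on the line through \<open>a\<close> and
  \<open>b\<close>.\<close>

definition orient :: "plane \<Rightarrow> plane \<Rightarrow> plane \<Rightarrow> real" where
  "orient a b c = (b - a) $ 1 * (c - a) $ 2 - (b - a) $ 2 * (c - a) $ 1"

text \<open>A quarter turn to the left: the direction \<open>rot (y - x)\<close> leads from the line
  through \<open>x\<close> and \<open>y\<close> to its left side.\<close>

definition rot :: "plane \<Rightarrow> plane" where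
  "rot u = vector [- u $ 2, u $ 1]"

lemma rot_nth [simp]: "rot u $ 1 = - u $ 2" "rot u $ 2 = u $ 1"
  by (simp_all add: rot_def)

lemma inner_plane: "(u::plane) \<bullet> v = u $ 1 * v $ 1 + u $ 2 * v $ 2"
  by (simp add: inner_vec_def sum_2)

lemma plane_eq_iff: "(u::plane) = v \<longleftrightarrow> u $ 1 = v $ 1 \<and> u $ 2 = v $ 2"
  by (simp add: vec_eq_iff forall_2)

lemma ccw_iff: "ccw xs \<longleftrightarrow> (\<exists>a b c. xs = [a, b, c] \<and> orient a b c > 0)"
  by (simp add: ccw_def orient_def)

lemma orient_rotate: "orient b c a = orient a b c"
  by (simp add: orient_def algebra_simps)

lemma orient_swap: "orient b a c = - orient a b c"
  by (simp add: orient_def algebra_simps)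

lemma orient_same [simp]: "orient a a c = 0" "orient a b a = 0" "orient a b b = 0"
  by (simp_all add: orient_def)

lemma orient_barycentric: "orient b c p + orient c a p + orient a b p = orient a b c"
  by (simp add: orient_def algebra_simps)

lemma orient_affine:
  "u + v = 1 \<Longrightarrow> orient a b (u *\<^sub>R p + v *\<^sub>R q) = u * orient a b p + v * orient a b q"
proof -
  assume "u + v = 1"
  hence v: "v = 1 - u" by simp
  show ?thesis unfolding v by (simp add: orient_def algebra_simps)
qed

lemma orient_affine3:
  "u + v + w = 1 \<Longrightarrow> orient a b (u *\<^sub>R p + v *\<^sub>R q + w *\<^sub>R r)
     = u * orient a b p + v * orient a b q + w * orient a b r"
proof -
  assume "u + v + w = 1"
  hence w: "w = 1 - u - v" by simp
  show ?thesis unfolding w by (simp add: orient_def algebra_simps)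
qed

lemma orient_add: "orient a b (p + t *\<^sub>R rot v) = orient a b p + t * ((b - a) \<bullet> v)"
  by (simp add: orient_def inner_plane algebra_simps)

lemma continuous_on_orient [continuous_intros]: "continuous_on A (orient a b)"
  unfolding orient_def[abs_def] by (intro continuous_intros)

lemma eventually_orient_pos: "orient a b p > 0 \<Longrightarrow> \<forall>\<^sub>F q in nhds p. orient a b q > 0"
  by (rule eventually_nhds_in_open[of "{q. 0 < orient a b q}", simplified])
    (auto intro!: open_Collect_less continuous_intros)

lemma triangle_eq:
  assumes D: "orient a b c > 0"
  shows "convex hull {a, b, c} = {p. orient a b p \<ge> 0 \<and> orient b c p \<ge> 0 \<and> orient c a p \<ge> 0}"
proof (intro equalityI subsetI)
  fix p assume "p \<in> convex hull {a, b, c}"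
  then obtain u v w where *: "u \<ge> 0" "v \<ge> 0" "w \<ge> 0" "u + v + w = 1"
    "p = u *\<^sub>R a + v *\<^sub>R b + w *\<^sub>R c" by (auto simp: convex_hull_3)
  have "orient b c a = orient a b c" "orient c a b = orient a b c"
    using orient_rotate by metis+
  thus "p \<in> {p. orient a b p \<ge> 0 \<and> orient b c p \<ge> 0 \<and> orient c a p \<ge> 0}"
    using * D by (simp add: orient_affine3)
next
  fix p assume "p \<in> {p. orient a b p \<ge> 0 \<and> orient b c p \<ge> 0 \<and> orient c a p \<ge> 0}"
  hence p: "orient a b p \<ge> 0" "orient b c p \<ge> 0" "orient c a p \<ge> 0" by auto
  let ?D = "orient a b c"
  \<comment> \<open>Cramer's rule: the values of \<open>orient\<close>, divided by
    \<open>?D\<close>, are the barycentric coordinates of \<open>p\<close>.\<close>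
  have "?D *\<^sub>R p = orient b c p *\<^sub>R a + orient c a p *\<^sub>R b + orient a b p *\<^sub>R c"
    by (simp add: plane_eq_iff orient_def algebra_simps)
  hence "p = (1 / ?D) *\<^sub>R (orient b c p *\<^sub>R a + orient c a p *\<^sub>R b + orient a b p *\<^sub>R c)"
    using D by (metis divide_self_if less_irrefl scaleR_one scaleR_scaleR times_divide_eq_left mult_1)
  hence "p = (orient b c p / ?D) *\<^sub>R a + (orient c a p / ?D) *\<^sub>R b + (orient a b p / ?D) *\<^sub>R c"
    by (simp add: scaleR_add_right)
  moreover have "orient b c p / ?D + orient c a p / ?D + orient a b p / ?D = 1"
    using orient_barycentric[of b c p a] D by (simp flip: add_divide_distrib)
  ultimately show "p \<in> convex hull {a, b, c}"
    using p D unfolding convex_hull_3 by fastforce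
qed

lemma triangle_interiorI:
  assumes "orient a b p > 0" "orient b c p > 0" "orient c a p > 0"
  shows "p \<in> interior (convex hull {a, b, c})"
proof -
  have D: "orient a b c > 0" using assms orient_barycentric[of b c p a] by simp
  have "open {q. orient a b q > 0 \<and> orient b c q > 0 \<and> orient c a q > 0}"
    by (intro open_Collect_conj open_Collect_less continuous_intros)
  moreover have "{q. orient a b q > 0 \<and> orient b c q > 0 \<and> orient c a q > 0} \<subseteq> convex hull {a, b, c}"
    unfolding triangle_eq[OF D] by auto
  ultimately show ?thesis using assms by (intro interiorI) auto
qed

lemma orient_eq_0_iff_collinear: "orient a b c = 0 \<longleftrightarrow> collinear {a, b, c}"
proof -
  have "collinear {a, b, c} \<longleftrightarrow> collinear {0, b - a, c - a}"
    using collinear_3[of b a c] by (simp add: insert_commute)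
  also have "\<dots> \<longleftrightarrow> orient a b c = 0"
  proof
    assume "collinear {0, b - a, c - a}"
    thus "orient a b c = 0" by (auto simp: collinear_lemma orient_def simp del: vector_minus_component)
  next
    assume o: "orient a b c = 0"
    define u v where "u = b - a" and "v = c - a"
    have uv: "u $ 1 * v $ 2 = u $ 2 * v $ 1" using o by (simp add: orient_def u_def v_def)
    have "\<exists>k. v = k *\<^sub>R u" if "u \<noteq> 0"
    proof (cases "u $ 1 = 0")
      case True
      hence "u $ 2 \<noteq> 0" using that by (simp add: plane_eq_iff)
      hence "v = (v $ 2 / u $ 2) *\<^sub>R u" using uv True by (simp add: plane_eq_iff)
      thus ?thesis by blast
    next
      case False
      hence "v = (v $ 1 / u $ 1) *\<^sub>R u" using uv by (simp add: plane_eq_iff field_simps)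
      thus ?thesis by blast
    qed
    thus "collinear {0, b - a, c - a}" by (auto simp: collinear_lemma u_def v_def)
  qed
  finally show ?thesis by simp
qed

lemma triangle_distinct: "orient a b c > 0 \<Longrightarrow> a \<noteq> b \<and> b \<noteq> c \<and> c \<noteq> a"
  by auto

lemma triangle_affine_independent: "orient a b c > 0 \<Longrightarrow> \<not> affine_dependent {a, b, c}"
  using orient_eq_0_iff_collinear[of a b c] by (auto simp: collinear_3_eq_affine_dependent)

lemma simplex_2_iff: "2 simplex K \<longleftrightarrow> (\<exists>a b c. orient a b c > 0 \<and> K = convex hull {a, b, c})"
proof
  assume "2 simplex K"
  then obtain C where C: "\<not> affine_dependent C" "int (card C) = 3" "K = convex hull C"
    by (auto simp: simplex_def)
  hence "card C = 3" by simp
  then obtain a b c where abc: "C = {a, b, c}" "a \<noteq> b" "b \<noteq> c" "a \<noteq> c" by (auto simp: card_3_iff)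
  hence "orient a b c \<noteq> 0" using C by (simp add: orient_eq_0_iff_collinear collinear_3_eq_affine_dependent)
  moreover have "orient b a c = - orient a b c" by (rule orient_swap)
  ultimately have "orient a b c > 0 \<or> orient b a c > 0" by auto
  thus "\<exists>a b c. orient a b c > 0 \<and> K = convex hull {a, b, c}"
  proof
    assume "orient a b c > 0"
    thus ?thesis using C(3) abc(1) by blast
  next
    assume "orient b a c > 0"
    moreover have "C = {b, a, c}" using abc(1) by auto
    ultimately show ?thesis using C(3) by blast
  qed
next
  assume "\<exists>a b c. orient a b c > 0 \<and> K = convex hull {a, b, c}"
  then obtain a b c where abc: "orient a b c > 0" "K = convex hull {a, b, c}" by blast
  moreover have "card {a, b, c} = 3" using triangle_distinct[OF abc(1)] by auto
  ultimately show "2 simplex K"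
    unfolding simplex_def using triangle_affine_independent[OF abc(1)]
    by (intro exI[of _ "{a, b, c}"]) simp
qed

text \<open>The hull determines its vertices as extreme points, and the sign of
  \<open>orient\<close> leaves only the three cyclic orders.\<close>

lemma triangle_edge_iff:
  assumes abc: "orient a b c > 0"
  shows "(\<exists>z. orient x y z > 0 \<and> convex hull {a, b, c} = convex hull {x, y, z})
    \<longleftrightarrow> (x, y) \<in> {(a, b), (b, c), (c, a)}"
proof
  assume "\<exists>z. orient x y z > 0 \<and> convex hull {a, b, c} = convex hull {x, y, z}"
  then obtain z where z: "orient x y z > 0" "convex hull {a, b, c} = convex hull {x, y, z}" by blast
  have "{p. p extreme_point_of convex hull {u, v, w}} = {u, v, w}" if "orient u v w > 0" for u v w
    using extreme_point_of_convex_hull_affine_independent[OF triangle_affine_independent[OF that]]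
    by (simp only: Collect_mem_eq)
  from this[OF abc] this[OF z(1)] have "{a, b, c} = {x, y, z}" unfolding z(2) by simp
  moreover have "orient a c b = - orient a b c" "orient c b a = - orient a b c" "orient b a c = - orient a b c"
    by (simp_all add: orient_def algebra_simps)
  ultimately show "(x, y) \<in> {(a, b), (b, c), (c, a)}"
    using abc z(1) triangle_distinct[OF z(1)] triangle_distinct[OF abc]
    by (elim equalityE) auto
next
  assume "(x, y) \<in> {(a, b), (b, c), (c, a)}"
  then consider "x = a" "y = b" | "x = b" "y = c" | "x = c" "y = a" by auto
  moreover have eq: "{a, b, c} = {b, c, a}" "{a, b, c} = {c, a, b}" by auto
  moreover have pos: "orient b c a > 0" "orient c a b > 0"
    using abc by (simp_all add: orient_rotate[of a b c] orient_rotate[of b c a])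
  ultimately show "\<exists>z. orient x y z > 0 \<and> convex hull {a, b, c} = convex hull {x, y, z}"
  proof cases
    case 1 thus ?thesis using abc by blast
  next
    case 2
    show ?thesis unfolding 2 eq(1) using pos(1) by blast
  next
    case 3
    show ?thesis unfolding 3 eq(2) using pos(2) by blast
  qed
qed

lemma orient_open_segment:
  assumes "z \<in> open_segment a b" "orient a b c > 0"
  shows "orient a b z = 0" "orient b c z > 0" "orient c a z > 0"
proof -
  obtain t where t: "0 < t" "t < 1" "z = (1 - t) *\<^sub>R a + t *\<^sub>R b"
    using assms(1) by (auto simp: in_segment)
  have "orient b c a = orient a b c" "orient c a b = orient a b c"
    using orient_rotate by metis+
  thus "orient a b z = 0" "orient b c z > 0" "orient c a z > 0"
    using t assms(2) by (simp_all add: orient_affine)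
qed

lemma triangle_edgeI:
  assumes D: "orient a b c > 0" and p: "p \<in> convex hull {a, b, c}" "orient a b p = 0"
  shows "p \<in> closed_segment a b"
proof -
  obtain u v w where *: "u \<ge> 0" "v \<ge> 0" "w \<ge> 0" "u + v + w = 1"
    "p = u *\<^sub>R a + v *\<^sub>R b + w *\<^sub>R c" using p(1) by (auto simp: convex_hull_3)
  have "w * orient a b c = 0" using p(2) * by (simp add: orient_affine3)
  hence "w = 0" using D by simp
  thus ?thesis using * by (auto simp: in_segment intro!: exI[of _ v])
qed

lemma triangle_edge_face:
  assumes "orient a b c > 0"
  shows "closed_segment a b face_of convex hull {a, b, c}"
  unfolding segment_convex_hull
    face_of_convex_hull_affine_independent[OF triangle_affine_independent[OF assms]]
  by (intro exI[of _ "{a, b}"]) auto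


section \<open>Face-to-face families of triangles and their directed edges\<close>

definition face_to_face :: "plane set set \<Rightarrow> bool" where
  "face_to_face \<T> \<longleftrightarrow> finite \<T> \<and> (\<forall>K\<in>\<T>. 2 simplex K) \<and>
     (\<forall>K\<in>\<T>. \<forall>K'\<in>\<T>. (K \<inter> K') face_of K)"

definition triangle_edges :: "plane set \<Rightarrow> (plane \<times> plane) set" where
  "triangle_edges K = {(x, y). \<exists>z. orient x y z > 0 \<and> K = convex hull {x, y, z}}"

text \<open>Two triangles that share an edge traverse it in opposite directions; the edges without a
  partner form the boundary, with the region on the left.\<close>

definition boundary_edges :: "plane set set \<Rightarrow> (plane \<times> plane) set" where
  "boundary_edges \<T> =
     {(x, y) \<in> \<Union>(triangle_edges ` \<T>). (y, x) \<notin> \<Union>(triangle_edges ` \<T>)}"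

text \<open>A description of boundary edges that does not refer to a triangulation. It makes edges
  of different triangulations, of similar copies and of nested regions comparable.\<close>

definition left_edge :: "plane set \<Rightarrow> plane \<Rightarrow> plane \<Rightarrow> bool" where
  "left_edge R x y \<longleftrightarrow> x \<noteq> y \<and>
     (\<forall>z\<in>open_segment x y. \<forall>\<^sub>F q in nhds z. q \<in> R \<longleftrightarrow> orient x y q \<ge> 0)"

lemma face_to_face_subset: "\<lbrakk>face_to_face \<T>; \<S> \<subseteq> \<T>\<rbrakk> \<Longrightarrow> face_to_face \<S>"
  unfolding face_to_face_def by (meson finite_subset subset_iff)

lemma open_segment_triangle: "z \<in> open_segment a b \<Longrightarrow> z \<in> convex hull {a, b, c}"
  using hull_mono[of "{a, b}" "{a, b, c}"] by (auto simp: open_segment_def segment_convex_hull)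

lemma triangle_edges_triangle:
  "orient a b c > 0 \<Longrightarrow> triangle_edges (convex hull {a, b, c}) = {(a, b), (b, c), (c, a)}"
  using triangle_edge_iff[of a b c] by (auto simp: triangle_edges_def)

lemma finite_triangle_edges: "finite (triangle_edges K)"
proof (cases "triangle_edges K = {}")
  case False
  then obtain a b c where "orient a b c > 0" "K = convex hull {a, b, c}"
    by (auto simp: triangle_edges_def)
  thus ?thesis by (simp add: triangle_edges_triangle)
qed simp

lemma triangle_edgesE:
  assumes "(x, y) \<in> triangle_edges K"
  obtains z where "orient x y z > 0" "K = convex hull {x, y, z}"
  using assms by (auto simp: triangle_edges_def)

lemma face_to_faceE:
  assumes "face_to_face \<T>" "K \<in> \<T>"
  obtains a b c where "orient a b c > 0" "K = convex hull {a, b, c}"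
  using assms by (auto simp: face_to_face_def simplex_2_iff)

lemma face_to_face_Int:
  assumes "face_to_face \<T>" "K \<in> \<T>" "K' \<in> \<T>"
  shows "(K \<inter> K') face_of K" "(K \<inter> K') face_of K'"
  using assms unfolding face_to_face_def by (auto simp: Int_commute)

lemma face_to_face_interior:
  assumes T: "face_to_face \<T>" "K \<in> \<T>" "K' \<in> \<T>" and p: "p \<in> interior K" "p \<in> interior K'"
  shows "K = K'"
proof -
  have "F = S" if "F face_of S" "p \<in> F" "p \<in> interior S" for F S :: "plane set"
    using that face_of_disjoint_interior by blast
  from this[OF face_to_face_Int(1)[OF T]] this[OF face_to_face_Int(2)[OF T]]
  show ?thesis using p interior_subset by blast
qed

lemma eventually_nhds_within_right:
  assumes "\<forall>\<^sub>F q in nhds (z::plane). P q"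
  obtains t where "t > 0" "P (z + t *\<^sub>R v)"
proof -
  have "((\<lambda>t. z + t *\<^sub>R v) \<longlongrightarrow> z + 0 *\<^sub>R v) (at_right 0)" by (intro tendsto_intros)
  hence "filterlim (\<lambda>t. z + t *\<^sub>R v) (nhds z) (at_right 0)" by simp
  hence "\<forall>\<^sub>F t in at_right 0. P (z + t *\<^sub>R v)" using assms eventually_compose_filterlim by blast
  moreover have "\<forall>\<^sub>F t in at_right 0. t > (0::real)" by (rule eventually_at_right_less)
  ultimately have "\<forall>\<^sub>F t in at_right (0::real). t > 0 \<and> P (z + t *\<^sub>R v)" by eventually_elim simp
  moreover have "at_right (0::real) \<noteq> bot" by simp
  ultimately show ?thesis using that eventually_happens by blast
qed

text \<open>Just to the left of an interior point of the edge lies a point interior to both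
  triangles, and distinct triangles have disjoint interiors.\<close>

lemma left_triangle_unique:
  assumes T: "face_to_face \<T>"
    and w: "orient x y w > 0" "convex hull {x, y, w} \<in> \<T>"
    and w': "orient x y w' > 0" "convex hull {x, y, w'} \<in> \<T>"
  shows "convex hull {x, y, w} = convex hull {x, y, w'}"
proof -
  have "x \<noteq> y" using w(1) by auto
  then obtain z where z: "z \<in> open_segment x y"
    using midpoint_in_open_segment by blast
  have "\<forall>\<^sub>F q in nhds z. orient y w q > 0 \<and> orient w x q > 0 \<and> orient y w' q > 0 \<and> orient w' x q > 0"
    using orient_open_segment[OF z w(1)] orient_open_segment[OF z w'(1)]
    by (intro eventually_conj eventually_orient_pos)
  then obtain t where t: "t > 0" and "let q = z + t *\<^sub>R rot (y - x) in
      orient y w q > 0 \<and> orient w x q > 0 \<and> orient y w' q > 0 \<and> orient w' x q > 0"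
    by (rule eventually_nhds_within_right[where v = "rot (y - x)"]) (auto simp: Let_def)
  moreover have "orient x y (z + t *\<^sub>R rot (y - x)) > 0"
    using t \<open>x \<noteq> y\<close> orient_open_segment(1)[OF z w(1)] by (simp add: orient_add)
  ultimately show ?thesis
    using face_to_face_interior[OF T w(2) w'(2), of "z + t *\<^sub>R rot (y - x)"]
    by (auto simp: Let_def intro: triangle_interiorI)
qed

lemma triangle_edges_disjoint:
  assumes "face_to_face \<T>" "K \<in> \<T>" "K' \<in> \<T>" "K \<noteq> K'"
  shows "triangle_edges K \<inter> triangle_edges K' = {}"
proof -
  have "K = K'" if e: "(x, y) \<in> triangle_edges K" "(x, y) \<in> triangle_edges K'" for x y
  proof -
    obtain w where "orient x y w > 0" "K = convex hull {x, y, w}"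
      by (rule triangle_edgesE[OF e(1)])
    moreover obtain w' where "orient x y w' > 0" "K' = convex hull {x, y, w'}"
      by (rule triangle_edgesE[OF e(2)])
    ultimately show ?thesis using left_triangle_unique[OF assms(1), of x y w w'] assms(2,3) by simp
  qed
  thus ?thesis using assms(4) by auto
qed

text \<open>A directed edge belongs to at most one triangle, so the double sum runs over the set of
  all directed edges. Outside \<open>boundary_edges\<close> this set is invariant under reversal,
  and an antisymmetric sum over it is its own negative.\<close>

lemma sum_triangle_edges_eq_boundary_edges:
  fixes \<eta> :: "plane \<Rightarrow> plane \<Rightarrow> complex"
  assumes T: "face_to_face \<T>" and antisym: "\<And>x y. \<eta> x y = - \<eta> y x"
  shows "(\<Sum>K\<in>\<T>. \<Sum>(x,y)\<in>triangle_edges K. \<eta> x y) = (\<Sum>(x,y)\<in>boundary_edges \<T>. \<eta> x y)"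
proof -
  let ?E = "\<Union>(triangle_edges ` \<T>)"
  have fin: "finite \<T>" using T by (simp add: face_to_face_def)
  hence finE: "finite ?E" by (auto simp: finite_triangle_edges)
  have "(\<Sum>K\<in>\<T>. \<Sum>(x,y)\<in>triangle_edges K. \<eta> x y) = (\<Sum>(x,y)\<in>?E. \<eta> x y)"
    using fin triangle_edges_disjoint[OF T]
    by (subst sum.UNION_disjoint) (auto simp: finite_triangle_edges)
  also have "\<dots> = (\<Sum>(x,y)\<in>boundary_edges \<T>. \<eta> x y) + (\<Sum>(x,y)\<in>?E - boundary_edges \<T>. \<eta> x y)"
    using finE by (subst sum.subset_diff[of "boundary_edges \<T>"]) (auto simp: boundary_edges_def)
  also have "(\<Sum>(x,y)\<in>?E - boundary_edges \<T>. \<eta> x y) = 0"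
  proof -
    let ?I = "?E - boundary_edges \<T>"
    have "(\<Sum>(x,y)\<in>?I. \<eta> x y) = (\<Sum>(x,y)\<in>?I. \<eta> y x)"
      by (rule sum.reindex_bij_witness[of _ prod.swap prod.swap]) (auto simp: boundary_edges_def)
    also have "\<dots> = - (\<Sum>(x,y)\<in>?I. \<eta> x y)"
      unfolding sum_negf[symmetric] case_prod_beta by (rule sum.cong[OF refl antisym])
    finally show ?thesis by simp
  qed
  finally show ?thesis by simp
qed

lemma boundary_edgesE:
  assumes "(x, y) \<in> boundary_edges \<T>"
  obtains w where "orient x y w > 0" "convex hull {x, y, w} \<in> \<T>"
    "\<And>w'. orient y x w' > 0 \<Longrightarrow> convex hull {y, x, w'} \<notin> \<T>"
proof -
  obtain K where K: "K \<in> \<T>" "(x, y) \<in> triangle_edges K" using assms by (auto simp: boundary_edges_def)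
  then obtain w where "orient x y w > 0" "K = convex hull {x, y, w}" by (elim triangle_edgesE)
  moreover have "convex hull {y, x, w'} \<notin> \<T>" if "orient y x w' > 0" for w'
  proof
    assume "convex hull {y, x, w'} \<in> \<T>"
    moreover have "(y, x) \<in> triangle_edges (convex hull {y, x, w'})"
      using that unfolding triangle_edges_def by blast
    ultimately show False using assms unfolding boundary_edges_def by blast
  qed
  ultimately show ?thesis using K(1) that by blast
qed

lemma triangle_local:
  assumes "z \<in> open_segment x y" "orient x y w > 0"
  shows "\<forall>\<^sub>F q in nhds z. q \<in> convex hull {x, y, w} \<longleftrightarrow> orient x y q \<ge> 0"
proof -
  have "\<forall>\<^sub>F q in nhds z. orient y w q > 0 \<and> orient w x q > 0"
    using orient_open_segment[OF assms] by (intro eventually_conj eventually_orient_pos)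
  thus ?thesis by eventually_elim (auto simp: triangle_eq[OF assms(2)])
qed

text \<open>The intersection of the two triangles is a face of the first and contains an interior
  point of the edge, hence the whole edge. The edge is then a face of \<open>K'\<close>, and its
  ends are vertices of \<open>K'\<close>.\<close>

lemma face_to_face_side:
  assumes T: "face_to_face \<T>" and w: "orient x y w > 0" "convex hull {x, y, w} \<in> \<T>"
    and K': "K' \<in> \<T>" and z: "z \<in> open_segment x y" "z \<in> K'"
  obtains w' where "orient x y w' \<noteq> 0" "K' = convex hull {x, y, w'}"
proof -
  let ?K = "convex hull {x, y, w}" and ?L = "convex hull {x, y, w} \<inter> K'"
  have L: "?L face_of ?K" "?L face_of K'" using face_to_face_Int[OF T w(2) K'] by auto
  have xyK: "x \<in> ?K" "y \<in> ?K" by (auto intro: hull_inc)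
  moreover have "z \<in> ?L"
    using z open_segment_triangle by blast
  ultimately have xy: "x \<in> ?L" "y \<in> ?L" using face_ofD[OF L(1) z(1)] by blast+
  hence "closed_segment x y \<subseteq> ?L"
    by (rule closed_segment_subset) (rule face_of_imp_convex[OF L(2)])
  hence "closed_segment x y face_of ?L"
    by (rule face_of_subset[OF triangle_edge_face[OF w(1)]]) simp
  hence face: "closed_segment x y face_of K'" using L(2) face_of_trans by blast
  obtain a b c where abc: "orient a b c > 0" "K' = convex hull {a, b, c}" by (rule face_to_faceE[OF T K'])
  have ext: "u \<in> {a, b, c}" if "u \<in> {x, y}" for u
  proof -
    have "u extreme_point_of closed_segment x y" using that by (auto simp: extreme_point_of_segment)
    hence "u extreme_point_of K'" using face extreme_point_of_face by blast
    thus ?thesis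
      using extreme_point_of_convex_hull_affine_independent[OF triangle_affine_independent[OF abc(1)]]
      by (simp add: abc(2))
  qed
  have "x \<noteq> y" using w(1) by auto
  have nz: "orient a b c \<noteq> 0" "orient b a c \<noteq> 0" "orient b c a \<noteq> 0" "orient c b a \<noteq> 0"
    "orient c a b \<noteq> 0" "orient a c b \<noteq> 0"
    using abc(1) by (simp_all add: orient_def algebra_simps)
  have perm: "{a, b, c} = {b, a, c}" "{a, b, c} = {b, c, a}" "{a, b, c} = {c, b, a}"
    "{a, b, c} = {c, a, b}" "{a, b, c} = {a, c, b}" by auto
  have "x \<in> {a, b, c}" "y \<in> {a, b, c}" using ext by auto
  then consider "x = a" "y = b" | "x = b" "y = a" | "x = b" "y = c" | "x = c" "y = b"
    | "x = c" "y = a" | "x = a" "y = c" using \<open>x \<noteq> y\<close> by auto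
  thus ?thesis
  proof cases
    case 1 thus ?thesis using that[of c] nz abc(2) by simp
  next
    case 2 thus ?thesis using that[of c] nz abc(2) perm(1) by simp
  next
    case 3 thus ?thesis using that[of a] nz abc(2) perm(2) by simp
  next
    case 4 thus ?thesis using that[of a] nz abc(2) perm(3) by simp
  next
    case 5 thus ?thesis using that[of b] nz abc(2) perm(4) by simp
  next
    case 6 thus ?thesis using that[of b] nz abc(2) perm(5) by simp
  qed
qed

lemma face_to_face_compact: "\<lbrakk>face_to_face \<T>; K \<in> \<T>\<rbrakk> \<Longrightarrow> compact K"
  by (metis face_to_faceE finite.emptyI finite_imp_compact_convex_hull finite_insert)

text \<open>Another triangle through an interior point of the edge would share the edge: on the left
  side it would be the same triangle, on the right side the edge would have a partner. So the union
  is locally a single triangle.\<close>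

lemma boundary_edge_left_edge:
  assumes T: "face_to_face \<T>" and xy: "(x, y) \<in> boundary_edges \<T>"
  shows "left_edge (\<Union>\<T>) x y"
  unfolding left_edge_def
proof (intro conjI ballI)
  obtain w where w: "orient x y w > 0" "convex hull {x, y, w} \<in> \<T>"
    and no: "\<And>w'. orient y x w' > 0 \<Longrightarrow> convex hull {y, x, w'} \<notin> \<T>"
    using boundary_edgesE[OF xy] by metis
  show "x \<noteq> y" using w by auto
  fix z assume z: "z \<in> open_segment x y"
  let ?K = "convex hull {x, y, w}"
  have far: "\<forall>\<^sub>F q in nhds z. q \<notin> K'" if K': "K' \<in> \<T>" "K' \<noteq> ?K" for K'
  proof -
    have "z \<notin> K'"
    proof
      assume "z \<in> K'"
      then obtain w' where w': "orient x y w' \<noteq> 0" "K' = convex hull {x, y, w'}"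
        using face_to_face_side[OF T w K'(1) z] by blast
      show False
      proof (cases "orient x y w' > 0")
        case True
        thus False using left_triangle_unique[OF T w True] w' K' by simp
      next
        case False
        hence "orient y x w' > 0" using w'(1) orient_swap[of y x w'] by simp
        moreover have "{x, y, w'} = {y, x, w'}" by auto
        ultimately show False using no w'(2) K'(1) by metis
      qed
    qed
    moreover have "open (- K')" using face_to_face_compact[OF T K'(1)] by (simp add: compact_imp_closed open_Compl)
    ultimately show ?thesis using eventually_nhds_in_open[of "- K'" z] by simp
  qed
  have "\<forall>\<^sub>F q in nhds z. \<forall>K'\<in>\<T> - {?K}. q \<notin> K'"
    using T far by (intro eventually_ball_finite) (auto simp: face_to_face_def)
  thus "\<forall>\<^sub>F q in nhds z. (q \<in> \<Union>\<T>) = (0 \<le> orient x y q)"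
    using triangle_local[OF z w(1)]
  proof eventually_elim
    case (elim q)
    thus ?case using w(2) by blast
  qed
qed

text \<open>An infinite intersection contains a point interior to both edges. The triangle to the
  left of \<open>(u, v)\<close> then also has \<open>(x, y)\<close> as an edge on whose left it
  lies, and different edges of one triangle share no such point.\<close>

lemma boundary_edges_nonoverlapping:
  assumes T: "face_to_face \<T>" and e: "(x, y) \<in> boundary_edges \<T>" "(u, v) \<in> boundary_edges \<T>"
    and ne: "(x, y) \<noteq> (u, v)"
  shows "finite (closed_segment x y \<inter> closed_segment u v)"
proof (rule ccontr)
  let ?S = "closed_segment x y \<inter> closed_segment u v"
  assume inf: "infinite ?S"
  obtain w where w: "orient x y w > 0" "convex hull {x, y, w} \<in> \<T>"
    and no: "\<And>w'. orient y x w' > 0 \<Longrightarrow> convex hull {y, x, w'} \<notin> \<T>"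
    using boundary_edgesE[OF e(1)] by metis
  obtain w' where w': "orient u v w' > 0" "convex hull {u, v, w'} \<in> \<T>"
    using boundary_edgesE[OF e(2)] by metis
  have "infinite (?S - {x, y, u, v})" using inf by simp
  hence "?S - {x, y, u, v} \<noteq> {}" by (metis finite.emptyI)
  then obtain z where "z \<in> ?S - {x, y, u, v}" by blast
  hence z: "z \<in> open_segment x y" "z \<in> open_segment u v" by (auto simp: open_segment_def)
  let ?K' = "convex hull {u, v, w'}"
  have "z \<in> ?K'"
    using z(2) by (rule open_segment_triangle)
  then obtain c where c: "orient x y c \<noteq> 0" "?K' = convex hull {x, y, c}"
    using face_to_face_side[OF T w w'(2) z(1)] by blast
  have pos: "orient x y c > 0"
  proof (rule ccontr)
    assume "\<not> ?thesis"
    hence "orient y x c > 0" using c(1) orient_swap[of y x c] by simp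
    moreover have "{x, y, c} = {y, x, c}" by auto
    ultimately show False using no w'(2) c(2) by metis
  qed
  have "(u, v) \<in> triangle_edges ?K'" using w'(1) by (auto simp: triangle_edges_def)
  hence "(u, v) \<in> {(x, y), (y, c), (c, x)}"
    unfolding c(2) triangle_edges_triangle[OF pos] .
  thus False
    using ne z(2) orient_open_segment[OF z(1) pos] orient_open_segment(1)[OF z(2) w'(1)] by auto
qed


lemma orient_closed_segment: "z \<in> closed_segment a b \<Longrightarrow> orient a b z = 0"
  by (auto simp: in_segment orient_affine)

lemma eventually_nhds_nonempty_punctured:
  assumes "\<forall>\<^sub>F q in nhds (z::plane). P q" "finite V"
  obtains q where "P q" "q \<notin> V"
proof -
  obtain U where U: "open U" "z \<in> U" "\<And>q. q \<in> U \<Longrightarrow> P q"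
    using assms(1) by (auto simp: eventually_nhds)
  have "infinite U" using U(1,2) by (metis empty_iff finite_imp_not_open)
  hence "U - V \<noteq> {}" using assms(2) by (metis finite.emptyI finite_Diff2)
  thus ?thesis using U(3) that by blast
qed

text \<open>Only vertices cause trouble, and a ball without finitely many points is still connected.
  About a frontier point off the boundary edges it would miss the frontier, hence lie inside or
  outside the union; neither is possible.\<close>

lemma boundary_edges_cover:
  assumes T: "face_to_face \<T>"
  shows "frontier (\<Union>\<T>) \<subseteq> \<Union>(edge_segment ` boundary_edges \<T>)"
proof
  fix z assume z: "z \<in> frontier (\<Union>\<T>)"
  let ?U = "\<Union>(edge_segment ` boundary_edges \<T>)" and ?E = "\<Union>(triangle_edges ` \<T>)"
  define V where "V = fst ` ?E"
  have fin: "finite \<T>" using T by (simp add: face_to_face_def)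
  hence finE: "finite ?E" by (auto simp: finite_triangle_edges)
  hence finV: "finite V" by (simp add: V_def)
  have closedT: "closed (\<Union>\<T>)" using fin face_to_face_compact[OF T] by (auto intro: compact_imp_closed)
  have closedU: "closed ?U"
    using finE by (intro closed_Union) (auto simp: boundary_edges_def intro: finite_subset[of _ ?E])
  \<comment> \<open>Away from vertices and boundary edges, a point of the union is interior to a
    triangle or to an edge shared by two triangles.\<close>
  have inner: "p \<in> interior (\<Union>\<T>)" if p: "p \<in> \<Union>\<T>" "p \<notin> V" "p \<notin> ?U" for p
  proof -
    obtain K where K: "K \<in> \<T>" "p \<in> K" using p(1) by blast
    obtain a b c where abc: "orient a b c > 0" "K = convex hull {a, b, c}" by (rule face_to_faceE[OF T K(1)])
    have edge: "p \<in> interior (\<Union>\<T>)" if xy: "orient x y w > 0" "K = convex hull {x, y, w}" "orient x y p = 0"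
      for x y w
    proof -
      have "(x, y) \<in> triangle_edges K" "(y, w) \<in> triangle_edges K"
        using triangle_edges_triangle[OF xy(1)] xy(2) by auto
      hence E: "(x, y) \<in> ?E" and "x \<in> V" "y \<in> V" using K(1) by (force simp: V_def)+
      have "p \<in> closed_segment x y" using triangle_edgeI[OF xy(1)] xy(2,3) K(2) by blast
      hence "(x, y) \<notin> boundary_edges \<T>" and z: "p \<in> open_segment x y"
        using p(2,3) \<open>x \<in> V\<close> \<open>y \<in> V\<close> by (auto simp: open_segment_def)
      with E have "(y, x) \<in> ?E" by (simp add: boundary_edges_def)
      then obtain K' where K': "K' \<in> \<T>" "(y, x) \<in> triangle_edges K'" by blast
      obtain w' where w': "orient y x w' > 0" "K' = convex hull {y, x, w'}"
        by (rule triangle_edgesE[OF K'(2)])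
      have "p \<in> open_segment y x" using z by (simp add: open_segment_commute)
      from triangle_local[OF this w'(1)] triangle_local[OF z xy(1)]
      have "\<forall>\<^sub>F q in nhds p. q \<in> \<Union>\<T>"
      proof eventually_elim
        case (elim q)
        have "orient y x q = - orient x y q" by (rule orient_swap)
        hence "q \<in> K \<or> q \<in> K'" using elim xy(2) w'(2) by auto
        thus ?case using K(1) K'(1) by blast
      qed
      thus ?thesis by (auto simp: eventually_nhds intro: interiorI)
    qed
    have "orient a b p \<ge> 0" "orient b c p \<ge> 0" "orient c a p \<ge> 0"
      using K(2) abc by (auto simp: triangle_eq)
    then consider "orient a b p > 0" "orient b c p > 0" "orient c a p > 0"
      | "orient a b p = 0" | "orient b c p = 0" | "orient c a p = 0" by fastforce
    moreover have pos: "orient b c a > 0" "orient c a b > 0"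
      using abc by (simp_all add: orient_rotate[of a b c] orient_rotate[of b c a])
    ultimately show ?thesis
    proof cases
      case 1
      hence "p \<in> interior K" using abc(2) triangle_interiorI by simp
      thus ?thesis using K(1) interior_mono[of K "\<Union>\<T>"] by blast
    next
      case 2 thus ?thesis using edge[of a b c] abc by simp
    next
      case 3
      have "K = convex hull {b, c, a}" unfolding abc(2) by (rule arg_cong[of _ _ "(hull) convex"]) auto
      from edge[OF pos(1) this 3] show ?thesis .
    next
      case 4
      have "K = convex hull {c, a, b}" unfolding abc(2) by (rule arg_cong[of _ _ "(hull) convex"]) auto
      from edge[OF pos(2) this 4] show ?thesis .
    qed
  qed
  show "z \<in> ?U"
  proof (rule ccontr)
    assume "z \<notin> ?U"
    hence "z \<in> - ?U" by simp
    then obtain e where e: "e > 0" "ball z e \<subseteq> - ?U"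
      using closedU by (meson open_Compl openE)
    let ?B = "ball z e - V"
    have conn: "connected ?B"
      by (rule connected_open_delete_finite) (use finV in auto)
    have "?B \<inter> frontier (\<Union>\<T>) = {}"
    proof -
      have "p \<notin> frontier (\<Union>\<T>)" if "p \<in> ?B" for p
      proof
        assume f: "p \<in> frontier (\<Union>\<T>)"
        hence "p \<in> \<Union>\<T>" using closedT frontier_subset_closed by blast
        hence "p \<in> interior (\<Union>\<T>)" using inner that e(2) by blast
        thus False using f by (simp add: frontier_def)
      qed
      thus ?thesis by blast
    qed
    hence "?B \<inter> \<Union>\<T> = {} \<or> ?B - \<Union>\<T> = {}" using connected_Int_frontier[OF conn, of "\<Union>\<T>"] by metis
    thus False
    proof
      \<comment> \<open>A triangle has interior points arbitrarily close to \<open>z\<close>, and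
        the finitely many vertices do not exhaust an open set.\<close>
      assume disj: "?B \<inter> \<Union>\<T> = {}"
      have "z \<in> \<Union>\<T>" using z closedT frontier_subset_closed by blast
      then obtain K where K: "K \<in> \<T>" "z \<in> K" by blast
      obtain a b c where abc: "orient a b c > 0" "K = convex hull {a, b, c}" by (rule face_to_faceE[OF T K(1)])
      have "interior K \<noteq> {}" unfolding abc(2)
        using interior_convex_hull_eq_empty[of "{a, b, c}"] triangle_affine_independent[OF abc(1)]
          triangle_distinct[OF abc(1)] by auto
      hence "closure (interior K) = closure K"
        using convex_closure_interior[of K] abc(2) by auto
      hence "z \<in> closure (interior K)" using K(2) closure_subset by blast
      hence "ball z e \<inter> interior K \<noteq> {}" 
        using e(1) open_Int_closure_eq_empty[of "ball z e" "interior K"]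
        by (metis IntI centre_in_ball empty_iff open_ball)
      then obtain q where q: "q \<in> ball z e \<inter> interior K" by blast
      have "\<forall>\<^sub>F p in nhds q. p \<in> ball z e \<inter> interior K"
        using q by (intro eventually_nhds_in_open) auto
      then obtain p where "p \<in> ball z e \<inter> interior K" "p \<notin> V"
        using finV by (rule eventually_nhds_nonempty_punctured)
      thus False using disj K(1) interior_subset[of K] by blast
    next
      assume "?B - \<Union>\<T> = {}"
      hence sub: "?B \<subseteq> \<Union>\<T>" by blast
      \<comment> \<open>The deleted vertices return because the union is closed.\<close>
      have "ball z e \<subseteq> \<Union>\<T>"
      proof
        fix q assume q: "q \<in> ball z e"
        show "q \<in> \<Union>\<T>"
        proof (rule ccontr)
          assume "q \<notin> \<Union>\<T>"
          hence "\<forall>\<^sub>F p in nhds q. p \<in> ball z e \<inter> - \<Union>\<T>"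
            using q closedT by (intro eventually_nhds_in_open) auto
          then obtain p where "p \<in> ball z e \<inter> - \<Union>\<T>" "p \<notin> V"
            using finV by (rule eventually_nhds_nonempty_punctured)
          thus False using sub by blast
        qed
      qed
      hence "z \<in> interior (\<Union>\<T>)" using e(1) by (meson centre_in_ball interiorI open_ball)
      thus False using z by (simp add: frontier_def)
    qed
  qed
qed

section \<open>Regions to the left of an edge\<close>

lemma left_edge_open_frontier:
  assumes e: "left_edge R x y" and z: "z \<in> open_segment x y"
  shows "z \<in> frontier R"
proof -
  have xy: "x \<noteq> y" and ev: "\<forall>\<^sub>F q in nhds z. q \<in> R \<longleftrightarrow> orient x y q \<ge> 0"
    using e z by (auto simp: left_edge_def)
  obtain t where t: "0 < t" "t < 1" "z = (1 - t) *\<^sub>R x + t *\<^sub>R y"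
    using z by (auto simp: in_segment)
  hence oz: "orient x y z = 0" by (simp add: orient_affine)
  have "z \<in> R" using eventually_nhds_x_imp_x[OF ev] oz by simp
  hence "z \<in> closure R" using closure_subset by blast
  moreover have "z \<in> closure (- R)"
  proof (rule ccontr)
    assume "z \<notin> closure (- R)"
    hence "z \<in> interior R" by (simp add: closure_complement)
    hence "\<forall>\<^sub>F q in nhds z. q \<in> R"
      using eventually_nhds_in_open[of "interior R" z] interior_subset[of R]
      by (auto elim: eventually_mono)
    hence "\<forall>\<^sub>F q in nhds z. orient x y q \<ge> 0" using ev by eventually_elim simp
    then obtain s where "s > 0" "orient x y (z + s *\<^sub>R rot (x - y)) \<ge> 0"
      by (rule eventually_nhds_within_right)
    hence "(y - x) \<bullet> (x - y) \<ge> 0" by (simp add: orient_add oz zero_le_mult_iff)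
    hence "(x - y) \<bullet> (x - y) \<le> 0" using inner_minus_left[of "x - y" "x - y"] by simp
    hence "(x - y) \<bullet> (x - y) = 0" using inner_ge_zero by (rule antisym)
    thus False using xy by simp
  qed
  ultimately show ?thesis by (simp add: frontier_closures)
qed

lemma left_edge_frontier:
  assumes "left_edge R x y"
  shows "closed_segment x y \<subseteq> frontier R"
proof -
  have "open_segment x y \<subseteq> frontier R" using left_edge_open_frontier[OF assms] by blast
  hence "closure (open_segment x y) \<subseteq> frontier R" by (rule closure_minimal) (rule frontier_closed)
  moreover have "x \<noteq> y" using assms by (simp add: left_edge_def)
  ultimately show ?thesis by (simp add: closure_open_segment)
qed

lemma boundary_edges_Union:
  assumes "face_to_face \<T>"
  shows "\<Union>(edge_segment ` boundary_edges \<T>) = frontier (\<Union>\<T>)"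
  using boundary_edges_cover[OF assms] left_edge_frontier[OF boundary_edge_left_edge[OF assms]] by fastforce

lemma finite_boundary_edges: "face_to_face \<T> \<Longrightarrow> finite (boundary_edges \<T>)"
  by (rule finite_subset[of _ "\<Union>(triangle_edges ` \<T>)"])
    (auto simp: boundary_edges_def face_to_face_def finite_triangle_edges)

lemma nonoverlapping_boundary_edges:
  assumes T: "face_to_face \<T>"
  shows "nonoverlapping (boundary_edges \<T>)"
  unfolding nonoverlapping_def
proof (intro conjI ballI impI finite_boundary_edges[OF T])
  fix e assume "e \<in> boundary_edges \<T>"
  thus "fst e \<noteq> snd e"
    using boundary_edge_left_edge[OF T, of "fst e" "snd e"] by (simp add: left_edge_def)
next
  fix e e' assume "e \<in> boundary_edges \<T>" "e' \<in> boundary_edges \<T>" "e \<noteq> e'"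
  thus "finite (edge_segment e \<inter> edge_segment e')"
    using boundary_edges_nonoverlapping[OF T, of "fst e" "snd e" "fst e'" "snd e'"] by simp
qed

lemma nonoverlapping_subset: "\<lbrakk>nonoverlapping E; E' \<subseteq> E\<rbrakk> \<Longrightarrow> nonoverlapping E'"
  unfolding nonoverlapping_def by (meson finite_subset subset_iff)

text \<open>Edges with infinitely many common points are collinear. At a common interior point the
  left side of the first lies in \<open>R\<close>, hence in \<open>R'\<close>, hence on the left
  side of the second, which excludes opposite directions.\<close>

lemma left_edges_same_direction:
  assumes e: "left_edge R x y" and e': "left_edge R' u v" and sub: "R \<subseteq> R'"
    and inf: "infinite (closed_segment x y \<inter> closed_segment u v)"
  shows "(y - x) \<bullet> (v - u) > 0"
proof -
  let ?S = "closed_segment x y \<inter> closed_segment u v - {x, y, u, v}"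
  have inf': "infinite ?S" using inf by simp
  then obtain z where z: "z \<in> ?S" by (metis all_not_in_conv finite.emptyI)
  have "infinite (?S - {z})" using inf' by simp
  then obtain p where p: "p \<in> ?S" "p \<noteq> z" by (metis all_not_in_conv finite.emptyI DiffD1 DiffD2 singletonI)
  have zo: "z \<in> open_segment x y" "z \<in> open_segment u v" using z by (auto simp: open_segment_def)
  have line: "\<exists>s. p - z = s *\<^sub>R (b - a)" if "z \<in> closed_segment a b" "p \<in> closed_segment a b" for a b
  proof -
    obtain s where s: "z = (1 - s) *\<^sub>R a + s *\<^sub>R b" using \<open>z \<in> closed_segment a b\<close> by (auto simp: in_segment)
    obtain t where t: "p = (1 - t) *\<^sub>R a + t *\<^sub>R b" using \<open>p \<in> closed_segment a b\<close> by (auto simp: in_segment)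
    have "p - z = (t - s) *\<^sub>R (b - a)" unfolding s t by (simp add: algebra_simps)
    thus ?thesis by blast
  qed
  obtain s t where st: "p - z = s *\<^sub>R (y - x)" "p - z = t *\<^sub>R (v - u)" using line z p by blast
  have "s \<noteq> 0" "t \<noteq> 0" using st p(2) by auto
  have "v - u = (1 / t) *\<^sub>R (p - z)" using st(2) \<open>t \<noteq> 0\<close> by simp
  hence k: "v - u = (s / t) *\<^sub>R (y - x)" using st(1) by simp
  have "\<forall>\<^sub>F q in nhds z. q \<in> R \<longleftrightarrow> orient x y q \<ge> 0" "\<forall>\<^sub>F q in nhds z. q \<in> R' \<longleftrightarrow> orient u v q \<ge> 0"
    using e e' zo by (auto simp: left_edge_def)
  hence "\<forall>\<^sub>F q in nhds z. orient x y q \<ge> 0 \<longrightarrow> orient u v q \<ge> 0"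
    by eventually_elim (use sub in auto)
  then obtain r where r: "r > 0" "orient x y (z + r *\<^sub>R rot (y - x)) \<ge> 0
      \<longrightarrow> orient u v (z + r *\<^sub>R rot (y - x)) \<ge> 0"
    by (rule eventually_nhds_within_right)
  have "orient x y z = 0" "orient u v z = 0" using zo by (auto simp: open_segment_def intro: orient_closed_segment)
  hence "r * ((v - u) \<bullet> (y - x)) \<ge> 0" using r by (simp add: orient_add)
  hence "(v - u) \<bullet> (y - x) \<ge> 0" using r(1) by (simp add: zero_le_mult_iff)
  moreover have "(v - u) \<bullet> (y - x) \<noteq> 0"
    using e \<open>s \<noteq> 0\<close> \<open>t \<noteq> 0\<close> unfolding k by (auto simp: left_edge_def)
  ultimately show ?thesis by (simp add: inner_commute)
qed

text \<open>Near an interior point of the edge, \<open>R\<close> is a half disc contained in \<open>R'\<close>; if the other half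
  disc does not meet \<open>frontier R'\<close>, then it lies in \<open>R'\<close> or in its complement.\<close>

lemma left_edge_frontier_dichotomy:
  assumes e: "left_edge R x y" and sub: "R \<subseteq> R'" "frontier R' \<subseteq> frontier R" and R': "closed R'"
  shows "closed_segment x y \<subseteq> frontier R' \<or> open_segment x y \<inter> frontier R' = {}"
proof -
  let ?O = "open_segment x y" and ?Z = "open_segment x y \<inter> frontier R'"
  have xy: "x \<noteq> y" using e by (simp add: left_edge_def)
  \<comment> \<open>The part of the open edge in \<open>frontier R'\<close> is relatively closed;
    this shows that it is relatively open, and connectedness of the edge decides.\<close>
  have loc: "\<exists>d>0. ball z d \<inter> ?O \<subseteq> frontier R'" if z: "z \<in> ?Z" for z
  proof -
    have "\<forall>\<^sub>F q in nhds z. q \<in> R \<longleftrightarrow> orient x y q \<ge> 0"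
      using e z by (auto simp: left_edge_def)
    then obtain d where d: "d > 0" "\<And>q. dist q z < d \<Longrightarrow> q \<in> R \<longleftrightarrow> orient x y q \<ge> 0"
      by (auto simp: eventually_nhds_metric)
    let ?L = "ball z d \<inter> {q. orient x y q < 0}"
    have loc: "q \<in> R \<longleftrightarrow> orient x y q \<ge> 0" if "q \<in> ball z d" for q
      using d(2)[of q] that by (simp add: dist_commute)
    have zl: "orient x y q = 0" if "q \<in> ?O" for q
      using that by (auto simp: in_segment orient_affine)
    have below: "\<exists>q'\<in>?L. dist q' q < \<epsilon>" if q: "q \<in> ball z d" "orient x y q = 0" and "\<epsilon> > 0" for q \<epsilon>
    proof -
      have "\<forall>\<^sub>F q' in nhds q. q' \<in> ball z d \<inter> ball q \<epsilon>"
        using q \<open>\<epsilon> > 0\<close> by (intro eventually_nhds_in_open) auto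
      then obtain s where s: "s > 0" "q + s *\<^sub>R rot (x - y) \<in> ball z d \<inter> ball q \<epsilon>"
        by (rule eventually_nhds_within_right)
      have "(y - x) \<bullet> (x - y) = - ((x - y) \<bullet> (x - y))" using inner_minus_left[of "x - y" "x - y"] by simp
      hence "orient x y (q + s *\<^sub>R rot (x - y)) < 0" using s(1) xy q(2) by (simp add: orient_add)
      thus ?thesis using s(2) by (intro bexI[of _ "q + s *\<^sub>R rot (x - y)"]) (auto simp: dist_commute)
    qed
    have "convex {q. orient x y q < 0}"
    proof (rule convexI)
      fix p q and u v :: real
      assume h: "p \<in> {q. orient x y q < 0}" "q \<in> {q. orient x y q < 0}" "0 \<le> u" "0 \<le> v" "u + v = 1"
      have "u * orient x y p + v * orient x y q < 0"
      proof (cases "u = 0")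
        case False
        hence "u * orient x y p < 0" "v * orient x y q \<le> 0"
          using h by (auto intro: mult_pos_neg mult_nonneg_nonpos)
        thus ?thesis by linarith
      qed (use h in auto)
      thus "u *\<^sub>R p + v *\<^sub>R q \<in> {q. orient x y q < 0}" using h by (simp add: orient_affine)
    qed
    hence conn: "connected ?L" by (intro convex_connected convex_Int) auto
    \<comment> \<open>The open half disc is disjoint from \<open>R\<close>, so it avoids the
      frontier of \<open>R\<close> and with it that of \<open>R'\<close>.\<close>
    have disj: "?L \<inter> frontier R' = {}"
    proof -
      have "q \<notin> frontier R" if q: "q \<in> ?L" for q
      proof -
        have "open ?L" by (intro open_Int open_Collect_less continuous_intros open_ball)
        hence "?L \<subseteq> interior (- R)" using loc by (intro interior_maximal) force+
        hence "q \<notin> closure R" using q by (auto simp: interior_complement)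
        thus ?thesis by (simp add: frontier_def)
      qed
      thus ?thesis using sub(2) by blast
    qed
    have "?L \<inter> R' = {}"
    proof (rule ccontr)
      assume "?L \<inter> R' \<noteq> {}"
      hence "?L - R' = {}" using connected_Int_frontier[OF conn, of R'] disj by metis
      hence "?L \<subseteq> R'" by blast
      hence "ball z d \<subseteq> R'" using loc sub(1) by force
      hence "z \<in> interior R'" using d(1) by (meson centre_in_ball interiorI open_ball)
      thus False using z by (simp add: frontier_def)
    qed
    hence "ball z d \<inter> ?O \<subseteq> frontier R'"
    proof (intro subsetI)
      fix q assume disj: "?L \<inter> R' = {}" and q: "q \<in> ball z d \<inter> ?O"
      have "q \<in> R'" using q loc zl sub(1) by auto
      moreover have "q \<notin> interior R'"
      proof
        assume "q \<in> interior R'"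
        then obtain \<epsilon> where "\<epsilon> > 0" "ball q \<epsilon> \<subseteq> R'" by (meson mem_interior)
        with below[of q \<epsilon>] q zl disj show False by (force simp: dist_commute)
      qed
      ultimately show "q \<in> frontier R'" using R' by (simp add: frontier_def)
    qed
    thus ?thesis using d(1) by blast
  qed
  have "openin (top_of_set ?O) ?Z"
    unfolding openin_contains_ball using loc by (auto intro: inf_le1)
  moreover have "closedin (top_of_set ?O) ?Z"
    by (intro closedin_closed_Int) (rule frontier_closed)
  moreover have "connected ?O" by (simp add: convex_connected convex_open_segment)
  ultimately have "?Z = {} \<or> ?Z = ?O" using connected_clopen by blast
  thus ?thesis
  proof
    assume "?Z = ?O"
    hence "closure ?O \<subseteq> frontier R'" by (intro closure_minimal frontier_closed) blast
    thus ?thesis using xy by (simp add: closure_open_segment)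
  qed blast
qed


section \<open>Similarities\<close>

definition similarity :: "real \<Rightarrow> (plane \<Rightarrow> plane) \<Rightarrow> bool" where
  "similarity r G \<longleftrightarrow> r > 0 \<and>
     (\<exists>A. linear A \<and> (\<forall>x. norm (A x) = r * norm x) \<and> G = (\<lambda>x. G 0 + A x))"

lemma similarityE:
  assumes "similarity r G"
  obtains A a where "r > 0" "linear A" "\<And>x. norm (A x) = r * norm x" "G = (\<lambda>x. a + A x)"
  using assms unfolding similarity_def by blast

lemma similarityI:
  assumes "r > 0" "linear A" "\<And>x. norm (A x) = r * norm x" "\<And>x. G x = a + A x"
  shows "similarity r G"
proof -
  have "G 0 = a" using assms(4)[of 0] linear_0[OF assms(2)] by simp
  hence "G = (\<lambda>x. G 0 + A x)" using assms(4) by auto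
  thus ?thesis using assms(1-3) unfolding similarity_def by blast
qed

lemma similarity_id: "similarity 1 id"
  by (rule similarityI[of 1 "\<lambda>x. x" _ 0]) (auto intro: linear_id[unfolded id_def])

lemma similarity_comp:
  assumes "similarity r G" "similarity s H"
  shows "similarity (r * s) (G \<circ> H)"
proof -
  obtain A a where A: "r > 0" "linear A" "\<And>x. norm (A x) = r * norm x" "G = (\<lambda>x. a + A x)"
    using similarityE[OF assms(1)] by metis
  obtain B b where B: "s > 0" "linear B" "\<And>x. norm (B x) = s * norm x" "H = (\<lambda>x. b + B x)"
    using similarityE[OF assms(2)] by metis
  show ?thesis
    by (rule similarityI[of _ "A \<circ> B" _ "a + A b"])
      (use A B in \<open>auto intro: linear_compose simp: linear_add\<close>)
qed

lemma similarity_dist: "similarity r G \<Longrightarrow> dist (G x) (G y) = r * dist x y"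
  by (elim similarityE) (simp add: dist_norm flip: linear_diff)

lemma similarity_pos: "similarity r G \<Longrightarrow> r > 0"
  by (simp add: similarity_def)

lemma similarity_inj:
  assumes "similarity r G"
  shows "inj G"
proof (rule injI)
  fix x y assume "G x = G y"
  hence "r * dist x y = 0" using similarity_dist[OF assms, of x y] by simp
  thus "x = y" using similarity_pos[OF assms] by simp
qed

lemma similarity_image:
  assumes "similarity r G"
  obtains A a where "linear A" "inj A" "\<And>S. G ` S = (+) a ` A ` S"
proof -
  obtain A a where A: "r > 0" "linear A" "\<And>x. norm (A x) = r * norm x" "G = (\<lambda>x. a + A x)"
    using similarityE[OF assms] by metis
  have "inj A" unfolding linear_injective_0[OF A(2)]
    using A(1,3) by (metis less_irrefl mult_eq_0_iff norm_eq_zero)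
  thus ?thesis using A by (intro that[of A a]) auto
qed

lemma similarity_interior: "similarity r G \<Longrightarrow> interior (G ` S) = G ` interior S"
  by (elim similarity_image) (simp add: interior_injective_linear_image interior_translation)

lemma similarity_closure: "similarity r G \<Longrightarrow> closure (G ` S) = G ` closure S"
  by (elim similarity_image) (simp add: closure_injective_linear_image closure_translation)

lemma similarity_frontier: "similarity r G \<Longrightarrow> frontier (G ` S) = G ` frontier S"
  by (simp add: frontier_def similarity_interior similarity_closure image_set_diff similarity_inj)

lemma similarity_continuous_on:
  assumes "similarity r G"
  shows "continuous_on S G"
proof -
  obtain A a where A: "linear A" "G = (\<lambda>x. a + A x)" using similarityE[OF assms] by metis
  have "continuous_on S A" using A(1) by (simp add: linear_continuous_on linear_conv_bounded_linear)
  thus ?thesis unfolding A(2) by (intro continuous_intros)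
qed

lemma similarity_compact: "similarity r G \<Longrightarrow> compact S \<Longrightarrow> compact (G ` S)"
  by (rule compact_continuous_image[OF similarity_continuous_on])

lemma similarity_linepath:
  assumes "similarity r G"
  shows "G (linepath x y t) = linepath (G x) (G y) t"
proof -
  obtain A a where A: "linear A" "G = (\<lambda>x. a + A x)" using similarityE[OF assms] by metis
  have "G (linepath x y t) = a + ((1 - t) *\<^sub>R A x + t *\<^sub>R A y)"
    by (simp add: A(2) linepath_def linear_add[OF A(1)] linear_cmul[OF A(1)])
  also have "\<dots> = linepath (G x) (G y) t" by (simp add: A(2) linepath_def algebra_simps)
  finally show ?thesis .
qed

lemma similarity_closed_segment: "similarity r G \<Longrightarrow> G ` closed_segment x y = closed_segment (G x) (G y)"
  by (simp add: similarity_linepath image_image flip: linepath_image_01)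

lemma similarity_open_segment: "similarity r G \<Longrightarrow> G ` open_segment x y = open_segment (G x) (G y)"
  by (simp add: open_segment_def image_set_diff similarity_inj similarity_closed_segment)

lemma similarity_eventually:
  assumes G: "similarity r G" and P: "\<forall>\<^sub>F p in nhds z. P (G p)"
  shows "\<forall>\<^sub>F q in nhds (G z). P q"
proof -
  obtain U where U: "open U" "z \<in> U" "\<And>p. p \<in> U \<Longrightarrow> P (G p)"
    using P by (auto simp: eventually_nhds)
  have "interior (G ` U) = G ` U" using similarity_interior[OF G, of U] U(1) by (simp add: interior_open)
  hence "open (G ` U)" by (metis open_interior)
  thus ?thesis unfolding eventually_nhds using U(2,3) by (intro exI[of _ "G ` U"]) auto
qed

text \<open>The factor \<open>k\<close> is the determinant of the linear part; its sign tells
  whether the map preserves orientation.\<close>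

lemma similarity_orient:
  assumes "similarity r G"
  obtains k where "k \<noteq> 0" "\<And>a b c. orient (G a) (G b) (G c) = k * orient a b c"
proof -
  obtain A a where A: "r > 0" "linear A" "\<And>x. norm (A x) = r * norm x" "G = (\<lambda>x. a + A x)"
    using similarityE[OF assms] by metis
  define e1 e2 :: plane where "e1 = vector [1, 0]" and "e2 = vector [0, 1]"
  define k where "k = orient (A 0) (A e1) (A e2)"
  have A0: "A 0 = 0" using A(2) by (rule linear_0)
  have coord: "A u = u $ 1 *\<^sub>R A e1 + u $ 2 *\<^sub>R A e2" for u
  proof -
    have "u = u $ 1 *\<^sub>R e1 + u $ 2 *\<^sub>R e2" by (simp add: plane_eq_iff e1_def e2_def)
    hence "A u = A (u $ 1 *\<^sub>R e1 + u $ 2 *\<^sub>R e2)" by (rule arg_cong)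
    thus ?thesis by (simp only: linear_add[OF A(2)] linear_cmul[OF A(2)])
  qed
  have mult: "orient (G x) (G y) (G z) = k * orient x y z" for x y z
  proof -
    have "orient (G x) (G y) (G z) = orient (A 0) (A (y - x)) (A (z - x))"
      by (simp add: A(4) A0 linear_diff[OF A(2)] orient_def)
    also have "\<dots> = k * orient x y z"
      unfolding k_def orient_def coord[of "y - x"] coord[of "z - x"] A0 by (simp add: algebra_simps)
    finally show ?thesis .
  qed
  have "k \<noteq> 0"
  proof
    assume "k = 0"
    hence col: "collinear {A 0, A e1, A e2}" by (simp add: k_def orient_eq_0_iff_collinear)
    have inj: "A x = 0 \<longleftrightarrow> x = 0" for x using A(1,3) by (metis norm_eq_zero mult_eq_0_iff less_irrefl)
    have "e1 \<noteq> 0" "e2 \<noteq> 0" by (auto simp: plane_eq_iff e1_def e2_def)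
    moreover have "A e2 \<noteq> c *\<^sub>R A e1" for c
    proof
      assume "A e2 = c *\<^sub>R A e1"
      hence "A (e2 - c *\<^sub>R e1) = 0" by (simp add: linear_diff[OF A(2)] linear_cmul[OF A(2)])
      hence "e2 = c *\<^sub>R e1" by (simp add: inj)
      thus False by (simp add: plane_eq_iff e1_def e2_def)
    qed
    ultimately show False using col inj by (auto simp: collinear_lemma A0)
  qed
  thus ?thesis using mult that by blast
qed

text \<open>A reflection exchanges left and right, so the image edge may have to be
  reversed.\<close>

lemma similarity_left_edge:
  assumes G: "similarity r G" and e: "left_edge R x y"
  shows "left_edge (G ` R) (G x) (G y) \<or> left_edge (G ` R) (G y) (G x)"
proof -
  obtain k where k: "k \<noteq> 0" "\<And>a b c. orient (G a) (G b) (G c) = k * orient a b c"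
    using similarity_orient[OF G] by blast
  have xy: "x \<noteq> y" and loc: "\<And>z. z \<in> open_segment x y \<Longrightarrow> \<forall>\<^sub>F q in nhds z. q \<in> R \<longleftrightarrow> orient x y q \<ge> 0"
    using e by (auto simp: left_edge_def)
  have ne: "G x \<noteq> G y" using xy similarity_inj[OF G] by (auto simp: inj_def)
  have mem: "G q \<in> G ` R \<longleftrightarrow> q \<in> R" for q using similarity_inj[OF G] by (auto simp: inj_def)
  show ?thesis
  proof (cases "k > 0")
    case True
    have "left_edge (G ` R) (G x) (G y)" unfolding left_edge_def
    proof (intro conjI ne ballI)
      fix z assume "z \<in> open_segment (G x) (G y)"
      then obtain p where p: "p \<in> open_segment x y" "z = G p"
        by (auto simp flip: similarity_open_segment[OF G])
      show "\<forall>\<^sub>F q in nhds z. (q \<in> G ` R) = (0 \<le> orient (G x) (G y) q)" unfolding p(2)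
        by (rule similarity_eventually[OF G])
          (use loc[OF p(1)] True in \<open>simp add: mem k(2) zero_le_mult_iff\<close>)
    qed
    thus ?thesis ..
  next
    case False
    have "left_edge (G ` R) (G y) (G x)" unfolding left_edge_def
    proof (intro conjI ballI)
      show "G y \<noteq> G x" using ne by simp
      fix z assume "z \<in> open_segment (G y) (G x)"
      then obtain p where p: "p \<in> open_segment x y" "z = G p"
        by (auto simp: open_segment_commute simp flip: similarity_open_segment[OF G])
      have "0 \<le> orient (G y) (G x) (G q) \<longleftrightarrow> 0 \<le> orient x y q" for q
        using False k(1) unfolding k(2) orient_swap[of y x q]
        by (simp add: mult_le_0_iff not_less)
      thus "\<forall>\<^sub>F q in nhds z. (q \<in> G ` R) = (0 \<le> orient (G y) (G x) q)" unfolding p(2)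
        by (intro similarity_eventually[OF G]) (use loc[OF p(1)] in \<open>simp add: mem\<close>)
    qed
    thus ?thesis ..
  qed
qed

text \<open>A similitude is determined by the images of a point and of an orthogonal frame. The ball
  ensures that such a frame fits into \<open>P\<close>, which may be neither convex nor
  connected.\<close>

lemma similitude_extends:
  assumes ball: "ball c e \<subseteq> P" "e > 0" and r: "r > 0"
    and F: "\<And>x y. \<lbrakk>x \<in> P; y \<in> P\<rbrakk> \<Longrightarrow> dist (F x) (F y) = r * dist x y"
  shows "\<exists>G. similarity r G \<and> (\<forall>x\<in>P. G x = F x)"
proof -
  define h where "h v = (1 / r) *\<^sub>R (F (c + v) - F c)" for v
  define d where "d = e / 2"
  have d: "d > 0" "d < e" using ball by (auto simp: d_def)
  define u1 u2 :: plane where "u1 = vector [d, 0]" and "u2 = vector [0, d]"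
  have c: "c \<in> P" using ball by auto
  have hdist: "norm (h v - h w) = norm (v - w)" if "c + v \<in> P" "c + w \<in> P" for v w
  proof -
    have "h v - h w = (1 / r) *\<^sub>R (F (c + v) - F (c + w))" by (simp add: h_def algebra_simps)
    hence "norm (h v - h w) = (1 / r) * dist (F (c + v)) (F (c + w))" using r by (simp add: dist_norm)
    thus ?thesis using F[OF that] r by (simp add: dist_norm)
  qed
  have h0: "h 0 = 0" by (simp add: h_def)
  have hnorm: "norm (h v) = norm v" if "c + v \<in> P" for v using hdist[OF that, of 0] c h0 by simp
  \<comment> \<open>Polarisation: \<open>h\<close> preserves norms and distances, hence inner
    products.\<close>
  have hinner: "h v \<bullet> h w = v \<bullet> w" if "c + v \<in> P" "c + w \<in> P" for v w
    using hdist[OF that] hnorm that by (simp add: dot_norm_neg)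
  have u: "c + u1 \<in> P" "c + u2 \<in> P" "u1 \<bullet> u1 = d * d" "u2 \<bullet> u2 = d * d" "u1 \<bullet> u2 = 0"
  proof -
    show uu: "u1 \<bullet> u1 = d * d" "u2 \<bullet> u2 = d * d" "u1 \<bullet> u2 = 0"
      by (simp_all add: inner_plane u1_def u2_def)
    hence "norm u1 = d" "norm u2 = d" using d by (simp_all add: norm_eq_sqrt_inner)
    thus "c + u1 \<in> P" "c + u2 \<in> P" using ball d by (auto simp: dist_norm subset_iff)
  qed
  define A where "A v = (v $ 1 / d) *\<^sub>R h u1 + (v $ 2 / d) *\<^sub>R h u2" for v :: plane
  have lin: "linear A"
    by (rule linearI) (simp_all add: A_def algebra_simps add_divide_distrib scaleR_add_left)
  have Ainner: "A v \<bullet> A v = v \<bullet> v" for v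
  proof -
    have "A v \<bullet> A v = (v $ 1 / d)\<^sup>2 * (h u1 \<bullet> h u1) + (v $ 2 / d)\<^sup>2 * (h u2 \<bullet> h u2)
        + 2 * (v $ 1 / d) * (v $ 2 / d) * (h u1 \<bullet> h u2)"
      by (simp add: A_def inner_add inner_commute power2_eq_square algebra_simps)
    also have "\<dots> = v \<bullet> v"
      using d u hinner[of u1 u1] hinner[of u2 u2] hinner[of u1 u2]
      by (simp add: inner_plane[of v v] power2_eq_square)
    finally show ?thesis .
  qed
  \<comment> \<open>\<open>A v\<close> is the combination of the image frame with the coordinates of
    \<open>v\<close>. Equal inner products with the frame force \<open>h v - A v\<close> to have
    length zero.\<close>
  have eq: "h v = A v" if v: "c + v \<in> P" for v
  proof -
    have "h v \<bullet> A v = (v $ 1 / d) * (v \<bullet> u1) + (v $ 2 / d) * (v \<bullet> u2)"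
      using hinner[OF v u(1)] hinner[OF v u(2)] by (simp add: A_def inner_add_right)
    also have "\<dots> = v \<bullet> v" using d by (simp add: inner_plane u1_def u2_def)
    finally have "h v \<bullet> A v = v \<bullet> v" .
    hence "(h v - A v) \<bullet> (h v - A v) = 0"
      using hinner[OF v v] Ainner[of v] by (simp add: inner_diff inner_commute)
    thus ?thesis by simp
  qed
  have "similarity r (\<lambda>x. F c + r *\<^sub>R A (x - c))"
  proof (rule similarityI[of _ "\<lambda>x. r *\<^sub>R A x" _ "F c - r *\<^sub>R A c"])
    show "linear (\<lambda>x. r *\<^sub>R A x)" using lin by (rule linear_compose_scale_right)
    show "norm (r *\<^sub>R A x) = r * norm x" for x
    proof -
      have "norm (A x) = norm x" using Ainner[of x] by (simp add: norm_eq_sqrt_inner)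
      thus ?thesis using r by simp
    qed
    show "F c + r *\<^sub>R A (x - c) = F c - r *\<^sub>R A c + r *\<^sub>R A x" for x
      by (simp add: linear_diff[OF lin] scaleR_diff_right)
  qed (rule r)
  moreover have "F c + r *\<^sub>R A (x - c) = F x" if "x \<in> P" for x
  proof -
    have "A (x - c) = (1 / r) *\<^sub>R (F x - F c)" using eq[of "x - c"] that by (simp add: h_def)
    thus ?thesis using r by simp
  qed
  ultimately show ?thesis by blast
qed


section \<open>Self-similar regions\<close>

lemma word_map_append: "word_map F (v @ w) = word_map F v \<circ> word_map F w"
  by (induction v) auto

lemma words_0: "words S 0 = {[]}"
  by (auto simp: words_def)

lemma words_Suc: "words S (Suc n) = (\<lambda>(j, w). j # w) ` (S \<times> words S n)"
  by (auto simp: words_def length_Suc_conv image_iff)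

lemma UN_words_Suc:
  "(\<Union>w\<in>words S (Suc n). word_map F w ` A) = (\<Union>j\<in>S. F j ` (\<Union>w\<in>words S n. word_map F w ` A))"
proof -
  have "(\<Union>w\<in>words S (Suc n). word_map F w ` A) = (\<Union>p\<in>S \<times> words S n. F (fst p) ` word_map F (snd p) ` A)"
    by (simp add: words_Suc image_comp case_prod_beta)
  also have "\<dots> = (\<Union>j\<in>S. F j ` (\<Union>w\<in>words S n. word_map F w ` A))" 
    unfolding image_UN by (auto intro: image_eqI) blast
  finally show ?thesis .
qed

lemma finite_words: "finite S \<Longrightarrow> finite (words S n)"
  by (induction n) (auto simp: words_0 words_Suc)

lemma sum_words_Suc:
  "(\<Sum>w\<in>words S (Suc n). f w) = (\<Sum>j\<in>S. \<Sum>w\<in>words S n. f (j # w))"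
  unfolding words_Suc
  by (subst sum.reindex) (auto simp: inj_on_def sum.cartesian_product case_prod_beta)

lemma sum_words_prod_list:
  fixes p :: "'j \<Rightarrow> real"
  shows "(\<Sum>w\<in>words S n. prod_list (map p w)) = (\<Sum>j\<in>S. p j) ^ n"
  by (induction n) (simp_all add: words_0 sum_words_Suc sum_distrib_left[symmetric] sum_distrib_right[symmetric])

text \<open>The space |X| without its cells. The maps are similarities of the whole plane, so that
  closure, interior and frontier commute with them.\<close>

locale self_similar_region =
  fixes P :: "plane set" and S :: "'j set" and G :: "'j \<Rightarrow> plane \<Rightarrow> plane" and r :: "'j \<Rightarrow> real"
  assumes compact_P: "compact P" and interior_P: "interior P \<noteq> {}"
    and finite_S: "finite S" and card_S: "card S \<ge> 2"
    and G: "\<And>j. j \<in> S \<Longrightarrow> similarity (r j) (G j)" and r_le_1: "\<And>j. j \<in> S \<Longrightarrow> r j \<le> 1"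
    and G_image: "\<And>j. j \<in> S \<Longrightarrow> G j ` P \<subseteq> P"
    and frontier_P: "frontier P \<subseteq> frontier (\<Union>j\<in>S. G j ` P)"
    and disjoint: "\<And>i j. \<lbrakk>i \<in> S; j \<in> S; i \<noteq> j\<rbrakk> \<Longrightarrow> interior (G i ` P) \<inter> interior (G j ` P) = {}"
begin

lemma closed_P: "closed P" using compact_P by (rule compact_imp_closed)

lemma G_interior:
  assumes "j \<in> S"
  shows "G j ` interior P \<subseteq> interior P"
  using interior_mono[OF G_image[OF assms]] by (simp add: similarity_interior[OF G[OF assms]])

lemma S_nonempty: "S \<noteq> {}" using card_S by auto

text \<open>An isometry \<open>G j\<close> would map a ball missed by \<open>G j ` P\<close> to infinitely many separated copies.\<close>

lemma r_less_1:
  assumes j: "j \<in> S"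
  shows "r j < 1"
proof (rule ccontr)
  assume "\<not> r j < 1"
  with r_le_1[OF j] have r1: "r j = 1" by simp
  have "S - {j} \<noteq> {}"
  proof
    assume "S - {j} = {}"
    hence "S \<subseteq> {j}" by blast
    hence "card S \<le> 1" using card_mono[of "{j}" S] by simp
    thus False using card_S by simp
  qed
  then obtain i where i: "i \<in> S" "i \<noteq> j" by blast
  obtain x0 where x0: "x0 \<in> interior P" using interior_P by blast
  define x where "x = G i x0"
  have xi: "x \<in> interior (G i ` P)" using x0 similarity_interior[OF G[OF i(1)], of P] by (auto simp: x_def)
  then obtain e where e: "e > 0" "ball x e \<subseteq> interior (G i ` P)" by (meson open_interior openE)
  define X where "X k = (G j ^^ k) x" for k
  have Xint: "X k \<in> interior P" for k
  proof (induction k)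
    case 0
    show ?case using xi interior_mono[OF G_image[OF i(1)]] by (auto simp: X_def)
  next
    case (Suc k)
    thus ?case using G_interior[OF j] by (auto simp: X_def)
  qed
  \<comment> \<open>All later points of the orbit are interior to the image of \<open>P\<close>
    under \<open>G j\<close>, which is disjoint from the ball about \<open>x\<close>.\<close>
  have far: "dist x (X (Suc m)) \<ge> e" for m
  proof (rule ccontr)
    assume "\<not> ?thesis"
    hence "X (Suc m) \<in> interior (G i ` P)" using e(2) by auto
    moreover have "X (Suc m) \<in> interior (G j ` P)"
      using Xint[of m] by (simp add: X_def similarity_interior[OF G[OF j]])
    ultimately show False using disjoint[OF i(1) j i(2)] by blast
  qed
  \<comment> \<open>For an isometry every gap in the orbit is congruent to a gap that starts at
    \<open>x\<close>.\<close>
  have shift: "dist (X k) (X (k + m)) = dist x (X m)" for k m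
    by (induction k) (simp_all add: X_def similarity_dist[OF G[OF j]] r1)
  have sep: "dist (X k) (X l) \<ge> e" if kl: "k < l" for k l
  proof -
    obtain m where "l = k + Suc m" using less_imp_Suc_add[OF kl] by auto
    thus ?thesis using shift[of k "Suc m"] far[of m] by simp
  qed
  have "\<forall>n. X n \<in> P" using Xint interior_subset by blast
  then obtain l f where lf: "strict_mono (f :: nat \<Rightarrow> nat)" "(X \<circ> f) \<longlonglongrightarrow> l"
    using compact_P[THEN compact_imp_seq_compact] unfolding seq_compact_def by metis
  hence "Cauchy (X \<circ> f)" by (intro LIMSEQ_imp_Cauchy)
  then obtain N where "\<And>m n. m \<ge> N \<Longrightarrow> n \<ge> N \<Longrightarrow> dist ((X \<circ> f) m) ((X \<circ> f) n) < e"
    using e(1) unfolding Cauchy_def by metis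
  hence "dist (X (f N)) (X (f (Suc N))) < e" by simp
  moreover have "f N < f (Suc N)" using lf(1) by (simp add: strict_mono_def)
  ultimately show False using sep[of "f N" "f (Suc N)"] by simp
qed

text \<open>A frontier point of the closed union lies in some image of \<open>P\<close> and in the
  interior of none.\<close>

lemma frontier_P_cover: "frontier P \<subseteq> (\<Union>j\<in>S. G j ` frontier P)"
proof
  fix x assume "x \<in> frontier P"
  hence x: "x \<in> frontier (\<Union>j\<in>S. G j ` P)" using frontier_P by blast
  have cl: "closed (\<Union>j\<in>S. G j ` P)"
    using finite_S G compact_P by (intro closed_UN) (auto intro!: compact_imp_closed similarity_compact)
  hence "x \<in> (\<Union>j\<in>S. G j ` P)" using x frontier_subset_closed by blast
  then obtain j where j: "j \<in> S" "x \<in> G j ` P" by blast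
  have "x \<notin> interior (G j ` P)"
    using x interior_mono[of "G j ` P" "\<Union>j\<in>S. G j ` P"] j(1) by (auto simp: frontier_def)
  hence "x \<in> frontier (G j ` P)" using j(2) closure_subset[of "G j ` P"] by (auto simp: frontier_def)
  thus "x \<in> (\<Union>j\<in>S. G j ` frontier P)" using j(1) similarity_frontier[OF G[OF j(1)]] by auto
qed

text \<open>A point of \<open>P\<close> farthest from the closure of the interior lies on the frontier, hence it is
  the image under some contraction \<open>G j\<close> of a point which is even farther away.\<close>

lemma closure_interior_P: "closure (interior P) = P"
proof
  let ?Q = "closure (interior P)"
  show "?Q \<subseteq> P" by (simp add: closed_P closure_minimal interior_subset)
  have ne: "?Q \<noteq> {}" using interior_P by simp
  have "P \<noteq> {}" using interior_P interior_subset by blast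
  then obtain p where p: "p \<in> P" "\<And>q. q \<in> P \<Longrightarrow> infdist q ?Q \<le> infdist p ?Q"
    using continuous_attains_sup[OF compact_P, of "\<lambda>x. infdist x ?Q"]
      continuous_on_infdist[OF continuous_on_id, of P ?Q] by blast
  have "infdist p ?Q = 0"
  proof (rule ccontr)
    assume M: "infdist p ?Q \<noteq> 0"
    hence "p \<notin> ?Q" by auto
    hence "p \<in> frontier P" using p(1) closure_subset by (auto simp: frontier_def)
    then obtain j q where jq: "j \<in> S" "q \<in> frontier P" "p = G j q" using frontier_P_cover by blast
    have "q \<in> P" using jq(2) closed_P frontier_subset_closed by blast
    obtain q' where q': "q' \<in> ?Q" "infdist q ?Q = dist q q'"
      using infdist_attains_inf[OF closed_closure ne] by blast
    have "G j ` ?Q \<subseteq> ?Q"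
      using closure_mono[OF G_interior[OF jq(1)]] by (simp add: similarity_closure[OF G[OF jq(1)]])
    hence "infdist p ?Q \<le> dist p (G j q')" using q'(1) by (intro infdist_le) auto
    also have "\<dots> = r j * infdist q ?Q" by (simp add: jq(3) similarity_dist[OF G[OF jq(1)]] q'(2))
    also have "\<dots> \<le> r j * infdist p ?Q"
      using p(2)[OF \<open>q \<in> P\<close>] similarity_pos[OF G[OF jq(1)]] by (intro mult_left_mono) auto
    also have "\<dots> < 1 * infdist p ?Q"
      using r_less_1[OF jq(1)] M infdist_nonneg[of p ?Q] by (intro mult_strict_right_mono) auto
    finally show False by simp
  qed
  show "P \<subseteq> ?Q"
  proof
    fix q assume "q \<in> P"
    hence "infdist q ?Q = 0" using p(2)[of q] \<open>infdist p ?Q = 0\<close> infdist_nonneg[of q ?Q] by simp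
    thus "q \<in> ?Q" using in_closed_iff_infdist_zero[OF closed_closure ne] by blast
  qed
qed

section \<open>Words, levels and the attractor\<close>

definition ratio :: "'j list \<Rightarrow> real" where "ratio w = prod_list (map r w)"

abbreviation W :: "'j list \<Rightarrow> plane \<Rightarrow> plane" where "W \<equiv> word_map G"

lemma ratio_simps [simp]: "ratio [] = 1" "ratio (j # w) = r j * ratio w" "ratio (v @ w) = ratio v * ratio w"
  by (simp_all add: ratio_def)

lemma W_similarity: "set w \<subseteq> S \<Longrightarrow> similarity (ratio w) (W w)"
  by (induction w) (auto intro: similarity_id similarity_comp[OF G])

lemma ratio_pos: "set w \<subseteq> S \<Longrightarrow> ratio w > 0"
  using W_similarity similarity_pos by blast

lemma W_image: "set w \<subseteq> S \<Longrightarrow> W w ` P \<subseteq> P"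
proof (induction w)
  case (Cons j w)
  have "W (j # w) ` P = G j ` (W w ` P)" by (simp add: image_comp)
  also have "\<dots> \<subseteq> G j ` P" using Cons by (intro image_mono) auto
  also have "\<dots> \<subseteq> P" using Cons.prems G_image by auto
  finally show ?case .
qed simp

lemma W_interior: "set w \<subseteq> S \<Longrightarrow> interior (W w ` P) = W w ` interior P"
  by (rule similarity_interior[OF W_similarity])

lemma W_frontier: "set w \<subseteq> S \<Longrightarrow> frontier (W w ` P) = W w ` frontier P"
  by (rule similarity_frontier[OF W_similarity])

lemma W_compact: "set w \<subseteq> S \<Longrightarrow> compact (W w ` P)"
  by (rule similarity_compact[OF W_similarity compact_P])

text \<open>After the common prefix \<open>u\<close> the two words enter different pieces. Their
  lengths may differ, as happens for the stopping words of the mass distribution.\<close>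

lemma W_disjoint:
  assumes "set u \<subseteq> S" "i \<in> S" "j \<in> S" "i \<noteq> j" "set v \<subseteq> S" "set w \<subseteq> S"
  shows "interior (W (u @ i # v) ` P) \<inter> interior (W (u @ j # w) ` P) = {}"
proof -
  have sub: "interior (W (u @ k # t) ` P) \<subseteq> W u ` interior (G k ` P)" if "k \<in> S" "set t \<subseteq> S" for k t
  proof -
    have "W (u @ k # t) ` P = W u ` (G k ` (W t ` P))" by (simp add: word_map_append image_comp o_assoc)
    also have "\<dots> \<subseteq> W u ` (G k ` P)" using W_image[OF that(2)] by blast
    finally have "interior (W (u @ k # t) ` P) \<subseteq> interior (W u ` (G k ` P))" by (rule interior_mono)
    thus ?thesis using similarity_interior[OF W_similarity[OF assms(1)]] by simp
  qed
  have "W u ` interior (G i ` P) \<inter> W u ` interior (G j ` P) = {}"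
    using disjoint[OF assms(2-4)] similarity_inj[OF W_similarity[OF assms(1)]]
    by (simp flip: image_Int)
  thus ?thesis using sub[OF assms(2,5)] sub[OF assms(3,6)] by blast
qed

lemma words_W_disjoint:
  assumes "v \<in> words S n" "w \<in> words S n" "v \<noteq> w"
  shows "interior (W v ` P) \<inter> interior (W w ` P) = {}"
proof -
  have "length v = length w" using assms by (simp add: words_def)
  from same_length_different[OF assms(3) this]
  obtain u i v' j w' where vw: "v = u @ i # v'" "w = u @ j # w'" "i \<noteq> j" by auto
  show ?thesis using assms(1,2) W_disjoint[of u i j v' w'] vw(3) unfolding vw(1,2) words_def by simp
qed

definition level :: "nat \<Rightarrow> plane set" where "level n = (\<Union>w\<in>words S n. W w ` P)"

lemma level_0: "level 0 = P" by (simp add: level_def words_0)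

lemma level_Suc: "level (Suc n) = (\<Union>j\<in>S. G j ` level n)"
  unfolding level_def by (rule UN_words_Suc)

lemma level_compact: "compact (level n)"
  unfolding level_def using finite_words[OF finite_S] W_compact
  by (intro compact_UN) (auto simp: words_def)

lemma level_decreasing: "level (Suc n) \<subseteq> level n"
proof (induction n)
  case 0
  show ?case using G_image by (auto simp: level_Suc level_0)
next
  case (Suc n)
  thus ?case unfolding level_Suc[of "Suc n"] level_Suc[of n] by blast
qed

lemma level_nonempty: "level n \<noteq> {}"
proof (induction n)
  case 0
  show ?case using interior_P interior_subset by (auto simp: level_0)
next
  case (Suc n)
  thus ?case using S_nonempty by (auto simp: level_Suc)
qed

lemma level_antimono: "m \<le> n \<Longrightarrow> level n \<subseteq> level m"
  using lift_Suc_antimono_le[of level] level_decreasing by blast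

definition attractor :: "plane set" where "attractor = (\<Inter>n. level n)"

lemma attractor_compact: "compact attractor"
  unfolding attractor_def using level_compact by (intro compact_Inter) auto

lemma attractor_nonempty: "attractor \<noteq> {}"
  unfolding attractor_def using level_compact level_nonempty level_antimono
  by (intro compact_nest) auto

lemma attractor_subset: "attractor \<subseteq> P"
  unfolding attractor_def using level_0 by blast

lemma attractor_fixed: "attractor = (\<Union>j\<in>S. G j ` attractor)"
proof
  show "(\<Union>j\<in>S. G j ` attractor) \<subseteq> attractor"
  proof
    fix x assume "x \<in> (\<Union>j\<in>S. G j ` attractor)"
    then obtain j y where jy: "j \<in> S" "y \<in> attractor" "x = G j y" by blast
    have "x \<in> level (Suc n)" for n using jy by (auto simp: level_Suc attractor_def)
    hence "x \<in> level n" for n using level_decreasing by blast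
    thus "x \<in> attractor" by (simp add: attractor_def)
  qed
  show "attractor \<subseteq> (\<Union>j\<in>S. G j ` attractor)"
  proof
    fix x assume x: "x \<in> attractor"
    show "x \<in> (\<Union>j\<in>S. G j ` attractor)"
    proof (rule ccontr)
      assume no: "x \<notin> (\<Union>j\<in>S. G j ` attractor)"
      \<comment> \<open>Otherwise injectivity of \<open>G j\<close> puts the one preimage of
        \<open>x\<close> into every level, hence into the attractor.\<close>
      have "\<exists>n. x \<notin> G j ` level n" if j: "j \<in> S" for j
      proof (rule ccontr)
        assume all: "\<not> ?thesis"
        then obtain y where y: "x = G j y" by blast
        have "y \<in> level n" for n
          using all similarity_inj[OF G[OF j]] y by (metis inj_image_mem_iff)
        thus False using no j y by (auto simp: attractor_def)
      qed
      then obtain n where n: "\<And>j. j \<in> S \<Longrightarrow> x \<notin> G j ` level (n j)" by metis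
      define N where "N = Max (n ` S)"
      have "x \<notin> G j ` level N" if "j \<in> S" for j
      proof -
        have "n j \<le> N" using that finite_S by (auto simp: N_def)
        thus ?thesis using n[OF that] level_antimono by blast
      qed
      hence "x \<notin> level (Suc N)" by (auto simp: level_Suc)
      thus False using x by (auto simp: attractor_def)
    qed
  qed
qed

definition rmax :: real where "rmax = Max (r ` S)"

lemma rmax: "0 < rmax" "rmax < 1" "\<And>j. j \<in> S \<Longrightarrow> r j \<le> rmax"
proof -
  have "rmax \<in> r ` S" unfolding rmax_def using finite_S S_nonempty by (intro Max_in) auto
  thus "0 < rmax" "rmax < 1" using r_less_1 similarity_pos[OF G] by auto
  show "\<And>j. j \<in> S \<Longrightarrow> r j \<le> rmax" using finite_S by (auto simp: rmax_def)
qed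

lemma ratio_le: "set w \<subseteq> S \<Longrightarrow> ratio w \<le> rmax ^ length w"
proof (induction w)
  case (Cons j w)
  hence "r j * ratio w \<le> rmax * rmax ^ length w"
    using rmax ratio_pos[of w] by (intro mult_mono) auto
  thus ?case by simp
qed simp

text \<open>A point \<open>W w p\<close> of level n is within \<open>rmax ^ n * D\<close> of the
  point \<open>W w k\<close> of \<open>K\<close>; hence a point of all levels has distance 0 from
  the closed set \<open>K\<close>.\<close>

lemma fixed_eq_attractor:
  assumes K: "K \<noteq> {}" "compact K" "K \<subseteq> P" "K = (\<Union>j\<in>S. G j ` K)"
  shows "K = attractor"
proof
  have "K \<subseteq> level n" for n
  proof (induction n)
    case 0 show ?case using K(3) by (simp add: level_0)
  next
    case (Suc n)
    have "(\<Union>j\<in>S. G j ` K) \<subseteq> level (Suc n)" using Suc by (auto simp: level_Suc)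
    thus ?case using K(4) by simp
  qed
  thus "K \<subseteq> attractor" by (auto simp: attractor_def)
  have WK: "W w ` K \<subseteq> K" if "set w \<subseteq> S" for w
    using that
  proof (induction w)
    case (Cons j w)
    have "W (j # w) ` K = G j ` W w ` K" by (simp add: image_comp)
    also have "\<dots> \<subseteq> G j ` K" using Cons by (intro image_mono) auto
    also have "\<dots> \<subseteq> K" using Cons.prems K(4) by auto
    finally show ?case .
  qed simp
  obtain k where k: "k \<in> K" using K(1) by blast
  obtain D where D: "D \<ge> 0" "\<And>x y. \<lbrakk>x \<in> P; y \<in> P\<rbrakk> \<Longrightarrow> dist x y \<le> D"
    using compact_imp_bounded[OF compact_P]
    by (metis diameter_bounded_bound diameter_ge_0)
  show "attractor \<subseteq> K"
  proof
    fix x assume x: "x \<in> attractor"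
    have le: "infdist x K \<le> rmax ^ n * D" for n
    proof -
      have "x \<in> level n" using x by (auto simp: attractor_def)
      then obtain w p where w: "w \<in> words S n" "p \<in> P" "x = W w p" by (auto simp: level_def)
      hence wS: "set w \<subseteq> S" and len: "length w = n" by (auto simp: words_def)
      have "infdist x K \<le> dist x (W w k)" using WK[OF wS] k by (intro infdist_le) auto
      also have "\<dots> = ratio w * dist p k" by (simp add: w(3) similarity_dist[OF W_similarity[OF wS]])
      also have "\<dots> \<le> rmax ^ n * D"
        using D(2)[OF w(2), of k] K(3) k ratio_le[OF wS] len ratio_pos[OF wS] rmax by (intro mult_mono) auto
      finally show ?thesis .
    qed
    have "(\<lambda>n. rmax ^ n * D) \<longlonglongrightarrow> 0"
      using rmax by (intro tendsto_mult_left_zero LIMSEQ_power_zero) auto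
    hence "infdist x K \<le> 0" by (rule LIMSEQ_le_const) (use le in auto)
    hence "infdist x K = 0" using infdist_nonneg[of x K] by simp
    thus "x \<in> K" using in_closed_iff_infdist_zero[OF compact_imp_closed[OF K(2)] K(1)] by blast
  qed
qed

lemma W_attractor: "set w \<subseteq> S \<Longrightarrow> W w ` attractor \<subseteq> attractor"
proof (induction w)
  case (Cons j w)
  have "W (j # w) ` attractor = G j ` W w ` attractor" by (simp add: image_comp)
  also have "\<dots> \<subseteq> G j ` attractor" using Cons by (intro image_mono) auto
  also have "\<dots> \<subseteq> attractor" using Cons.prems attractor_fixed by auto
  finally show ?case .
qed simp

text \<open>By \<open>frontier_P_cover\<close> each frontier point is the image of another one, and
  this can be iterated n times.\<close>

lemma frontier_P_level: "frontier P \<subseteq> level n"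
proof -
  have "frontier P \<subseteq> (\<Union>w\<in>words S n. W w ` frontier P)"
  proof (induction n)
    case 0 show ?case by (simp add: words_0)
  next
    case (Suc n)
    have "(\<Union>j\<in>S. G j ` frontier P) \<subseteq> (\<Union>j\<in>S. G j ` (\<Union>w\<in>words S n. W w ` frontier P))"
      by (intro UN_mono image_mono Suc order_refl)
    thus ?case unfolding UN_words_Suc using frontier_P_cover by (rule order_trans[rotated])
  qed
  also have "\<dots> \<subseteq> level n"
    unfolding level_def by (intro UN_mono image_mono frontier_subset_closed closed_P order_refl)
  finally show ?thesis .
qed

lemma frontier_P_attractor: "frontier P \<subseteq> attractor"
  using frontier_P_level by (auto simp: attractor_def)

lemma level_subset: "level n \<subseteq> P"
  using level_antimono[of 0 n] by (simp add: level_0)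

text \<open>Condition (a) persists at every level: a frontier point of \<open>P\<close> belongs to
  level n and is not interior even to the larger set \<open>P\<close>.\<close>

lemma frontier_P_frontier_level: "frontier P \<subseteq> frontier (level n)"
proof
  fix x assume x: "x \<in> frontier P"
  hence "x \<in> level n" using frontier_P_level by blast
  moreover have "x \<notin> interior (level n)" using x interior_mono[OF level_subset[of n]] by (auto simp: frontier_def)
  ultimately show "x \<in> frontier (level n)" using closure_subset by (auto simp: frontier_def)
qed

end


section \<open>Contraction ratios and Hausdorff dimension\<close>

text \<open>Half of \<eta> pays for a cover witnessing measure zero, the other half for enlarging
  its sets to open balls by geometrically decreasing amounts; compactness leaves finitely many. As
  \<open>s > 0\<close>, sets of diameter 0 can be enlarged too.\<close>

lemma hausdorff_null_ball_cover:
  fixes K :: "'a::metric_space set"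
  assumes K: "compact K" and null: "hausdorff_measure t K = 0" and t: "0 \<le> t" "t < s" and \<eta>: "\<eta> > 0"
  obtains N :: "nat set" and c d where "finite N" "\<And>i. i \<in> N \<Longrightarrow> 0 < d i \<and> d i < 1"
    "K \<subseteq> (\<Union>i\<in>N. ball (c i) (d i))" "(\<Sum>i\<in>N. d i powr s) < \<eta>"
proof -
  \<comment> \<open>Diameters at most 1/2 leave room for radii below 1, where raising the exponent
    from \<open>t\<close> to \<open>s\<close> decreases powers.\<close>
  have "hausdorff_premeasure t (1/2) K \<le> hausdorff_measure t K"
    unfolding hausdorff_measure_def by (intro SUP_upper) auto
  hence "hausdorff_premeasure t (1/2) K < ennreal (\<eta> / 2)" using null \<eta> by simp
  then obtain U :: "nat \<Rightarrow> 'a set" where U: "K \<subseteq> (\<Union>i. U i)" "\<And>i. bounded (U i)"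
    "\<And>i. diameter (U i) \<le> 1/2" "suminf (\<lambda>i. hausdorff_weight t (U i)) < ennreal (\<eta> / 2)"
    unfolding hausdorff_premeasure_def Inf_less_iff by auto
  define I where "I = {i. U i \<noteq> {}}"
  have diam0: "diameter (U i) \<ge> 0" for i by (rule diameter_ge_0[OF U(2)])
  have "\<exists>d. diameter (U i) < d \<and> d < 1 \<and> d powr s < diameter (U i) powr s + \<eta> / 2 * (1/2) ^ Suc i" for i
  proof -
    let ?x = "diameter (U i)"
    have "((\<lambda>d. d powr s) \<longlongrightarrow> ?x powr s) (at_right ?x)"
    proof (rule tendsto_powr')
      have "\<forall>\<^sub>F d in at_right ?x. 0 \<le> d"
        using eventually_at_right_less[of ?x] by eventually_elim (use diam0[of i] in simp)
      thus "?x \<noteq> 0 \<or> (0 < s \<and> (\<forall>\<^sub>F d in at_right ?x. 0 \<le> d))" using t by simp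
    qed (auto intro: tendsto_intros)
    moreover have "?x powr s < ?x powr s + \<eta> / 2 * (1/2) ^ Suc i" using \<eta> by simp
    ultimately have "\<forall>\<^sub>F d in at_right ?x. d powr s < ?x powr s + \<eta> / 2 * (1/2) ^ Suc i"
      by (rule order_tendstoD)
    moreover have "\<forall>\<^sub>F d in at_right ?x. d < 1"
      using U(3)[of i] by (intro order_tendstoD(2)[OF tendsto_ident_at]) simp
    moreover have "\<forall>\<^sub>F d in at_right ?x. ?x < d" by (rule eventually_at_right_less)
    ultimately have "\<forall>\<^sub>F d in at_right ?x. ?x < d \<and> d < 1 \<and> d powr s < ?x powr s + \<eta> / 2 * (1/2) ^ Suc i"
      by eventually_elim simp
    moreover have "at_right ?x \<noteq> bot" by simp
    ultimately show ?thesis using eventually_happens by blast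
  qed
  then obtain d where d: "\<And>i. diameter (U i) < d i" "\<And>i. d i < 1"
    "\<And>i. d i powr s < diameter (U i) powr s + \<eta> / 2 * (1/2) ^ Suc i" by metis
  define c where "c i = (SOME x. x \<in> U i)" for i
  have c: "c i \<in> U i" if "i \<in> I" for i
    using that unfolding c_def I_def by (auto intro: someI)
  have "K \<subseteq> (\<Union>i\<in>I. ball (c i) (d i))"
  proof
    fix x assume "x \<in> K"
    then obtain i where i: "x \<in> U i" using U(1) by blast
    hence iI: "i \<in> I" by (auto simp: I_def)
    have "dist (c i) x \<le> diameter (U i)" by (rule diameter_bounded_bound[OF U(2) c[OF iI] i])
    thus "x \<in> (\<Union>i\<in>I. ball (c i) (d i))" using d(1)[of i] iI by force
  qed
  then obtain N where N: "N \<subseteq> I" "finite N" "K \<subseteq> (\<Union>i\<in>N. ball (c i) (d i))"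
    using compactE_image[OF K, of I "\<lambda>i. ball (c i) (d i)"] by (metis open_ball)
  have weight: "ennreal (diameter (U i) powr s) \<le> hausdorff_weight t (U i)" if "i \<in> I" for i
  proof (cases "t = 0")
    case True
    have "diameter (U i) powr s \<le> 1" using diam0[of i] U(3)[of i] t by (intro powr_le1) auto
    thus ?thesis using that True by (simp add: hausdorff_weight_def I_def)
  next
    case False
    have "diameter (U i) powr s \<le> diameter (U i) powr t"
      using diam0[of i] U(3)[of i] t by (intro powr_mono') auto
    thus ?thesis using that False by (simp add: hausdorff_weight_def I_def ennreal_leI)
  qed
  have "ennreal (\<Sum>i\<in>N. diameter (U i) powr s) = (\<Sum>i\<in>N. ennreal (diameter (U i) powr s))"
    by (simp add: sum_ennreal)
  also have "\<dots> \<le> (\<Sum>i\<in>N. hausdorff_weight t (U i))" using weight N(1) by (intro sum_mono) auto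
  also have "\<dots> \<le> suminf (\<lambda>i. hausdorff_weight t (U i))" using N(2) by (intro sum_le_suminf) auto
  also have "\<dots> < ennreal (\<eta> / 2)" by (rule U(4))
  finally have s1: "(\<Sum>i\<in>N. diameter (U i) powr s) < \<eta> / 2"
    by (simp add: ennreal_less_iff sum_nonneg)
  have "(\<Sum>i\<in>N. (1/2::real) ^ Suc i) \<le> suminf (\<lambda>i. (1/2) ^ Suc i)"
    using N(2) by (intro sum_le_suminf) (auto intro: sums_summable[OF power_half_series])
  hence s2: "(\<Sum>i\<in>N. \<eta> / 2 * (1/2) ^ Suc i) \<le> \<eta> / 2"
    using \<eta> sums_unique[OF power_half_series] unfolding sum_distrib_left[symmetric] by simp
  have "(\<Sum>i\<in>N. d i powr s) \<le> (\<Sum>i\<in>N. diameter (U i) powr s + \<eta> / 2 * (1/2) ^ Suc i)"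
    using d(3) by (intro sum_mono) (auto intro: less_imp_le)
  also have "\<dots> < \<eta>" using s1 s2 unfolding sum.distrib by simp
  finally have "(\<Sum>i\<in>N. d i powr s) < \<eta>" .
  moreover have "0 < d i" for i using d(1)[of i] diam0[of i] by simp
  ultimately show ?thesis using that[of N d c] N d(2) by blast
qed

text \<open>If \<open>s \<le> 1\<close>, radii below 1 satisfy \<open>d \<le> d powr s\<close>, so
  balls with small sum of \<open>d powr s\<close> would have to cover a segment longer than they
  can.\<close>

lemma segment_null_exponent:
  fixes K :: "'a::euclidean_space set"
  assumes K: "compact K" "closed_segment x y \<subseteq> K" "x \<noteq> y"
    and null: "hausdorff_measure t K = 0" and t: "0 \<le> t" "t < s"
  shows "s > 1"
proof (rule ccontr)
  assume "\<not> s > 1"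
  let ?L = "dist x y"
  have L: "?L > 0" using K(3) by simp
  \<comment> \<open>Parameters that fall into one ball of radius \<open>d\<close> differ by at most
    \<open>2 * d / ?L\<close>, so they lie in an interval of length \<open>4 * d / ?L\<close>. Sums
    of radii below \<open>?L / 4\<close> then cover less than length 1.\<close>
  hence L4: "?L / 4 > 0" by simp
  obtain N :: "nat set" and c d where N: "finite N" "\<And>i. i \<in> N \<Longrightarrow> 0 < d i \<and> d i < 1"
    "K \<subseteq> (\<Union>i\<in>N. ball (c i) (d i))" "(\<Sum>i\<in>N. d i powr s) < ?L / 4"
    by (rule hausdorff_null_ball_cover[OF K(1) null t L4]) blast
  define T where "T i = {u \<in> {0..1}. linepath x y u \<in> ball (c i) (d i)}" for i
  have "\<exists>a. T i \<subseteq> cbox (a - 2 * d i / ?L) (a + 2 * d i / ?L)" if "i \<in> N" for i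
  proof (cases "T i = {}")
    case False
    then obtain a where a: "a \<in> T i" by blast
    have "u \<in> cbox (a - 2 * d i / ?L) (a + 2 * d i / ?L)" if "u \<in> T i" for u
    proof -
      have "dist (linepath x y a) (linepath x y u) \<le> dist (c i) (linepath x y a) + dist (c i) (linepath x y u)"
        by (rule dist_triangle3)
      hence "\<bar>u - a\<bar> * ?L \<le> 2 * d i" using a that by (simp add: dist_linepath T_def)
      hence "\<bar>u - a\<bar> \<le> 2 * d i / ?L" using L by (simp add: field_simps)
      thus ?thesis by (auto simp: abs_le_iff)
    qed
    thus ?thesis by blast
  qed simp
  then obtain a where a: "\<And>i. i \<in> N \<Longrightarrow> T i \<subseteq> cbox (a i - 2 * d i / ?L) (a i + 2 * d i / ?L)" by metis
  have "{0..1} \<subseteq> (\<Union>i\<in>N. T i)"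
  proof
    fix u :: real assume u: "u \<in> {0..1}"
    hence "linepath x y u \<in> K" using K(2) linepath_in_segment[of u x y] by auto
    then obtain i where "i \<in> N" "linepath x y u \<in> ball (c i) (d i)" using N(3) by blast
    thus "u \<in> (\<Union>i\<in>N. T i)" using u by (auto simp: T_def)
  qed
  hence "{0..1::real} \<subseteq> (\<Union>i\<in>N. cbox (a i - 2 * d i / ?L) (a i + 2 * d i / ?L))" using a by blast
  hence "measure lborel {0..1::real} \<le> measure lborel (\<Union>i\<in>N. cbox (a i - 2 * d i / ?L) (a i + 2 * d i / ?L))"
    using N(1) by (intro measure_mono_fmeasurable fmeasurable.finite_UN fmeasurable_cbox) auto
  also have "\<dots> \<le> (\<Sum>i\<in>N. measure lborel (cbox (a i - 2 * d i / ?L) (a i + 2 * d i / ?L)))"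
    using N(1) by (intro measure_UNION_le) auto
  also have "\<dots> = (\<Sum>i\<in>N. 4 / ?L * d i)"
    using N(2) L by (intro sum.cong refl) (auto simp: less_imp_le intro!: trans[OF measure_lborel_Icc])
  also have "\<dots> \<le> (\<Sum>i\<in>N. 4 / ?L * d i powr s)"
  proof (intro sum_mono mult_left_mono)
    fix i assume "i \<in> N"
    thus "d i \<le> d i powr s" using powr_mono'[of s 1 "d i"] N(2)[of i] \<open>\<not> s > 1\<close> by simp
  qed (use L in auto)
  also have "\<dots> = 4 / ?L * (\<Sum>i\<in>N. d i powr s)" by (simp only: sum_distrib_left)
  also have "\<dots> < 4 / ?L * (?L / 4)" using N(4) L by (intro mult_strict_left_mono) auto
  finally show False using L by simp
qed

text \<open>The discs of radius \<delta> / 2 about the points are disjoint and lie in the disc of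
  radius \<open>(\<kappa> + 1) * \<delta>\<close> about \<open>c\<close>; the bound is the ratio of
  areas.\<close>

lemma separated_card_le:
  fixes V :: "plane set"
  assumes V: "finite V" and \<delta>: "\<delta> > 0" "\<kappa> \<ge> 0" and near: "\<And>p. p \<in> V \<Longrightarrow> dist c p \<le> \<kappa> * \<delta>"
    and sep: "\<And>p q. \<lbrakk>p \<in> V; q \<in> V; p \<noteq> q\<rbrakk> \<Longrightarrow> dist p q \<ge> \<delta>"
  shows "real (card V) \<le> 4 * (\<kappa> + 1)\<^sup>2"
proof -
  define u where "u = measure lborel (ball (0::plane) 1)"
  have fm: "ball p R \<in> fmeasurable lborel" for p :: plane and R
  proof (rule fmeasurableI)
    show "emeasure lborel (ball p R) < \<infinity>" by (rule emeasure_bounded_finite) simp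
  qed simp
  have u: "u > 0" unfolding u_def by (rule content_ball_pos) simp
  have vol: "measure lborel (ball p R) = R\<^sup>2 * u" if "R \<ge> 0" for p :: plane and R
    using content_ball_conv_unit_ball[OF that, of p] by (simp add: u_def)
  have "(\<Sum>p\<in>V. measure lborel (ball p (\<delta> / 2))) = measure lborel (\<Union>p\<in>V. ball p (\<delta> / 2))"
  proof (rule measure_UNION'[symmetric])
    show "pairwise (\<lambda>p q. disjnt (ball p (\<delta> / 2)) (ball q (\<delta> / 2))) V"
    proof (intro pairwiseI)
      fix p q assume pq: "p \<in> V" "q \<in> V" "p \<noteq> q"
      have "\<not> (dist p z < \<delta> / 2 \<and> dist q z < \<delta> / 2)" for z
        using sep[OF pq] dist_triangle2[of p q z] by auto
      thus "disjnt (ball p (\<delta> / 2)) (ball q (\<delta> / 2))" by (auto simp: disjnt_iff)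
    qed
  qed (use V fm in auto)
  also have "\<dots> \<le> measure lborel (ball c ((\<kappa> + 1) * \<delta>))"
  proof (intro measure_mono_fmeasurable UN_least subsetI)
    fix p z assume "p \<in> V" "z \<in> ball p (\<delta> / 2)"
    thus "z \<in> ball c ((\<kappa> + 1) * \<delta>)"
      using near[of p] dist_triangle[of c z p] \<delta> by (simp add: algebra_simps)
  qed (use fm in \<open>auto intro!: borel_open open_UN\<close>)
  finally have "real (card V) * ((\<delta> / 2)\<^sup>2 * u) \<le> ((\<kappa> + 1) * \<delta>)\<^sup>2 * u" using \<delta> by (simp add: vol)
  hence "real (card V) * (\<delta>\<^sup>2 * u) \<le> (4 * (\<kappa> + 1)\<^sup>2) * (\<delta>\<^sup>2 * u)"
    by (simp add: power2_eq_square field_simps)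
  thus ?thesis using \<delta> u by (simp add: mult_le_cancel_right)
qed

lemma similarity_ball:
  assumes G: "similarity r G"
  shows "G ` ball x e = ball (G x) (r * e)"
proof -
  obtain A a where A: "linear A" "inj A" "\<And>S. G ` S = (+) a ` A ` S"
    using similarity_image[OF G] by blast
  have "surj A" using linear_injective_imp_surjective[OF A(1,2)] by simp
  hence "surj G" using A(3)[of UNIV] by simp
  have "q \<in> G ` ball x e" if "q \<in> ball (G x) (r * e)" for q
  proof -
    obtain p where p: "q = G p" using \<open>surj G\<close> by blast
    hence "r * dist x p < r * e" using that by (simp add: similarity_dist[OF G])
    thus ?thesis using p similarity_pos[OF G] by simp
  qed
  thus ?thesis using similarity_pos[OF G] by (auto simp: similarity_dist[OF G])
qed

context self_similar_region
begin

text \<open>Otherwise the weights \<open>r j powr s\<close>, scaled to total mass 1, define a mass distribution on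
  words that gives mass at most \<open>M * d powr s\<close> to a ball of radius \<open>d\<close>, because only boundedly
  many pieces of size about \<open>d\<close> meet the ball.\<close>

lemma null_imp_ratio_sum_less_1:
  assumes null: "hausdorff_measure t attractor = 0" and t: "0 \<le> t" "t < s"
  shows "(\<Sum>j\<in>S. r j powr s) < 1"
proof (rule ccontr)
  define \<rho> where "\<rho> = (\<Sum>j\<in>S. r j powr s)"
  assume "\<not> (\<Sum>j\<in>S. r j powr s) < 1"
  hence \<rho>: "\<rho> \<ge> 1" by (simp add: \<rho>_def)
  \<comment> \<open>Dividing by \<open>\<rho> \<ge> 1\<close> makes the weights a probability on
    letters and keeps \<open>p j \<le> r j powr s\<close>.\<close>
  define p where "p j = r j powr s / \<rho>" for j
  define m where "m w = prod_list (map p w)" for w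
  have p_nonneg: "p j \<ge> 0" for j using \<rho> by (simp add: p_def)
  have p_le: "p j \<le> r j powr s" for j 
  proof -
    have "r j powr s * 1 \<le> r j powr s * \<rho>" using \<rho> by (intro mult_left_mono) auto
    thus ?thesis using \<rho> by (simp add: p_def divide_le_eq)
  qed
  have p_sum: "(\<Sum>j\<in>S. p j) = 1" using \<rho> by (simp add: p_def \<rho>_def flip: sum_divide_distrib)
  have m_nonneg: "m w \<ge> 0" for w by (induction w) (auto simp: m_def p_nonneg)
  have m_append: "m (v @ w) = m v * m w" for v w by (simp add: m_def)
  have m_sum: "(\<Sum>w\<in>words S n. m w) = 1" for n unfolding m_def sum_words_prod_list p_sum by simp
  have m_le: "m w \<le> ratio w powr s" if "set w \<subseteq> S" for w
    using that
  proof (induction w)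
    case (Cons j w)
    have rj: "r j > 0" using Cons.prems G similarity_pos by auto
    have "m (j # w) \<le> r j powr s * ratio w powr s"
      unfolding m_def using Cons p_le[of j] m_nonneg[of w]
      by (simp add: m_def) (intro mult_mono, auto)
    also have "\<dots> = (r j * ratio w) powr s" using rj ratio_pos[of w] Cons.prems by (simp add: powr_mult)
    finally show ?case by simp
  qed (simp add: m_def)
  obtain x0 where x0: "x0 \<in> attractor" using attractor_nonempty by blast
  obtain c0 where c0: "c0 \<in> interior P" using interior_P by blast
  then obtain e where e: "e > 0" "ball c0 e \<subseteq> interior P" by (meson open_interior openE)
  obtain D where D: "D \<ge> 0" "\<And>x y. \<lbrakk>x \<in> P; y \<in> P\<rbrakk> \<Longrightarrow> dist x y \<le> D"
    using compact_imp_bounded[OF compact_P] by (metis diameter_bounded_bound diameter_ge_0)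
  define rmin where "rmin = Min (r ` S)"
  have "rmin \<in> r ` S" unfolding rmin_def using finite_S S_nonempty by (intro Min_in) auto
  hence rmin_pos: "rmin > 0" using similarity_pos[OF G] by auto
  have rmin: "rmin \<le> r j" if "j \<in> S" for j using that finite_S by (auto simp: rmin_def)
  \<comment> \<open>These are the constants of \<open>separated_card_le\<close> for points at mutual
    distance at least \<open>rmin * e * d\<close> and within \<open>d + d * D\<close> of the
    centre.\<close>
  define \<kappa> where "\<kappa> = (D + 1) / (rmin * e)"
  define M where "M = 4 * (\<kappa> + 1)\<^sup>2"
  have \<kappa>: "\<kappa> \<ge> 0" using D(1) rmin_pos e(1) by (simp add: \<kappa>_def)
  have M: "M > 0" using \<kappa> by (simp add: M_def)
  have ball_mass: "(\<Sum>w\<in>{w \<in> words S n. W w x0 \<in> ball c d}. m w) \<le> M * d powr s"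
    if d: "0 < d" "d < 1" "rmax ^ n < d" for c d n
  proof -
    define B where "B = {w \<in> words S n. W w x0 \<in> ball c d}"
    have finB: "finite B" using finite_words[OF finite_S] by (simp add: B_def)
    \<comment> \<open>Stopping rule: \<open>v w\<close> is the shortest prefix of \<open>w\<close>
      with ratio below \<open>d\<close>; \<open>rmax ^ n < d\<close> guarantees that there is
      one.\<close>
    define k where "k w = (LEAST k. ratio (take k w) < d)" for w
    define v where "v w = take (k w) w" for w
    have B: "length w = n" "set w \<subseteq> S" "W w x0 \<in> ball c d" if "w \<in> B" for w
      using that by (auto simp: B_def words_def)
    have v: "ratio (v w) < d" "k w \<le> n" "set (v w) \<subseteq> S" "\<And>l. l < k w \<Longrightarrow> \<not> ratio (take l w) < d"
      if w: "w \<in> B" for w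
    proof -
      have ex: "ratio (take n w) < d" using ratio_le[OF B(2)[OF w]] B(1)[OF w] d(3) by simp
      show "ratio (v w) < d" unfolding v_def k_def using ex by (rule LeastI)
      show "k w \<le> n" unfolding k_def using ex by (rule Least_le)
      show "set (v w) \<subseteq> S" unfolding v_def using B(2)[OF w] set_take_subset by fastforce
      show "\<And>l. l < k w \<Longrightarrow> \<not> ratio (take l w) < d" unfolding k_def by (rule not_less_Least)
    qed
    \<comment> \<open>As \<open>d < 1\<close>, the stopping word is nonempty; without its last
      letter the ratio is still at least \<open>d\<close>.\<close>
    have v_lower: "ratio (v w) \<ge> rmin * d" if w: "w \<in> B" for w
    proof -
      have "k w \<noteq> 0" using v(1)[OF w] d(2) by (auto simp: v_def intro: ccontr)
      then obtain l where l: "k w = Suc l" using not0_implies_Suc by blast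
      have "l < length w" using l v(2)[OF w] B(1)[OF w] by simp
      hence "v w = take l w @ [w ! l]" and "w ! l \<in> S"
        using B(2)[OF w] by (auto simp: v_def l take_Suc_conv_app_nth)
      moreover have "ratio (take l w) \<ge> d" using v(4)[OF w, of l] l by simp
      ultimately have "d * rmin \<le> ratio (take l w) * r (w ! l)"
        using rmin[of "w ! l"] rmin_pos d(1) by (intro mult_mono) auto
      thus ?thesis using \<open>v w = take l w @ [w ! l]\<close> by (simp add: mult.commute)
    qed
    define V where "V = v ` B"
    have finV: "finite V" using finB by (simp add: V_def)
    \<comment> \<open>No stopping word is a proper prefix of another, so two of them part at some
      letter and \<open>W_disjoint\<close> applies.\<close>
    have split: "\<exists>u i j t t'. a = u @ i # t \<and> b = u @ j # t' \<and> i \<noteq> j" if ab: "a \<in> V" "b \<in> V" "a \<noteq> b" for a b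
    proof -
      have *: "\<exists>u i j t t'. v w = u @ i # t \<and> v w' = u @ j # t' \<and> i \<noteq> j"
        if w: "w \<in> B" "w' \<in> B" "v w \<noteq> v w'" "k w \<le> k w'" for w w'
      proof -
        have ne: "take (k w) w \<noteq> take (k w) w'"
        proof
          assume eq: "take (k w) w = take (k w) w'"
          hence "ratio (take (k w) w') < d" using v(1)[OF w(1)] by (simp add: v_def)
          hence "\<not> k w < k w'" using v(4)[OF w(2)] by blast
          hence "k w = k w'" using w(4) by simp
          thus False using eq w(3) by (simp add: v_def)
        qed
        have "length (take (k w) w) = length (take (k w) w')" using B(1) w by simp
        from same_length_different[OF ne this] obtain u i t j t' where
          *: "i \<noteq> j" "take (k w) w = u @ i # t" "take (k w) w' = u @ j # t'" by auto
        have "v w' = take (k w) w' @ drop (k w) (v w')"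
          using w(4) by (metis append_take_drop_id min.absorb1 take_take v_def)
        hence "v w' = u @ j # (t' @ drop (k w) (v w'))" using *(3) by simp
        thus ?thesis using *(1,2) unfolding v_def[of w] by blast
      qed
      obtain w w' where ww: "w \<in> B" "w' \<in> B" "a = v w" "b = v w'" using ab by (auto simp: V_def)
      show ?thesis
      proof (cases "k w \<le> k w'")
        case True thus ?thesis using *[of w w'] ww ab(3) by simp
      next
        case False
        hence "\<exists>u i j t t'. b = u @ i # t \<and> a = u @ j # t' \<and> i \<noteq> j" using *[of w' w] ww ab(3) by simp
        thus ?thesis by metis
      qed
    qed
    have VS: "set a \<subseteq> S" "rmin * d \<le> ratio a" "ratio a < d" if "a \<in> V" for a
      using that v v_lower by (auto simp: V_def)
    \<comment> \<open>The image of the disc about \<open>c0\<close> under \<open>W a\<close> has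
      radius at least \<open>rmin * e * d\<close> and lies in the interior of its piece, so it
      misses the interior of the other piece.\<close>
    have sep: "dist (W a c0) (W b c0) \<ge> rmin * e * d" if ab: "a \<in> V" "b \<in> V" "a \<noteq> b" for a b
    proof (rule ccontr)
      assume "\<not> ?thesis"
      hence "dist (W a c0) (W b c0) < rmin * d * e" by (simp add: mult_ac)
      also have "\<dots> \<le> ratio a * e" using VS(2)[OF ab(1)] e(1) by (intro mult_right_mono) auto
      finally have "W b c0 \<in> W a ` ball c0 e" by (simp add: similarity_ball[OF W_similarity[OF VS(1)[OF ab(1)]]])
      hence "W b c0 \<in> interior (W a ` P)" unfolding W_interior[OF VS(1)[OF ab(1)]] using e(2) by blast
      moreover have "W b c0 \<in> interior (W b ` P)" unfolding W_interior[OF VS(1)[OF ab(2)]] using c0 by blast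
      moreover obtain u i j t t' where "a = u @ i # t" "b = u @ j # t'" "i \<noteq> j" using split[OF ab] by blast
      ultimately show False using W_disjoint[of u i j t t'] VS(1)[OF ab(1)] VS(1)[OF ab(2)] by auto
    qed
    have pos: "rmin * e * d > 0" using rmin_pos e(1) d(1) by simp
    have near: "dist c (W a c0) \<le> \<kappa> * (rmin * e * d)" if a: "a \<in> V" for a
    proof -
      obtain w where w: "w \<in> B" "a = v w" using a by (auto simp: V_def)
      have "w = a @ drop (k w) w" by (simp add: w(2) v_def)
      hence "W w x0 = W a (W (drop (k w) w) x0)" using word_map_append[of G a "drop (k w) w"] by simp
      moreover have "W (drop (k w) w) x0 \<in> P"
        using W_image[of "drop (k w) w"] B(2)[OF w(1)] x0 attractor_subset set_drop_subset by fast
      ultimately have "dist (W w x0) (W a c0) \<le> ratio a * D"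
        using D(2) c0 interior_subset[of P] ratio_pos[OF VS(1)[OF a]]
        by (auto simp: similarity_dist[OF W_similarity[OF VS(1)[OF a]]])
      also have "\<dots> \<le> d * D" using VS(3)[OF a] D(1) by (intro mult_right_mono) auto
      finally have "dist c (W a c0) \<le> d + d * D"
        using B(3)[OF w(1)] dist_triangle[of c "W a c0" "W w x0"] by simp
      also have "\<dots> = \<kappa> * (rmin * e * d)" using rmin_pos e(1) by (simp add: \<kappa>_def field_simps)
      finally show ?thesis .
    qed
    have inj: "inj_on (\<lambda>a. W a c0) V"
    proof (rule inj_onI, rule ccontr)
      fix a b assume "a \<in> V" "b \<in> V" "W a c0 = W b c0" "a \<noteq> b"
      thus False using sep[of a b] pos by simp
    qed
    have "real (card ((\<lambda>a. W a c0) ` V)) \<le> M"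
      unfolding M_def
      by (rule separated_card_le[OF _ pos \<kappa>, of _ c]) (use finV near sep in auto)
    hence cardV: "real (card V) \<le> M" by (simp add: card_image[OF inj])
    \<comment> \<open>The words of length n with prefix \<open>a\<close> have total mass
      \<open>m a\<close>, because the masses of the remaining letters add up to 1.\<close>
    have cyl: "(\<Sum>w\<in>{w \<in> B. v w = a}. m w) \<le> d powr s" if a: "a \<in> V" for a
    proof -
      have la: "length a \<le> n" using a v(2) B(1) by (auto simp: V_def v_def)
      have "{w \<in> B. v w = a} \<subseteq> (@) a ` words S (n - length a)"
      proof
        fix w assume w: "w \<in> {w \<in> B. v w = a}"
        hence "w = a @ drop (k w) w" by (auto simp: v_def)
        moreover have "drop (k w) w \<in> words S (n - length a)"
          using w B(1,2)[of w] v(2)[of w] set_drop_subset[of "k w" w] by (auto simp: words_def v_def)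
        ultimately show "w \<in> (@) a ` words S (n - length a)" by blast
      qed
      hence "(\<Sum>w\<in>{w \<in> B. v w = a}. m w) \<le> (\<Sum>w\<in>(@) a ` words S (n - length a). m w)"
        using finite_words[OF finite_S] m_nonneg by (intro sum_mono2) auto
      also have "\<dots> = m a"
        by (subst sum.reindex) (auto simp: inj_on_def m_append m_sum simp flip: sum_distrib_left)
      also have "\<dots> \<le> ratio a powr s" by (rule m_le[OF VS(1)[OF a]])
      also have "\<dots> \<le> d powr s"
        using VS(3)[OF a] ratio_pos[OF VS(1)[OF a]] t by (intro powr_mono2) auto
      finally show ?thesis .
    qed
    have "(\<Sum>w\<in>B. m w) = (\<Sum>a\<in>V. \<Sum>w\<in>{w \<in> B. v w = a}. m w)"
      unfolding V_def by (rule sum.image_gen[OF finB])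
    also have "\<dots> \<le> (\<Sum>a\<in>V. d powr s)" using cyl by (rule sum_mono)
    also have "\<dots> \<le> M * d powr s" using cardV by (simp add: mult_right_mono)
    finally show ?thesis by (simp add: B_def)
  qed
  have M1: "1 / M > 0" using M by simp
  obtain N :: "nat set" and c d where N: "finite N" "\<And>i. i \<in> N \<Longrightarrow> 0 < d i \<and> d i < 1"
    "attractor \<subseteq> (\<Union>i\<in>N. ball (c i) (d i))" "(\<Sum>i\<in>N. d i powr s) < 1 / M"
    by (rule hausdorff_null_ball_cover[OF attractor_compact null t M1]) blast
  obtain n where n: "\<And>i. i \<in> N \<Longrightarrow> rmax ^ n < d i"
  proof -
    have "(\<lambda>n. rmax ^ n) \<longlonglongrightarrow> 0" using rmax by (intro LIMSEQ_power_zero) auto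
    hence "\<forall>\<^sub>F n in sequentially. rmax ^ n < d i" if "i \<in> N" for i
      using N(2)[OF that] by (auto simp: order_tendsto_iff)
    hence "\<forall>\<^sub>F n in sequentially. \<forall>i\<in>N. rmax ^ n < d i" by (intro eventually_ball_finite N(1)) blast
    thus ?thesis using that by (auto simp: eventually_sequentially)
  qed
  \<comment> \<open>Every word sends \<open>x0\<close> into some ball of the cover, so the total
    mass is at most the sum of the ball masses.\<close>
  have "1 = (\<Sum>w\<in>words S n. m w)" by (simp add: m_sum)
  also have "\<dots> \<le> (\<Sum>w\<in>words S n. \<Sum>i\<in>N. if W w x0 \<in> ball (c i) (d i) then m w else 0)"
  proof (intro sum_mono)
    fix w assume "w \<in> words S n"
    hence "W w x0 \<in> attractor" using W_attractor[of w] x0 by (auto simp: words_def)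
    then obtain i where i: "i \<in> N" "W w x0 \<in> ball (c i) (d i)" using N(3) by blast
    have "(if W w x0 \<in> ball (c i) (d i) then m w else 0)
        \<le> (\<Sum>i\<in>N. if W w x0 \<in> ball (c i) (d i) then m w else 0)"
      using i(1) N(1) m_nonneg by (intro member_le_sum) auto
    thus "m w \<le> (\<Sum>i\<in>N. if W w x0 \<in> ball (c i) (d i) then m w else 0)" using i(2) by simp
  qed
  also have "\<dots> = (\<Sum>i\<in>N. \<Sum>w\<in>words S n. if W w x0 \<in> ball (c i) (d i) then m w else 0)"
    by (rule sum.swap)
  also have "\<dots> = (\<Sum>i\<in>N. \<Sum>w\<in>{w \<in> words S n. W w x0 \<in> ball (c i) (d i)}. m w)"
    using finite_words[OF finite_S] by (intro sum.cong refl sum.inter_filter[symmetric]) auto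
  also have "\<dots> \<le> (\<Sum>i\<in>N. M * d i powr s)" using N(2) n by (intro sum_mono ball_mass) auto
  also have "\<dots> < 1" using N(4) M by (simp add: field_simps flip: sum_distrib_left)
  finally show False by simp
qed

end


section \<open>Evaluation of alternating forms on chains\<close>

lemma chain_eval_superset:
  assumes "finite A" "Poly_Mapping.keys c \<subseteq> A"
  shows "chain_eval \<omega> c = (\<Sum>xs\<in>A. Poly_Mapping.lookup c xs * \<omega> xs)"
  unfolding chain_eval_def
  by (rule sum.mono_neutral_left) (use assms in \<open>auto simp: in_keys_iff\<close>)

lemma chain_eval_0 [simp]: "chain_eval \<omega> 0 = 0"
  by (simp add: chain_eval_def)

lemma chain_eval_single [simp]: "chain_eval \<omega> (Poly_Mapping.single xs a) = a * \<omega> xs"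
  by (subst chain_eval_superset[of "{xs}"]) auto

lemma chain_eval_add [simp]: "chain_eval \<omega> (c + d) = chain_eval \<omega> c + chain_eval \<omega> d"
proof -
  let ?A = "Poly_Mapping.keys c \<union> Poly_Mapping.keys d"
  have "Poly_Mapping.keys (c + d) \<subseteq> ?A" by (rule Poly_Mapping.keys_add)
  thus ?thesis
    by (simp add: chain_eval_superset[of ?A] lookup_add sum.distrib algebra_simps)
qed

lemma chain_eval_diff [simp]: "chain_eval \<omega> (c - d) = chain_eval \<omega> c - chain_eval \<omega> d"
  using chain_eval_add[of \<omega> "c - d" d] by simp

lemma chain_eval_sum [simp]: "chain_eval \<omega> (sum c I) = (\<Sum>i\<in>I. chain_eval \<omega> (c i))"
  by (induction I rule: infinite_finite_induct) auto

text \<open>The coboundary of \<eta>, as a function on ordered simplices.\<close>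

definition face_sum :: "(plane list \<Rightarrow> complex) \<Rightarrow> plane list \<Rightarrow> complex" where
  "face_sum \<eta> xs = (\<Sum>j<length xs. (- 1) ^ j * \<eta> (take j xs @ drop (Suc j) xs))"

lemma chain_eval_boundary: "chain_eval \<eta> (chain_boundary c) = chain_eval (face_sum \<eta>) c"
proof -
  have "chain_eval \<eta> (chain_boundary c) =
      (\<Sum>xs\<in>Poly_Mapping.keys c. \<Sum>j<length xs.
        (- 1) ^ j * Poly_Mapping.lookup c xs * \<eta> (take j xs @ drop (Suc j) xs))"
    unfolding chain_boundary_def by simp
  also have "\<dots> = chain_eval (face_sum \<eta>) c"
    unfolding chain_eval_def face_sum_def sum_distrib_left
    by (intro sum.cong refl) (simp add: mult_ac)
  finally show ?thesis .
qed

lemma face_sum_triple: "face_sum \<eta> [a, b, c] = \<eta> [b, c] - \<eta> [a, c] + \<eta> [a, b]"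
  by (simp add: face_sum_def numeral_3_eq_3)

lemma length_3E:
  assumes "length xs = 3"
  obtains a b c where "xs = [a, b, c]"
  using assms by (auto simp: length_Suc_conv numeral_3_eq_3)

lemma face_sum_degenerate:
  assumes anti: "\<And>x y. \<eta> [x, y] = - \<eta> [y, x]" and "length xs = 3" "\<not> distinct xs"
  shows "face_sum \<eta> xs = 0"
proof -
  obtain a b c where xs: "xs = [a, b, c]" using assms(2) by (rule length_3E)
  have "\<eta> [x, x] = 0" for x using anti[of x x] by simp
  thus ?thesis using assms(3) anti[of a b] anti[of b c] anti[of a c] by (auto simp: xs face_sum_triple)
qed

lemma face_sum_transpose:
  assumes anti: "\<And>x y. \<eta> [x, y] = - \<eta> [y, x]" and xs: "length xs = 3"
    and ij: "i < 3" "j < 3" "i \<noteq> j"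
  shows "face_sum \<eta> (permute_list (Transposition.transpose i j) xs) = - face_sum \<eta> xs"
proof -
  obtain a b c where abc: "xs = [a, b, c]" using xs by (rule length_3E)
  have "i \<in> {0, 1, 2}" "j \<in> {0, 1, 2}" using ij by auto
  thus ?thesis
    using ij(3) anti[of a b] anti[of b c] anti[of a c]
    by (auto simp: abc permute_list_def face_sum_triple transpose_def upt_rec[of _ "Suc _"] numeral_2_eq_2)
qed

lemma face_sum_permute:
  assumes anti: "\<And>x y. \<eta> [x, y] = - \<eta> [y, x]" and \<tau>: "\<tau> permutes {..<3}" and xs: "length xs = 3"
  shows "face_sum \<eta> (permute_list \<tau> xs) = of_int (sign \<tau>) * face_sum \<eta> xs"
proof -
  have fin: "finite {..<3::nat}" by simp
  have "\<forall>xs. length xs = 3 \<longrightarrow> face_sum \<eta> (permute_list \<tau> xs) = of_int (sign \<tau>) * face_sum \<eta> xs"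
    using \<tau> fin
  proof (induction rule: permutes_induct)
    case id
    show ?case by simp
  next
    case (swap a b p)
    show ?case
    proof (intro allI impI)
      fix xs :: "plane list" assume xs: "length xs = 3"
      have "permutation p" using swap.hyps fin by (auto simp: permutation_permutes)
      hence "sign (Transposition.transpose a b \<circ> p) = - sign p"
        using swap.hyps by (simp add: sign_compose permutation_swap_id sign_swap_id)
      moreover have "permute_list (Transposition.transpose a b \<circ> p) xs
          = permute_list p (permute_list (Transposition.transpose a b) xs)"
        using swap.hyps xs by (intro permute_list_compose) simp
      ultimately show "face_sum \<eta> (permute_list (Transposition.transpose a b \<circ> p) xs) =
          of_int (sign (Transposition.transpose a b \<circ> p)) * face_sum \<eta> xs"
        using swap xs face_sum_transpose[of \<eta> xs a b, OF anti xs] by simp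
    qed
  qed
  thus ?thesis using xs by blast
qed

text \<open>The coboundary of an antisymmetric form is alternating, so it descends to oriented
  chains.\<close>

lemma chain_eval_orientation_relations:
  assumes anti: "\<And>x y. \<eta> [x, y] = - \<eta> [y, x]" and c: "c \<in> orientation_relations T 2"
  shows "chain_eval (face_sum \<eta>) c = 0"
  using c
proof induction
  case (degenerate c xs a)
  hence "length xs = 3" by (simp add: ordered_simplices_def)
  thus ?case using degenerate face_sum_degenerate[of \<eta> xs, OF anti] by simp
next
  case (permuted c xs \<tau> a)
  hence len: "length xs = 3" by (simp add: ordered_simplices_def)
  thus ?case using permuted face_sum_permute[of \<eta> \<tau> xs, OF anti] by simp
qed simp

lemma simplicial_complex_face: "\<lbrakk>simplicial_complex T; K \<in> T; L face_of K\<rbrakk> \<Longrightarrow> L \<in> T"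
  unfolding simplicial_complex_def by blast

text \<open>The chain may be replaced by the counterclockwise representative of its class, where
  each triangle contributes its three directed edges.\<close>

lemma chain_eval_boundary_admissible:
  assumes T: "simplicial_complex T" and s: "admissible_chain Q T s"
    and anti: "\<And>x y. \<eta> [x, y] = - \<eta> [y, x]"
  shows "chain_eval \<eta> (chain_boundary s) =
    (\<Sum>K\<in>{K \<in> T. 2 simplex K}. \<Sum>(x,y)\<in>triangle_edges K. \<eta> [x, y])"
proof -
  define L where "L K = (SOME xs. xs \<in> ordered_simplices T 2 \<and> ccw xs \<and> convex hull set xs = K)" for K
  define c where "c = (\<Sum>K\<in>{K \<in> T. 2 simplex K}. Poly_Mapping.single (L K) (1::complex))"
  have s': "s \<in> ordered_chains T 2" "oriented_class T 2 s = oriented_class T 2 c"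
    using s by (auto simp: admissible_chain_def ccw_chain_def c_def L_def)
  have "s \<in> oriented_class T 2 s"
    using s'(1) orientation_relations.zero by (simp add: oriented_class_def oriented_rel_def)
  hence "c - s \<in> orientation_relations T 2" unfolding s'(2) by (simp add: oriented_class_def oriented_rel_def)
  hence "chain_eval (face_sum \<eta>) (c - s) = 0" by (rule chain_eval_orientation_relations[of \<eta>, OF anti])
  hence "chain_eval (face_sum \<eta>) s = chain_eval (face_sum \<eta>) c" by simp
  also have "\<dots> = (\<Sum>K\<in>{K \<in> T. 2 simplex K}. face_sum \<eta> (L K))" by (simp add: c_def)
  also have "\<dots> = (\<Sum>K\<in>{K \<in> T. 2 simplex K}. \<Sum>(x,y)\<in>triangle_edges K. \<eta> [x, y])"
  proof (intro sum.cong refl)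
    fix K assume K: "K \<in> {K \<in> T. 2 simplex K}"
    then obtain a b c where abc: "orient a b c > 0" "K = convex hull {a, b, c}" by (auto simp: simplex_2_iff)
    have "{x} \<in> T" if "x \<in> {a, b, c}" for x
    proof -
      have "x extreme_point_of K"
        using extreme_point_of_convex_hull_affine_independent[OF triangle_affine_independent[OF abc(1)]] that abc(2)
        by simp
      hence "{x} face_of K" by (simp add: face_of_singleton)
      thus ?thesis using simplicial_complex_face[OF T] K by blast
    qed
    hence "[a, b, c] \<in> ordered_simplices T 2"
      using K abc(2) hull_subset[of "{a, b, c}" convex]
      by (auto simp: ordered_simplices_def complex_vertices_def)
    hence "[a, b, c] \<in> ordered_simplices T 2 \<and> ccw [a, b, c] \<and> convex hull set [a, b, c] = K"
      using abc by (auto simp: ccw_iff)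
    hence "L K \<in> ordered_simplices T 2 \<and> ccw (L K) \<and> convex hull set (L K) = K"
      unfolding L_def by (rule someI)
    then obtain u v w where uvw: "L K = [u, v, w]" "orient u v w > 0" "K = convex hull {u, v, w}"
      by (auto simp: ccw_iff)
    have "u \<noteq> v" "v \<noteq> w" "w \<noteq> u" using triangle_distinct[OF uvw(2)] by auto
    hence "(\<Sum>(x,y)\<in>triangle_edges K. \<eta> [x, y]) = \<eta> [u, v] + \<eta> [v, w] + \<eta> [w, u]"
      by (simp add: uvw(3) triangle_edges_triangle[OF uvw(2)])
    thus "face_sum \<eta> (L K) = (\<Sum>(x,y)\<in>triangle_edges K. \<eta> [x, y])"
      using anti[of u w] by (simp add: uvw(1) face_sum_triple)
  qed
  finally show ?thesis by (simp add: chain_eval_boundary)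
qed

text \<open>Removing the outer edges from the chain amounts to setting the form to zero on them. The
  truncated form stays antisymmetric, since a segment does not depend on the order of its ends, and
  is evaluated on a full boundary.\<close>

lemma chain_eval_inner_chain:
  "chain_eval \<omega> (inner_chain Q s) =
     chain_eval (\<lambda>xs. if convex hull set xs \<subseteq> frontier Q then 0 else \<omega> xs) (chain_boundary s)"
proof -
  let ?b = "chain_boundary s" and ?out = "\<lambda>xs. convex hull set xs \<subseteq> frontier Q"
  have "chain_eval \<omega> (outer_chain Q s) =
      (\<Sum>xs\<in>Poly_Mapping.keys ?b. if ?out xs then Poly_Mapping.lookup ?b xs * \<omega> xs else 0)"
    unfolding outer_chain_def chain_eval_sum chain_eval_single by (rule sum.inter_filter) simp
  thus ?thesis
    unfolding inner_chain_def chain_eval_diff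
    by (auto simp: chain_eval_def sum_subtractf[symmetric] intro!: sum.cong)
qed


section \<open>Boundary sums over triangulated pieces\<close>

lemma triangle_interior_nonempty:
  fixes K :: "plane set"
  assumes "2 simplex K"
  shows "interior K \<noteq> {}"
proof -
  obtain a b c where abc: "orient a b c > 0" "K = convex hull {a, b, c}"
    using assms by (auto simp: simplex_2_iff)
  show ?thesis unfolding abc(2)
    using interior_convex_hull_eq_empty[of "{a, b, c}"] triangle_affine_independent[OF abc(1)]
      triangle_distinct[OF abc(1)] by auto
qed

lemma sum_triangle_edges_exact:
  fixes u :: "plane \<Rightarrow> complex"
  assumes "2 simplex K"
  shows "(\<Sum>(x,y)\<in>triangle_edges K. u y - u x) = 0"
proof -
  obtain a b c where abc: "orient a b c > 0" "K = convex hull {a, b, c}"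
    using assms by (auto simp: simplex_2_iff)
  have "a \<noteq> b" "b \<noteq> c" "c \<noteq> a" using triangle_distinct[OF abc(1)] by auto
  thus ?thesis by (simp add: abc(2) triangle_edges_triangle[OF abc(1)])
qed

lemma sum_boundary_edges_exact:
  fixes u :: "plane \<Rightarrow> complex"
  assumes T: "face_to_face \<T>"
  shows "(\<Sum>(x,y)\<in>boundary_edges \<T>. u y - u x) = 0"
proof -
  have "(\<Sum>(x,y)\<in>boundary_edges \<T>. u y - u x) = (\<Sum>K\<in>\<T>. \<Sum>(x,y)\<in>triangle_edges K. u y - u x)"
    by (rule sum_triangle_edges_eq_boundary_edges[OF T, symmetric]) simp
  also have "\<dots> = 0"
    using T sum_triangle_edges_exact by (intro sum.neutral) (auto simp: face_to_face_def)
  finally show ?thesis .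
qed

lemma bracket_antisym: "bracket f g x y = - bracket f g y x"
  by (simp add: bracket_def)

lemma bracket_shift:
  "bracket (\<lambda>p. f p - a) (\<lambda>p. g p - b) x y =
     bracket f g x y - (a * g y - a * g x) + (b * f y - b * f x)"
  by (simp add: bracket_def algebra_simps)

text \<open>The correction terms are differences \<open>u y - u x\<close>, whose sum around each
  triangle is zero.\<close>

lemma sum_bracket_shift:
  assumes T: "face_to_face \<T>"
  shows "(\<Sum>K\<in>\<T>. \<Sum>(x,y)\<in>triangle_edges K. bracket f g x y) =
    (\<Sum>(x,y)\<in>boundary_edges \<T>. bracket (\<lambda>p. f p - a) (\<lambda>p. g p - b) x y)"
proof -
  have "(\<Sum>(x,y)\<in>boundary_edges \<T>. bracket (\<lambda>p. f p - a) (\<lambda>p. g p - b) x y) =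
      (\<Sum>(x,y)\<in>boundary_edges \<T>. bracket f g x y)
      - (\<Sum>(x,y)\<in>boundary_edges \<T>. a * g y - a * g x)
      + (\<Sum>(x,y)\<in>boundary_edges \<T>. b * f y - b * f x)"
    unfolding bracket_shift by (simp add: case_prod_beta sum.distrib sum_subtractf)
  thus ?thesis
    using sum_boundary_edges_exact[OF T, of "\<lambda>p. a * g p"] sum_boundary_edges_exact[OF T, of "\<lambda>p. b * f p"]
      sum_triangle_edges_eq_boundary_edges[OF T, of "bracket f g", OF bracket_antisym] by simp
qed

text \<open>One factor \<open>dist x y\<close> is kept and the remaining power is bounded by the
  mesh; thus the total length replaces the number of edges.\<close>

lemma sum_edges_estimate:
  fixes Y \<omega> :: "'a::euclidean_space \<Rightarrow> 'a \<Rightarrow> complex"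
  assumes E: "\<And>x y. (x, y) \<in> E \<Longrightarrow> closed_segment x y \<subseteq> K \<and> dist x y \<le> \<delta>"
    and near: "\<And>x y. closed_segment x y \<subseteq> K \<Longrightarrow> norm (Y x y - \<omega> x y) \<le> C * dist x y powr \<theta>"
    and \<theta>: "\<theta> > 1" and C: "C \<ge> 0"
  shows "norm ((\<Sum>(x,y)\<in>E. Y x y) - (\<Sum>(x,y)\<in>E. \<omega> x y)) \<le> C * \<delta> powr (\<theta> - 1) * (\<Sum>(x,y)\<in>E. dist x y)"
proof -
  have "norm (Y (fst e) (snd e) - \<omega> (fst e) (snd e)) \<le> C * \<delta> powr (\<theta> - 1) * dist (fst e) (snd e)"
    if "e \<in> E" for e
  proof -
    let ?d = "dist (fst e) (snd e)"
    have e: "closed_segment (fst e) (snd e) \<subseteq> K" "?d \<le> \<delta>" using E[of "fst e" "snd e"] that by auto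
    have "norm (Y (fst e) (snd e) - \<omega> (fst e) (snd e)) \<le> C * ?d powr \<theta>" by (rule near[OF e(1)])
    also have "?d powr \<theta> = ?d powr (\<theta> - 1) * ?d" by (cases "?d = 0") (auto simp: powr_diff)
    also have "C * (?d powr (\<theta> - 1) * ?d) \<le> C * (\<delta> powr (\<theta> - 1) * ?d)"
      using e(2) \<theta> C by (intro mult_left_mono mult_right_mono powr_mono2) auto
    finally show ?thesis by (simp add: mult.assoc)
  qed
  hence "norm (\<Sum>e\<in>E. Y (fst e) (snd e) - \<omega> (fst e) (snd e))
      \<le> (\<Sum>e\<in>E. C * \<delta> powr (\<theta> - 1) * dist (fst e) (snd e))" by (rule sum_norm_le)
  thus ?thesis by (simp add: case_prod_beta sum_subtractf flip: sum_distrib_left)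
qed

section \<open>Triangulations adapted to the pieces\<close>

context self_similar_region
begin

text \<open>All that is retained of a level subdivision: each triangle lies in one piece, so sums
  over the level can be sorted by words.\<close>

definition adapted :: "nat \<Rightarrow> plane set set \<Rightarrow> bool" where
  "adapted n \<T> \<longleftrightarrow> face_to_face \<T> \<and> \<Union>\<T> = level n \<and> (\<forall>K\<in>\<T>. \<exists>w\<in>words S n. K \<subseteq> W w ` P)"

definition pieces :: "plane set set \<Rightarrow> 'j list \<Rightarrow> plane set set" where
  "pieces \<T> w = {K \<in> \<T>. K \<subseteq> W w ` P}"

lemma words_set: "w \<in> words S n \<Longrightarrow> set w \<subseteq> S"
  by (simp add: words_def)

lemma W_closure_interior: "set w \<subseteq> S \<Longrightarrow> closure (interior (W w ` P)) = W w ` P"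
  by (simp add: W_interior similarity_closure[OF W_similarity] closure_interior_P)

text \<open>A triangle through an interior point of the piece \<open>w\<close> cannot lie in another
  piece, since every piece is the closure of its interior and the interiors are disjoint.\<close>

lemma pieces_Union:
  assumes T: "adapted n \<T>" and w: "w \<in> words S n"
  shows "\<Union>(pieces \<T> w) = W w ` P"
proof
  show "\<Union>(pieces \<T> w) \<subseteq> W w ` P" by (auto simp: pieces_def)
  have face: "face_to_face \<T>" using T by (simp add: adapted_def)
  have "interior (W w ` P) \<subseteq> \<Union>(pieces \<T> w)"
  proof
    fix x assume x: "x \<in> interior (W w ` P)"
    hence "x \<in> level n" using w interior_subset by (fastforce simp: level_def)
    moreover have "\<Union>\<T> = level n" using T by (simp add: adapted_def)
    ultimately obtain K where K: "K \<in> \<T>" "x \<in> K" by blast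
    obtain v where v: "v \<in> words S n" "K \<subseteq> W v ` P" using T K(1) by (auto simp: adapted_def)
    have "v = w"
    proof (rule ccontr)
      assume "v \<noteq> w"
      hence "interior (W w ` P) \<inter> interior (W v ` P) = {}" using words_W_disjoint[OF w v(1)] by auto
      hence "interior (W w ` P) \<inter> closure (interior (W v ` P)) = {}"
        by (simp add: open_Int_closure_eq_empty)
      thus False using x K(2) v(2) W_closure_interior[OF words_set[OF v(1)]] by auto
    qed
    thus "x \<in> \<Union>(pieces \<T> w)" using K v(2) by (auto simp: pieces_def)
  qed
  moreover have "closed (\<Union>(pieces \<T> w))"
    using face face_to_face_compact[OF face]
    by (intro closed_Union) (auto simp: pieces_def face_to_face_def compact_imp_closed)
  ultimately have "closure (interior (W w ` P)) \<subseteq> \<Union>(pieces \<T> w)" by (rule closure_minimal)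
  thus "W w ` P \<subseteq> \<Union>(pieces \<T> w)" by (simp add: W_closure_interior[OF words_set[OF w]])
qed

text \<open>A triangle has interior points, so it cannot lie in two pieces.\<close>

lemma sum_pieces:
  assumes T: "adapted n \<T>"
  shows "(\<Sum>K\<in>\<T>. h K) = (\<Sum>w\<in>words S n. \<Sum>K\<in>pieces \<T> w. h K)"
proof -
  have face: "face_to_face \<T>" using T by (simp add: adapted_def)
  have eq: "\<T> = (\<Union>w\<in>words S n. pieces \<T> w)" using T by (auto simp: adapted_def pieces_def)
  have "pieces \<T> v \<inter> pieces \<T> w = {}" if vw: "v \<in> words S n" "w \<in> words S n" "v \<noteq> w" for v w
  proof -
    have False if K: "K \<in> pieces \<T> v" "K \<in> pieces \<T> w" for K
    proof -
      have "interior K \<subseteq> interior (W v ` P) \<inter> interior (W w ` P)"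
        using K by (auto simp: pieces_def dest: interior_mono)
      moreover have "interior K \<noteq> {}"
        using K face by (intro triangle_interior_nonempty) (auto simp: pieces_def face_to_face_def)
      ultimately show False using words_W_disjoint[OF vw] by blast
    qed
    thus ?thesis by blast
  qed
  moreover have "finite (pieces \<T> w)" for w using face by (simp add: pieces_def face_to_face_def)
  ultimately have "(\<Sum>K\<in>(\<Union>w\<in>words S n. pieces \<T> w). h K) = (\<Sum>w\<in>words S n. \<Sum>K\<in>pieces \<T> w. h K)"
    using finite_words[OF finite_S] by (intro sum.UNION_disjoint) auto
  thus ?thesis using eq by simp
qed

lemma diameter_P: obtains D where "D \<ge> 0" "\<And>x y. \<lbrakk>x \<in> P; y \<in> P\<rbrakk> \<Longrightarrow> dist x y \<le> D"
  using compact_imp_bounded[OF compact_P] by (metis diameter_bounded_bound diameter_ge_0)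

lemma frontier_P_nonempty: "frontier P \<noteq> {}"
proof -
  have "P \<noteq> UNIV" using compact_P not_bounded_UNIV compact_imp_bounded by auto
  moreover have "P \<noteq> {}" using interior_P by auto
  ultimately show ?thesis by (simp add: frontier_eq_empty)
qed

lemma frontier_W_attractor: "set w \<subseteq> S \<Longrightarrow> frontier (W w ` P) \<subseteq> attractor"
  using W_attractor frontier_P_attractor by (force simp: W_frontier)

lemma W_P_dist:
  assumes D: "\<And>x y. \<lbrakk>x \<in> P; y \<in> P\<rbrakk> \<Longrightarrow> dist x y \<le> D"
    and w: "set w \<subseteq> S" and xy: "x \<in> W w ` P" "y \<in> W w ` P"
  shows "dist x y \<le> ratio w * D"
proof -
  obtain p q where "p \<in> P" "q \<in> P" "x = W w p" "y = W w q" using xy by blast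
  thus ?thesis
    using D[of p q] ratio_pos[OF w] by (simp add: similarity_dist[OF W_similarity[OF w]] mult_left_mono)
qed

text \<open>The boundary edges of an arbitrary triangulation of the piece are traded for the images
  of the fixed boundary edges of \<open>\<T>0\<close>; this is why \<open>C\<close> can be chosen
  before \<open>w\<close> and \<open>\<T>\<close>.\<close>

lemma piece_sum_bound:
  assumes \<alpha>: "2 * \<alpha> > 1" and f: "hoelder_on \<alpha> cf attractor f" "cf \<ge> 0" and g: "hoelder_on \<alpha> cg attractor g" "cg \<ge> 0"
    and T0: "face_to_face \<T>0" "\<Union>\<T>0 = P"
  obtains C where "C \<ge> 0" "\<And>w \<T>. \<lbrakk>set w \<subseteq> S; face_to_face \<T>; \<Union>\<T> = W w ` P\<rbrakk> \<Longrightarrow>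
    norm (\<Sum>K\<in>\<T>. \<Sum>(x,y)\<in>triangle_edges K. bracket f g x y) \<le> C * ratio w powr (2 * \<alpha>)"
proof -
  define \<theta> where "\<theta> = 2 * \<alpha>"
  have \<theta>: "\<theta> > 1" using \<alpha> by (simp add: \<theta>_def)
  obtain M where M: "M \<ge> 0" and young: "\<And>K f g cf cg. \<lbrakk>hoelder_on \<alpha> cf K f; hoelder_on \<alpha> cg K g; cf \<ge> 0; cg \<ge> 0\<rbrakk> \<Longrightarrow>
      \<exists>Y. additive_on K Y \<and> (\<forall>x y. closed_segment x y \<subseteq> K \<longrightarrow>
        norm (Y x y - bracket f g x (y::plane)) \<le> M * (cf * cg) * dist x y powr (2 * \<alpha>))"
    using young_integral_exists[OF \<alpha>, where 'a = plane] by blast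
  obtain D where D: "D \<ge> 0" "\<And>x y. \<lbrakk>x \<in> P; y \<in> P\<rbrakk> \<Longrightarrow> dist x y \<le> D" using diameter_P by blast
  define B0 where "B0 = boundary_edges \<T>0"
  define L0 where "L0 = (\<Sum>(x,y)\<in>B0. dist x y)"
  define c where "c = cf * cg"
  have c: "c \<ge> 0" using f(2) g(2) by (simp add: c_def)
  have B0: "nonoverlapping B0" "\<Union>(edge_segment ` B0) = frontier P"
    using nonoverlapping_boundary_edges[OF T0(1)] boundary_edges_Union[OF T0(1)] T0(2) by (simp_all add: B0_def)
  have finB0: "finite B0" using B0(1) by (simp add: nonoverlapping_def)
  have B0_left: "left_edge P (fst e) (snd e)" if "e \<in> B0" for e
    using boundary_edge_left_edge[OF T0(1), of "fst e" "snd e"] that T0(2) by (simp add: B0_def)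
  have L0: "L0 \<ge> 0" unfolding L0_def by (intro sum_nonneg) auto
  \<comment> \<open>The first summand bounds \<open>Y\<close> on the at most \<open>card B0\<close>
    image edges, the second the error of replacing the bracket by \<open>Y\<close> on the actual
    edges.\<close>
  define C where "C = real (card B0) * ((2 * c + M * c) * D powr \<theta>) + M * c * D powr (\<theta> - 1) * L0"
  show ?thesis
  proof (rule that[of C])
    show "C \<ge> 0" using M c L0 by (simp add: C_def)
    fix w \<T> assume w: "set w \<subseteq> S" and T: "face_to_face \<T>" "\<Union>\<T> = W w ` P"
    let ?R = "W w ` P" and ?\<rho> = "ratio w" and ?E = "boundary_edges \<T>"
    have sim: "similarity ?\<rho> (W w)" by (rule W_similarity[OF w])
    have \<rho>: "?\<rho> > 0" by (rule ratio_pos[OF w])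
    have fr: "frontier ?R \<subseteq> attractor" by (rule frontier_W_attractor[OF w])
    have frR: "frontier ?R \<subseteq> ?R" using W_compact[OF w] compact_imp_closed frontier_subset_closed by blast
    have distR: "dist x y \<le> ?\<rho> * D" if "x \<in> ?R" "y \<in> ?R" for x y
      by (rule W_P_dist[OF D(2) w that])
    obtain z where z: "z \<in> frontier ?R" using frontier_P_nonempty by (auto simp: W_frontier[OF w])
    \<comment> \<open>Normalised to vanish at a frontier point of the piece, both functions are of
      order \<open>(?\<rho> * D) powr \<alpha>\<close> on its frontier.\<close>
    define f' g' where "f' p = f p - f z" and "g' p = g p - g z" for p
    have hol: "hoelder_on \<alpha> cf attractor f'" "hoelder_on \<alpha> cg attractor g'"
      using f(1) g(1) by (simp_all add: hoelder_on_def f'_def g'_def)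
    obtain Y where Y: "additive_on attractor Y" "\<And>x y. closed_segment x y \<subseteq> attractor \<Longrightarrow>
        norm (Y x y - bracket f' g' x y) \<le> M * c * dist x y powr \<theta>"
      using young[OF hol f(2) g(2)] by (auto simp: c_def \<theta>_def)
    \<comment> \<open>The similarity may reverse orientation; \<open>ori\<close> directs each image
      edge so that the piece lies on its left.\<close>
    define ori where "ori e = (if left_edge ?R (W w (fst e)) (W w (snd e))
        then (W w (fst e), W w (snd e)) else (W w (snd e), W w (fst e)))" for e
    define E' where "E' = ori ` B0"
    have ori_left: "left_edge ?R (fst (ori e)) (snd (ori e))" if "e \<in> B0" for e
      using similarity_left_edge[OF sim B0_left[OF that]] by (auto simp: ori_def)
    have ori_seg: "edge_segment (ori e) = W w ` edge_segment e" for e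
      by (simp add: ori_def similarity_closed_segment[OF sim] insert_commute)
    have ori_dist: "dist (fst (ori e)) (snd (ori e)) = ?\<rho> * dist (fst e) (snd e)" for e
      by (simp add: ori_def similarity_dist[OF sim] dist_commute)
    have E: "nonoverlapping ?E" "\<Union>(edge_segment ` ?E) = frontier ?R"
      using nonoverlapping_boundary_edges[OF T(1)] boundary_edges_Union[OF T(1)] T(2) by simp_all
    have E'_no: "nonoverlapping E'"
      unfolding nonoverlapping_def
    proof (intro conjI ballI impI)
      show "finite E'" using finB0 by (simp add: E'_def)
      fix e assume "e \<in> E'"
      thus "fst e \<noteq> snd e" using ori_left by (auto simp: E'_def left_edge_def)
    next
      fix e e' assume ee: "e \<in> E'" "e' \<in> E'" "e \<noteq> e'"
      then obtain a b where ab: "a \<in> B0" "b \<in> B0" "e = ori a" "e' = ori b" by (auto simp: E'_def)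
      hence "finite (edge_segment a \<inter> edge_segment b)" using ee(3) B0(1) by (auto simp: nonoverlapping_def)
      thus "finite (edge_segment e \<inter> edge_segment e')"
        unfolding ab(3,4) ori_seg image_Int[OF similarity_inj[OF sim], symmetric] by simp
    qed
    have E'_U: "\<Union>(edge_segment ` E') = frontier ?R"
    proof -
      have "\<Union>(edge_segment ` E') = W w ` \<Union>(edge_segment ` B0)"
        unfolding E'_def by (auto simp: ori_seg)
      thus ?thesis by (simp only: B0(2) W_frontier[OF w])
    qed
    have eq: "(\<Sum>(x,y)\<in>?E. Z x y) = (\<Sum>(x,y)\<in>E'. Z x y)"
      if "additive_on attractor Z" for Z :: "plane \<Rightarrow> plane \<Rightarrow> 'z::real_normed_vector"
    proof (rule additive_sum_edges_eq[OF that E(1) E'_no])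
      fix x y u v assume *: "(x, y) \<in> ?E" "(u, v) \<in> E'" "infinite (closed_segment x y \<inter> closed_segment u v)"
      have "left_edge ?R x y" using boundary_edge_left_edge[OF T(1) *(1)] T(2) by simp
      moreover have "left_edge ?R u v" using *(2) ori_left by (auto simp: E'_def) (metis fst_conv snd_conv)
      ultimately show "(y - x) \<bullet> (v - u) > 0" using left_edges_same_direction *(3) by blast
    qed (use fr in \<open>simp_all only: E(2) E'_U Diff_cancel finite.emptyI\<close>)
    \<comment> \<open>The comparison of subdivisions, applied to the additive function
      \<open>dist\<close>.\<close>
    have len: "(\<Sum>(x,y)\<in>?E. dist x y) \<le> ?\<rho> * L0"
    proof -
      have "(\<Sum>(x,y)\<in>?E. dist x y) = (\<Sum>e\<in>E'. dist (fst e) (snd e))"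
        using eq[OF additive_on_dist] by (simp add: case_prod_beta)
      also have "\<dots> \<le> (\<Sum>e\<in>B0. dist (fst (ori e)) (snd (ori e)))"
        unfolding E'_def using sum_image_le[OF finB0, of "\<lambda>e. dist (fst e) (snd e)" ori] by (simp add: o_def)
      also have "\<dots> = ?\<rho> * L0" by (simp add: ori_dist L0_def case_prod_beta sum_distrib_left)
      finally show ?thesis .
    qed
    have edge: "closed_segment x y \<subseteq> attractor \<and> dist x y \<le> ?\<rho> * D" if "closed_segment x y \<subseteq> frontier ?R" for x y
    proof -
      have "x \<in> ?R" "y \<in> ?R" using that frR ends_in_segment by blast+
      thus ?thesis using that fr distR by blast
    qed
    have segE: "closed_segment x y \<subseteq> frontier ?R" if "(x, y) \<in> ?E" for x y using that E(2) by fastforce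
    have segE': "closed_segment x y \<subseteq> frontier ?R" if "(x, y) \<in> E'" for x y using that E'_U by fastforce
    have A: "norm ((\<Sum>(x,y)\<in>?E. Y x y) - (\<Sum>(x,y)\<in>?E. bracket f' g' x y))
        \<le> M * c * (?\<rho> * D) powr (\<theta> - 1) * (\<Sum>(x,y)\<in>?E. dist x y)"
      using edge segE Y(2) \<theta> M c by (intro sum_edges_estimate[where K = attractor]) auto
    also have "\<dots> \<le> M * c * (?\<rho> * D) powr (\<theta> - 1) * (?\<rho> * L0)"
      using len M c by (intro mult_left_mono) auto
    \<comment> \<open>The mesh contributes the power \<theta> - 1 of the ratio and the length one
      more.\<close>
    also have "\<dots> = M * c * D powr (\<theta> - 1) * L0 * ?\<rho> powr \<theta>"
      using \<rho> D(1) by (simp add: powr_mult powr_diff)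
    finally have A: "norm ((\<Sum>(x,y)\<in>?E. Y x y) - (\<Sum>(x,y)\<in>?E. bracket f' g' x y))
        \<le> M * c * D powr (\<theta> - 1) * L0 * ?\<rho> powr \<theta>" .
    have small: "norm (u p) \<le> k * (?\<rho> * D) powr \<alpha>"
      if "hoelder_on \<alpha> k attractor u" "k \<ge> 0" "u z = 0" "p \<in> frontier ?R" for u k p
    proof -
      have "norm (u p - u z) \<le> k * dist p z powr \<alpha>"
      proof -
        have "p \<in> attractor" "z \<in> attractor" using that(4) z fr by blast+
        thus ?thesis using that(1) unfolding hoelder_on_def by blast
      qed
      also have "\<dots> \<le> k * (?\<rho> * D) powr \<alpha>"
        
      proof (intro mult_left_mono powr_mono2)
        have "p \<in> ?R" "z \<in> ?R" using that(4) z frR by blast+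
        thus "dist p z \<le> ?\<rho> * D" by (rule distR)
      qed (use that(2) \<alpha> in auto)
      finally show ?thesis using that(3) by simp
    qed
    have fz: "f' z = 0" "g' z = 0" by (simp_all add: f'_def g'_def)
    have Y_le: "norm (Y x y) \<le> (2 * c + M * c) * D powr \<theta> * ?\<rho> powr \<theta>" if e: "(x, y) \<in> E'" for x y
    proof -
      note seg = segE'[OF e]
      have xy: "x \<in> frontier ?R" "y \<in> frontier ?R" using seg by auto
      have \<theta>2: "(?\<rho> * D) powr \<alpha> * (?\<rho> * D) powr \<alpha> = D powr \<theta> * ?\<rho> powr \<theta>"
      proof -
        have "\<alpha> + \<alpha> = \<theta>" by (simp add: \<theta>_def)
        thus ?thesis unfolding powr_add[symmetric] using \<rho> D(1) by (simp add: powr_mult)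
      qed
      have "norm (bracket f' g' x y) \<le> norm (f' x) * norm (g' y) + norm (g' x) * norm (f' y)"
        unfolding bracket_def by (metis norm_mult norm_triangle_ineq4)
      also have "\<dots> \<le> (cf * (?\<rho> * D) powr \<alpha>) * (cg * (?\<rho> * D) powr \<alpha>)
          + (cg * (?\<rho> * D) powr \<alpha>) * (cf * (?\<rho> * D) powr \<alpha>)"
        using f(2) g(2) by (intro add_mono mult_mono small hol fz xy) auto
      also have "\<dots> = 2 * c * ((?\<rho> * D) powr \<alpha> * (?\<rho> * D) powr \<alpha>)" by (simp add: c_def)
      finally have b: "norm (bracket f' g' x y) \<le> 2 * c * (D powr \<theta> * ?\<rho> powr \<theta>)" by (simp only: \<theta>2)
      have "norm (Y x y - bracket f' g' x y) \<le> M * c * dist x y powr \<theta>" using Y(2) edge[OF seg] by blast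
      also have "\<dots> \<le> M * c * (?\<rho> * D) powr \<theta>"
        using edge[OF seg] M c \<theta> by (intro mult_left_mono powr_mono2) auto
      also have "\<dots> = M * c * (D powr \<theta> * ?\<rho> powr \<theta>)" using \<rho> D(1) by (simp add: powr_mult)
      finally have "norm (Y x y) \<le> 2 * c * (D powr \<theta> * ?\<rho> powr \<theta>) + M * c * (D powr \<theta> * ?\<rho> powr \<theta>)"
        using b norm_triangle_sub[of "Y x y" "bracket f' g' x y"] by linarith
      thus ?thesis by (simp add: algebra_simps)
    qed
    have "norm (\<Sum>(x,y)\<in>E'. Y x y) \<le> (\<Sum>e\<in>E'. (2 * c + M * c) * D powr \<theta> * ?\<rho> powr \<theta>)"
      by (rule sum_norm_le) (use Y_le in auto)
    also have "\<dots> = real (card E') * ((2 * c + M * c) * D powr \<theta> * ?\<rho> powr \<theta>)" by simp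
    also have "\<dots> \<le> real (card B0) * ((2 * c + M * c) * D powr \<theta> * ?\<rho> powr \<theta>)"
      using card_image_le[OF finB0, of ori] M c unfolding E'_def by (intro mult_right_mono) auto
    finally have B: "norm (\<Sum>(x,y)\<in>?E. Y x y) \<le> real (card B0) * ((2 * c + M * c) * D powr \<theta> * ?\<rho> powr \<theta>)"
      unfolding eq[OF Y(1)] .
    have "(\<Sum>K\<in>\<T>. \<Sum>(x,y)\<in>triangle_edges K. bracket f g x y) = (\<Sum>(x,y)\<in>?E. bracket f' g' x y)"
      unfolding f'_def g'_def by (rule sum_bracket_shift[OF T(1)])
    hence "norm (\<Sum>K\<in>\<T>. \<Sum>(x,y)\<in>triangle_edges K. bracket f g x y)
        \<le> real (card B0) * ((2 * c + M * c) * D powr \<theta> * ?\<rho> powr \<theta>) + M * c * D powr (\<theta> - 1) * L0 * ?\<rho> powr \<theta>"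
      using A B norm_triangle_ineq4[of "\<Sum>(x,y)\<in>?E. Y x y" "(\<Sum>(x,y)\<in>?E. Y x y) - (\<Sum>(x,y)\<in>?E. bracket f' g' x y)"]
      by simp
    also have "\<dots> = C * ?\<rho> powr \<theta>" by (simp add: C_def distrib_right)
    finally show "norm (\<Sum>K\<in>\<T>. \<Sum>(x,y)\<in>triangle_edges K. bracket f g x y) \<le> C * ratio w powr (2 * \<alpha>)"
      by (simp add: \<theta>_def)
  qed
qed

lemma sum_ratio_words: "(\<Sum>w\<in>words S n. ratio w powr s) = (\<Sum>j\<in>S. r j powr s) ^ n"
proof -
  have "ratio w powr s = prod_list (map (\<lambda>j. r j powr s) w)" if "set w \<subseteq> S" for w
    using that
  proof (induction w)
    case (Cons j w)
    thus ?case using ratio_pos[of w] similarity_pos[OF G, of j] by (simp add: powr_mult)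
  qed simp
  hence "(\<Sum>w\<in>words S n. ratio w powr s) = (\<Sum>w\<in>words S n. prod_list (map (\<lambda>j. r j powr s) w))"
    by (intro sum.cong refl) (auto simp: words_def)
  thus ?thesis by (simp add: sum_words_prod_list)
qed

lemma level_sum_tendsto_0:
  assumes \<alpha>: "2 * \<alpha> > 1" and ratios: "(\<Sum>j\<in>S. r j powr (2 * \<alpha>)) < 1"
    and f: "hoelder_on \<alpha> cf attractor f" "cf \<ge> 0" and g: "hoelder_on \<alpha> cg attractor g" "cg \<ge> 0"
    and T: "\<And>n. adapted n (\<T> n)"
  shows "(\<lambda>n. \<Sum>K\<in>\<T> n. \<Sum>(x,y)\<in>triangle_edges K. bracket f g x y) \<longlonglongrightarrow> 0"
proof -
  have face: "face_to_face (\<T> n)" for n using T by (simp add: adapted_def)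
  have U0: "\<Union>(\<T> 0) = P" using T[of 0] by (simp add: adapted_def level_0)
  obtain C where C: "C \<ge> 0" "\<And>w \<T>. \<lbrakk>set w \<subseteq> S; face_to_face \<T>; \<Union>\<T> = W w ` P\<rbrakk> \<Longrightarrow>
      norm (\<Sum>K\<in>\<T>. \<Sum>(x,y)\<in>triangle_edges K. bracket f g x y) \<le> C * ratio w powr (2 * \<alpha>)"
    by (rule piece_sum_bound[OF \<alpha> f g face[of 0] U0]) blast
  let ?q = "\<Sum>j\<in>S. r j powr (2 * \<alpha>)"
  have bound: "norm (\<Sum>K\<in>\<T> n. \<Sum>(x,y)\<in>triangle_edges K. bracket f g x y) \<le> C * ?q ^ n" for n
  proof -
    have "norm (\<Sum>w\<in>words S n. \<Sum>K\<in>pieces (\<T> n) w. \<Sum>(x,y)\<in>triangle_edges K. bracket f g x y)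
        \<le> (\<Sum>w\<in>words S n. C * ratio w powr (2 * \<alpha>))"
    proof (intro sum_norm_le C(2))
      fix w assume w: "w \<in> words S n"
      show "set w \<subseteq> S" by (rule words_set[OF w])
      show "face_to_face (pieces (\<T> n) w)"
        by (rule face_to_face_subset[OF face]) (auto simp: pieces_def)
      show "\<Union>(pieces (\<T> n) w) = W w ` P" by (rule pieces_Union[OF T w])
    qed
    also have "\<dots> = C * ?q ^ n" by (simp only: sum_ratio_words sum_distrib_left[symmetric])
    finally show ?thesis unfolding sum_pieces[OF T] .
  qed
  have "(\<lambda>n. C * ?q ^ n) \<longlonglongrightarrow> 0"
    using ratios by (intro tendsto_mult_right_zero LIMSEQ_power_zero) (simp add: sum_nonneg)
  thus ?thesis
    by (rule Lim_null_comparison[OF always_eventually[OF allI[OF bound]]])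
qed

text \<open>The boundary edges of level n inside \<open>frontier P\<close> cover it up to finitely
  many points, so \<open>Y\<close> and the length have the same sums over them as at level 0. The
  mesh tends to 0 while the length stays fixed.\<close>

lemma outer_sum_tendsto:
  fixes Y \<omega> :: "plane \<Rightarrow> plane \<Rightarrow> complex"
  assumes \<alpha>: "2 * \<alpha> > 1" and T: "\<And>n. adapted n (\<T> n)"
    and Y: "additive_on attractor Y" "\<And>x y. closed_segment x y \<subseteq> attractor \<Longrightarrow>
        norm (Y x y - \<omega> x y) \<le> C * dist x y powr (2 * \<alpha>)"
    and C: "C \<ge> 0" and anti: "\<And>x y. \<omega> x y = - \<omega> y x"
  shows "(\<lambda>n. \<Sum>K\<in>\<T> n. \<Sum>(x,y)\<in>triangle_edges K. if closed_segment x y \<subseteq> frontier P then \<omega> x y else 0)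
    \<longlonglongrightarrow> (\<Sum>(x,y)\<in>boundary_edges (\<T> 0). Y x y)"
proof -
  define \<theta> where "\<theta> = 2 * \<alpha>"
  have \<theta>: "\<theta> > 1" using \<alpha> by (simp add: \<theta>_def)
  have face: "face_to_face (\<T> n)" for n using T by (simp add: adapted_def)
  have UT: "\<Union>(\<T> n) = level n" for n using T by (simp add: adapted_def)
  define B where "B n = boundary_edges (\<T> n)" for n
  define E where "E n = {e \<in> B n. edge_segment e \<subseteq> frontier P}" for n
  define L0 where "L0 = (\<Sum>(x,y)\<in>B 0. dist x y)"
  have L0: "L0 \<ge> 0" unfolding L0_def by (intro sum_nonneg) auto
  obtain D where D: "D \<ge> 0" "\<And>x y. \<lbrakk>x \<in> P; y \<in> P\<rbrakk> \<Longrightarrow> dist x y \<le> D" using diameter_P by blast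
  have finB: "finite (B n)" for n unfolding B_def by (rule finite_boundary_edges[OF face])
  have left: "left_edge (level n) x y" if "(x, y) \<in> B n" for n x y
    using boundary_edge_left_edge[OF face] that by (simp add: B_def UT[symmetric])
  have B0_U: "\<Union>(edge_segment ` B 0) = frontier P"
    using boundary_edges_Union[OF face, of 0] by (simp add: B_def UT level_0)
  have E_U: "\<Union>(edge_segment ` E n) \<subseteq> frontier P" for n by (auto simp: E_def)
  \<comment> \<open>An uncovered point lies on a boundary edge of level n not contained in
    \<open>frontier P\<close>. By the dichotomy the interior of that edge misses
    \<open>frontier P\<close>, so the point is an end of it.\<close>
  have cover: "finite (frontier P - \<Union>(edge_segment ` E n))" for n
  proof (rule finite_subset)
    show "finite (fst ` B n \<union> snd ` B n)" using finB by simp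
    show "frontier P - \<Union>(edge_segment ` E n) \<subseteq> fst ` B n \<union> snd ` B n"
    proof
      fix z assume z: "z \<in> frontier P - \<Union>(edge_segment ` E n)"
      hence "z \<in> frontier (level n)" using frontier_P_frontier_level by blast
      hence "z \<in> \<Union>(edge_segment ` B n)"
        using boundary_edges_Union[OF face, of n] by (simp add: B_def UT)
      then obtain e where e: "e \<in> B n" "z \<in> edge_segment e" by blast
      have "\<not> edge_segment e \<subseteq> frontier P" using z e by (auto simp: E_def)
      moreover have "left_edge (level n) (fst e) (snd e)" using left e(1) by simp
      ultimately have "open_segment (fst e) (snd e) \<inter> frontier P = {}"
        using left_edge_frontier_dichotomy[OF _ level_subset frontier_P_frontier_level closed_P] by blast
      hence "z \<notin> open_segment (fst e) (snd e)" using z by blast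
      hence "z = fst e \<or> z = snd e" using e(2) by (auto simp: open_segment_def)
      thus "z \<in> fst ` B n \<union> snd ` B n" using e(1) by auto
    qed
  qed
  have no: "nonoverlapping (E n)" "nonoverlapping (B n)" for n
  proof -
    show "nonoverlapping (B n)" unfolding B_def by (rule nonoverlapping_boundary_edges[OF face])
    thus "nonoverlapping (E n)" by (rule nonoverlapping_subset) (auto simp: E_def)
  qed
  have eq: "(\<Sum>(x,y)\<in>E n. Z x y) = (\<Sum>(x,y)\<in>B 0. Z x y)"
    if "additive_on attractor Z" for Z :: "plane \<Rightarrow> plane \<Rightarrow> 'z::real_normed_vector" and n
  proof (rule additive_sum_edges_eq[OF that no])
    show "\<Union>(edge_segment ` E n) \<subseteq> attractor" "\<Union>(edge_segment ` B 0) \<subseteq> attractor"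
      using E_U B0_U frontier_P_attractor by blast+
    show "finite (\<Union>(edge_segment ` E n) - \<Union>(edge_segment ` B 0))"
    proof -
      have "\<Union>(edge_segment ` E n) - \<Union>(edge_segment ` B 0) = {}" using E_U[of n] unfolding B0_U by blast
      thus ?thesis by (simp only: finite.emptyI)
    qed
    show "finite (\<Union>(edge_segment ` B 0) - \<Union>(edge_segment ` E n))" unfolding B0_U by (rule cover)
    fix x y u v assume *: "(x, y) \<in> E n" "(u, v) \<in> B 0" "infinite (closed_segment x y \<inter> closed_segment u v)"
    have "left_edge (level n) x y" using *(1) left by (simp add: E_def)
    moreover have "left_edge P u v" using left[OF *(2)] by (simp add: level_0)
    ultimately show "(y - x) \<bullet> (v - u) > 0"
      using left_edges_same_direction level_subset *(3) by blast
  qed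
  \<comment> \<open>Truncation to segments in \<open>frontier P\<close> keeps the form
    antisymmetric, so interior edges still cancel.\<close>
  have sum_eq: "(\<Sum>K\<in>\<T> n. \<Sum>(x,y)\<in>triangle_edges K. if closed_segment x y \<subseteq> frontier P then \<omega> x y else 0)
      = (\<Sum>(x,y)\<in>E n. \<omega> x y)" for n
  proof -
    have "(\<Sum>K\<in>\<T> n. \<Sum>(x,y)\<in>triangle_edges K. if closed_segment x y \<subseteq> frontier P then \<omega> x y else 0)
        = (\<Sum>(x,y)\<in>B n. if closed_segment x y \<subseteq> frontier P then \<omega> x y else 0)"
      unfolding B_def
    proof (rule sum_triangle_edges_eq_boundary_edges[OF face,
          where \<eta> = "\<lambda>x y. if closed_segment x y \<subseteq> frontier P then \<omega> x y else 0"])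
      show "(if closed_segment x y \<subseteq> frontier P then \<omega> x y else 0) =
          - (if closed_segment y x \<subseteq> frontier P then \<omega> y x else 0)" for x y
        using anti[of x y] by (simp add: closed_segment_commute)
    qed
    also have "\<dots> = (\<Sum>(x,y)\<in>E n. \<omega> x y)"
      unfolding E_def case_prod_beta by (rule sum.inter_filter[symmetric]) (rule finB)
    finally show ?thesis .
  qed
  have bound: "norm ((\<Sum>(x,y)\<in>E n. Y x y) - (\<Sum>(x,y)\<in>E n. \<omega> x y)) \<le> C * (rmax ^ n * D) powr (\<theta> - 1) * L0" for n
  proof -
    have "closed_segment x y \<subseteq> attractor \<and> dist x y \<le> rmax ^ n * D" if xy: "(x, y) \<in> E n" for x y
    proof
      have seg: "closed_segment x y \<subseteq> frontier P" using xy by (simp add: E_def)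
      thus "closed_segment x y \<subseteq> attractor" using frontier_P_attractor by blast
      obtain K where K: "K \<in> \<T> n" "(x, y) \<in> triangle_edges K"
        using xy by (auto simp: E_def B_def boundary_edges_def)
      obtain c where c: "K = convex hull {x, y, c}" by (rule triangle_edgesE[OF K(2)])
      obtain w where w: "w \<in> words S n" "K \<subseteq> W w ` P" using T[of n] K(1) by (auto simp: adapted_def)
      have "x \<in> K" "y \<in> K" unfolding c by (auto intro: hull_inc)
      hence "dist x y \<le> ratio w * D" using w by (intro W_P_dist D(2) words_set[OF w(1)]) auto
      also have "\<dots> \<le> rmax ^ n * D"
        using ratio_le[OF words_set[OF w(1)]] w(1) D(1) by (intro mult_right_mono) (auto simp: words_def)
      finally show "dist x y \<le> rmax ^ n * D" .
    qed
    hence "norm ((\<Sum>(x,y)\<in>E n. Y x y) - (\<Sum>(x,y)\<in>E n. \<omega> x y))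
        \<le> C * (rmax ^ n * D) powr (\<theta> - 1) * (\<Sum>(x,y)\<in>E n. dist x y)"
      using Y(2) \<theta> C unfolding \<theta>_def by (intro sum_edges_estimate[where K = attractor]) auto
    thus ?thesis unfolding eq[OF additive_on_dist] L0_def .
  qed
  have "(\<lambda>n. (rmax powr (\<theta> - 1)) ^ n) \<longlonglongrightarrow> 0"
    using rmax(1,2) \<theta> powr_less_mono2[of "\<theta> - 1" rmax 1] by (intro LIMSEQ_power_zero) auto
  moreover have "(rmax ^ n * D) powr (\<theta> - 1) = (rmax powr (\<theta> - 1)) ^ n * D powr (\<theta> - 1)" for n
    using rmax(1) D(1) by (simp add: powr_mult powr_power powr_realpow[symmetric] powr_powr mult.commute)
  ultimately have "(\<lambda>n. C * (rmax ^ n * D) powr (\<theta> - 1) * L0) \<longlonglongrightarrow> 0"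
    by (auto intro!: tendsto_mult_left_zero tendsto_mult_right_zero)
  hence "(\<lambda>n. (\<Sum>(x,y)\<in>B 0. Y x y) - (\<Sum>(x,y)\<in>E n. \<omega> x y)) \<longlonglongrightarrow> 0"
    by (rule Lim_null_comparison[OF always_eventually[OF allI[OF bound[unfolded eq[OF Y(1)]]]]])
  from tendsto_diff[OF tendsto_const[of "\<Sum>(x,y)\<in>B 0. Y x y"] this]
  show ?thesis unfolding sum_eq by (simp add: B_def)
qed

end


section \<open>The boundary functional\<close>

lemma additive_on_add:
  assumes "additive_on K Y" "additive_on K Z"
  shows "additive_on K (\<lambda>x y. Y x y + Z x y)"
  unfolding additive_on_def
proof (intro allI impI)
  fix x y z assume "closed_segment x y \<subseteq> K" "z \<in> closed_segment x y"
  from additive_onD[OF assms(1) this] additive_onD[OF assms(2) this]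
  show "Y x y + Z x y = Y x z + Z x z + (Y z y + Z z y)" by simp
qed

lemma additive_on_cmult:
  fixes Y :: "'a::euclidean_space \<Rightarrow> 'a \<Rightarrow> complex"
  assumes "additive_on K Y"
  shows "additive_on K (\<lambda>x y. c * Y x y)"
  unfolding additive_on_def
proof (intro allI impI)
  fix x y z assume "closed_segment x y \<subseteq> K" "z \<in> closed_segment x y"
  from additive_onD[OF assms this] show "c * Y x y = c * Y x z + c * Y z y"
    by (simp add: distrib_left)
qed

lemma additive_on_exact: "additive_on K (\<lambda>x y. u y - u x)"
  by (simp add: additive_on_def)

context self_similar_region
begin

abbreviation Alg :: "real \<Rightarrow> (plane \<Rightarrow> complex) set" where "Alg \<alpha> \<equiv> hoelder_algebra \<alpha> attractor"

lemma Alg_hoelder: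
  assumes "f \<in> Alg \<alpha>"
  obtains c where "c \<ge> 0" "hoelder_on \<alpha> c attractor f"
proof -
  obtain c where c: "\<And>x y. \<lbrakk>x \<in> attractor; y \<in> attractor\<rbrakk> \<Longrightarrow> norm (f x - f y) \<le> c * dist x y powr \<alpha>"
    using assms by (auto simp: hoelder_algebra_def)
  have "norm (f x - f y) \<le> max c 0 * dist x y powr \<alpha>" if "x \<in> attractor" "y \<in> attractor" for x y
    using c[OF that] by (rule order_trans) (simp add: mult_right_mono)
  thus ?thesis using that[of "max c 0"] by (simp add: hoelder_on_def)
qed

lemma Alg_bounded:
  assumes f: "f \<in> Alg \<alpha>" and \<alpha>: "\<alpha> > 0"
  obtains B where "B \<ge> 0" "\<And>x. x \<in> attractor \<Longrightarrow> norm (f x) \<le> B"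
proof -
  obtain c where c: "c \<ge> 0" "hoelder_on \<alpha> c attractor f" using Alg_hoelder[OF f] by blast
  obtain D where D: "D \<ge> 0" "\<And>x y. \<lbrakk>x \<in> P; y \<in> P\<rbrakk> \<Longrightarrow> dist x y \<le> D" using diameter_P by blast
  obtain z where z: "z \<in> attractor" using attractor_nonempty by blast
  have "norm (f x) \<le> norm (f z) + c * D powr \<alpha>" if x: "x \<in> attractor" for x
  proof -
    have "norm (f x - f z) \<le> c * dist x z powr \<alpha>" using c(2) x z by (simp add: hoelder_on_def)
    also have "\<dots> \<le> c * D powr \<alpha>"
      using D(2)[of x z] attractor_subset x z c(1) \<alpha> by (intro mult_left_mono powr_mono2) auto
    finally show ?thesis using norm_triangle_sub[of "f x" "f z"] by simp
  qed
  thus ?thesis using that[of "norm (f z) + c * D powr \<alpha>"] c(1) by simp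
qed

lemma Alg_add:
  assumes "f \<in> Alg \<alpha>" "g \<in> Alg \<alpha>"
  shows "(\<lambda>x. f x + g x) \<in> Alg \<alpha>"
proof -
  obtain c where c: "hoelder_on \<alpha> c attractor f" using Alg_hoelder[OF assms(1)] by blast
  obtain d where d: "hoelder_on \<alpha> d attractor g" using Alg_hoelder[OF assms(2)] by blast
  have "norm ((f x + g x) - (f y + g y)) \<le> (c + d) * dist x y powr \<alpha>"
    if "x \<in> attractor" "y \<in> attractor" for x y
  proof -
    have "norm (f x - f y) \<le> c * dist x y powr \<alpha>" "norm (g x - g y) \<le> d * dist x y powr \<alpha>"
      using c d that by (auto simp: hoelder_on_def)
    hence "norm (f x - f y) + norm (g x - g y) \<le> (c + d) * dist x y powr \<alpha>"
      by (simp add: distrib_right)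
    thus ?thesis using norm_triangle_ineq[of "f x - f y" "g x - g y"] by (simp add: algebra_simps)
  qed
  thus ?thesis using assms by (auto simp: hoelder_algebra_def)
qed

lemma Alg_cmult:
  assumes "f \<in> Alg \<alpha>"
  shows "(\<lambda>x. a * f x) \<in> Alg \<alpha>"
proof -
  obtain c where c: "hoelder_on \<alpha> c attractor f" using Alg_hoelder[OF assms] by blast
  have "norm (a * f x - a * f y) \<le> (norm a * c) * dist x y powr \<alpha>"
    if "x \<in> attractor" "y \<in> attractor" for x y
  proof -
    have "norm (a * (f x - f y)) \<le> norm a * (c * dist x y powr \<alpha>)"
      unfolding norm_mult using c that by (intro mult_left_mono) (auto simp: hoelder_on_def)
    thus ?thesis by (simp add: right_diff_distrib mult.assoc)
  qed
  thus ?thesis using assms by (auto simp: hoelder_algebra_def)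
qed

lemma Alg_mult:
  assumes f: "f \<in> Alg \<alpha>" and g: "g \<in> Alg \<alpha>" and \<alpha>: "\<alpha> > 0"
  shows "(\<lambda>x. f x * g x) \<in> Alg \<alpha>"
proof -
  obtain c where c: "c \<ge> 0" "hoelder_on \<alpha> c attractor f" using Alg_hoelder[OF f] by blast
  obtain d where d: "d \<ge> 0" "hoelder_on \<alpha> d attractor g" using Alg_hoelder[OF g] by blast
  obtain B where B: "B \<ge> 0" "\<And>x. x \<in> attractor \<Longrightarrow> norm (f x) \<le> B" using Alg_bounded[OF f \<alpha>] by blast
  obtain B' where B': "B' \<ge> 0" "\<And>x. x \<in> attractor \<Longrightarrow> norm (g x) \<le> B'" using Alg_bounded[OF g \<alpha>] by blast
  have "norm (f x * g x - f y * g y) \<le> (B * d + B' * c) * dist x y powr \<alpha>"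
    if xy: "x \<in> attractor" "y \<in> attractor" for x y
  proof -
    have "f x * g x - f y * g y = f x * (g x - g y) + g y * (f x - f y)" by (simp add: algebra_simps)
    also have "norm \<dots> \<le> norm (f x) * norm (g x - g y) + norm (g y) * norm (f x - f y)"
      by (metis norm_mult norm_triangle_ineq)
    also have "\<dots> \<le> B * (d * dist x y powr \<alpha>) + B' * (c * dist x y powr \<alpha>)"
      using B B' c d xy by (intro add_mono mult_mono) (auto simp: hoelder_on_def)
    finally show ?thesis by (simp add: algebra_simps)
  qed
  thus ?thesis using f g by (auto simp: hoelder_algebra_def)
qed

text \<open>The constant is left open and any such \<open>Y\<close> will do, so linear relations
  between brackets can be carried over to arbitrarily chosen \<open>Y\<close>.\<close>

definition close_to :: "real \<Rightarrow> (plane \<Rightarrow> complex) \<Rightarrow> (plane \<Rightarrow> complex) \<Rightarrow> (plane \<Rightarrow> plane \<Rightarrow> complex) \<Rightarrow> bool" where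
  "close_to \<alpha> f g Y \<longleftrightarrow> additive_on attractor Y \<and>
     (\<exists>C\<ge>0. \<forall>x y. closed_segment x y \<subseteq> attractor \<longrightarrow>
        norm (Y x y - bracket f g x y) \<le> C * dist x y powr (2 * \<alpha>))"

lemma close_to_exists:
  assumes \<alpha>: "2 * \<alpha> > 1" and f: "f \<in> Alg \<alpha>" and g: "g \<in> Alg \<alpha>"
  shows "\<exists>Y. close_to \<alpha> f g Y"
proof -
  obtain c where c: "c \<ge> 0" "hoelder_on \<alpha> c attractor f" using Alg_hoelder[OF f] by blast
  obtain d where d: "d \<ge> 0" "hoelder_on \<alpha> d attractor g" using Alg_hoelder[OF g] by blast
  obtain M where M: "M \<ge> 0" "\<And>K f g cf cg. \<lbrakk>hoelder_on \<alpha> cf K f; hoelder_on \<alpha> cg K g; cf \<ge> 0; cg \<ge> 0\<rbrakk> \<Longrightarrow>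
      \<exists>Y. additive_on K Y \<and> (\<forall>x y. closed_segment x y \<subseteq> K \<longrightarrow>
        norm (Y x y - bracket f g x (y::plane)) \<le> M * (cf * cg) * dist x y powr (2 * \<alpha>))"
    using young_integral_exists[OF \<alpha>, where 'a = plane] by blast
  obtain Y where "additive_on attractor Y" "\<forall>x y. closed_segment x y \<subseteq> attractor \<longrightarrow>
      norm (Y x y - bracket f g x y) \<le> M * (c * d) * dist x y powr (2 * \<alpha>)"
    using M(2)[OF c(2) d(2) c(1) d(1)] by blast
  thus ?thesis unfolding close_to_def using M(1) c(1) d(1)
    by (intro exI[of _ Y] conjI exI[of _ "M * (c * d)"]) auto
qed

lemma close_to_add:
  assumes "close_to \<alpha> f h Y" "close_to \<alpha> g h Z"
  shows "close_to \<alpha> (\<lambda>x. f x + g x) h (\<lambda>x y. Y x y + Z x y)"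
proof -
  obtain C where C: "C \<ge> 0" "\<And>x y. closed_segment x y \<subseteq> attractor \<Longrightarrow>
      norm (Y x y - bracket f h x y) \<le> C * dist x y powr (2 * \<alpha>)" using assms(1) by (auto simp: close_to_def)
  obtain C' where C': "C' \<ge> 0" "\<And>x y. closed_segment x y \<subseteq> attractor \<Longrightarrow>
      norm (Z x y - bracket g h x y) \<le> C' * dist x y powr (2 * \<alpha>)" using assms(2) by (auto simp: close_to_def)
  have "norm (Y x y + Z x y - bracket (\<lambda>x. f x + g x) h x y) \<le> (C + C') * dist x y powr (2 * \<alpha>)"
    if seg: "closed_segment x y \<subseteq> attractor" for x y
  proof -
    have "Y x y + Z x y - bracket (\<lambda>x. f x + g x) h x y
        = (Y x y - bracket f h x y) + (Z x y - bracket g h x y)"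
      by (simp add: bracket_def algebra_simps)
    also have "norm \<dots> \<le> C * dist x y powr (2 * \<alpha>) + C' * dist x y powr (2 * \<alpha>)"
      by (intro order_trans[OF norm_triangle_ineq] add_mono C(2) C'(2) seg)
    finally show ?thesis by (simp add: distrib_right)
  qed
  thus ?thesis using assms C(1) C'(1)
    unfolding close_to_def by (intro conjI additive_on_add exI[of _ "C + C'"]) auto
qed

lemma close_to_cmult:
  assumes "close_to \<alpha> f g Y"
  shows "close_to \<alpha> (\<lambda>x. a * f x) g (\<lambda>x y. a * Y x y)"
proof -
  obtain C where C: "C \<ge> 0" "\<And>x y. closed_segment x y \<subseteq> attractor \<Longrightarrow>
      norm (Y x y - bracket f g x y) \<le> C * dist x y powr (2 * \<alpha>)" using assms by (auto simp: close_to_def)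
  have "norm (a * Y x y - bracket (\<lambda>x. a * f x) g x y) \<le> (norm a * C) * dist x y powr (2 * \<alpha>)"
    if seg: "closed_segment x y \<subseteq> attractor" for x y
  proof -
    have "a * Y x y - bracket (\<lambda>x. a * f x) g x y = a * (Y x y - bracket f g x y)"
      by (simp add: bracket_def algebra_simps)
    thus ?thesis using C(2)[OF seg] by (simp add: norm_mult mult_left_mono mult.assoc)
  qed
  thus ?thesis using assms C(1)
    unfolding close_to_def by (intro conjI additive_on_cmult exI[of _ "norm a * C"]) auto
qed

lemma close_to_swap:
  assumes "close_to \<alpha> f g Y"
  shows "close_to \<alpha> g f (\<lambda>x y. - Y x y)"
proof -
  obtain C where C: "C \<ge> 0" "\<And>x y. closed_segment x y \<subseteq> attractor \<Longrightarrow>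
      norm (Y x y - bracket f g x y) \<le> C * dist x y powr (2 * \<alpha>)" using assms by (auto simp: close_to_def)
  have "norm (- Y x y - bracket g f x y) \<le> C * dist x y powr (2 * \<alpha>)"
    if seg: "closed_segment x y \<subseteq> attractor" for x y
  proof -
    have "- Y x y - bracket g f x y = - (Y x y - bracket f g x y)" by (simp add: bracket_def)
    thus ?thesis using C(2)[OF seg] by (simp only: norm_minus_cancel)
  qed
  moreover have "additive_on attractor (\<lambda>x y. - Y x y)"
    using additive_on_cmult[of attractor Y "- 1"] assms by (simp add: close_to_def)
  ultimately show ?thesis using C(1) unfolding close_to_def by blast
qed

text \<open>The Leibniz rule with its error: up to the exact form of the product of
  \<open>f\<close>, \<open>g\<close> and \<open>h\<close>, the cocycle expression is a triple
  product of increments.\<close>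

lemma bracket_cocycle:
  "bracket (\<lambda>p. f p * g p) h x y - bracket f (\<lambda>p. g p * h p) x y + bracket (\<lambda>p. h p * f p) g x y
     + (f y * g y * h y - f x * g x * h x) = (f y - f x) * (g y - g x) * (h y - h x)"
  by (simp add: bracket_def algebra_simps)

text \<open>The hypothesis on \<open>\<Phi>\<close> holds for every choice of \<open>Y\<close>, so
  each identity can be tested on a combination of previously chosen ones.\<close>

lemma boundary_functional_cocycle:
  assumes \<alpha>: "2 * \<alpha> > 1" and T0: "face_to_face \<T>0" "\<Union>\<T>0 = P"
    and \<Phi>: "\<And>f g Y. \<lbrakk>f \<in> Alg \<alpha>; g \<in> Alg \<alpha>; close_to \<alpha> f g Y\<rbrakk> \<Longrightarrow> \<Phi> f g = - (\<Sum>(x,y)\<in>boundary_edges \<T>0. Y x y)"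
  shows "\<Phi> \<in> cyclic_1_cocycles (Alg \<alpha>)"
proof -
  let ?B = "boundary_edges \<T>0"
  have \<alpha>0: "\<alpha> > 0" using \<alpha> by simp
  have anti: "\<Phi> f g = - \<Phi> g f" if fg: "f \<in> Alg \<alpha>" "g \<in> Alg \<alpha>" for f g
  proof -
    obtain Y where Y: "close_to \<alpha> f g Y" using close_to_exists[OF \<alpha> fg] by blast
    show ?thesis using \<Phi>[OF fg Y] \<Phi>[OF fg(2,1) close_to_swap[OF Y]]
      by (simp add: case_prod_beta sum_negf)
  qed
  have add: "\<Phi> (\<lambda>x. f x + g x) h = \<Phi> f h + \<Phi> g h" if fgh: "f \<in> Alg \<alpha>" "g \<in> Alg \<alpha>" "h \<in> Alg \<alpha>" for f g h
  proof -
    obtain Y Z where YZ: "close_to \<alpha> f h Y" "close_to \<alpha> g h Z"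
      using close_to_exists[OF \<alpha>] fgh by metis
    show ?thesis
      using \<Phi>[OF fgh(1,3) YZ(1)] \<Phi>[OF fgh(2,3) YZ(2)] \<Phi>[OF Alg_add[OF fgh(1,2)] fgh(3) close_to_add[OF YZ]]
      by (simp add: case_prod_beta sum.distrib)
  qed
  have scale: "\<Phi> (\<lambda>x. c * f x) g = c * \<Phi> f g" if fg: "f \<in> Alg \<alpha>" "g \<in> Alg \<alpha>" for c f g
  proof -
    obtain Y where Y: "close_to \<alpha> f g Y" using close_to_exists[OF \<alpha> fg] by blast
    show ?thesis using \<Phi>[OF fg Y] \<Phi>[OF Alg_cmult[OF fg(1)] fg(2) close_to_cmult[OF Y]]
      by (simp add: case_prod_beta sum_distrib_left)
  qed
  have cocycle: "\<Phi> (\<lambda>x. f x * g x) h - \<Phi> f (\<lambda>x. g x * h x) + \<Phi> (\<lambda>x. h x * f x) g = 0"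
    if f: "f \<in> Alg \<alpha>" and g: "g \<in> Alg \<alpha>" and h: "h \<in> Alg \<alpha>" for f g h
  proof -
    have fg: "(\<lambda>x. f x * g x) \<in> Alg \<alpha>" and gh: "(\<lambda>x. g x * h x) \<in> Alg \<alpha>" and hf: "(\<lambda>x. h x * f x) \<in> Alg \<alpha>"
      using Alg_mult f g h \<alpha>0 by auto
    obtain Y1 where Y1: "close_to \<alpha> (\<lambda>x. f x * g x) h Y1" using close_to_exists[OF \<alpha> fg h] by blast
    obtain Y2 where Y2: "close_to \<alpha> f (\<lambda>x. g x * h x) Y2" using close_to_exists[OF \<alpha> f gh] by blast
    obtain Y3 where Y3: "close_to \<alpha> (\<lambda>x. h x * f x) g Y3" using close_to_exists[OF \<alpha> hf g] by blast
    define u where "u p = f p * g p * h p" for p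
    \<comment> \<open>\<open>Z\<close> is the cocycle expression completed by an exact form; it is
      additive and of order 2\<alpha>, hence zero on the boundary edges.\<close>
    define Z where "Z x y = Y1 x y + (- 1) * Y2 x y + Y3 x y + (u y - u x)" for x y
    obtain C1 where C1: "C1 \<ge> 0" "\<And>x y. closed_segment x y \<subseteq> attractor \<Longrightarrow>
        norm (Y1 x y - bracket (\<lambda>x. f x * g x) h x y) \<le> C1 * dist x y powr (2 * \<alpha>)"
      using Y1 by (auto simp: close_to_def)
    obtain C2 where C2: "C2 \<ge> 0" "\<And>x y. closed_segment x y \<subseteq> attractor \<Longrightarrow>
        norm (Y2 x y - bracket f (\<lambda>x. g x * h x) x y) \<le> C2 * dist x y powr (2 * \<alpha>)"
      using Y2 by (auto simp: close_to_def)
    obtain C3 where C3: "C3 \<ge> 0" "\<And>x y. closed_segment x y \<subseteq> attractor \<Longrightarrow>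
        norm (Y3 x y - bracket (\<lambda>x. h x * f x) g x y) \<le> C3 * dist x y powr (2 * \<alpha>)"
      using Y3 by (auto simp: close_to_def)
    obtain c where c: "c \<ge> 0" "hoelder_on \<alpha> c attractor f" using Alg_hoelder[OF f] by blast
    obtain d where d: "d \<ge> 0" "hoelder_on \<alpha> d attractor g" using Alg_hoelder[OF g] by blast
    obtain b where b: "b \<ge> 0" "\<And>x. x \<in> attractor \<Longrightarrow> norm (h x) \<le> b" using Alg_bounded[OF h \<alpha>0] by blast
    have Zadd: "additive_on attractor Z"
      unfolding Z_def using Y1 Y2 Y3
      by (intro additive_on_add additive_on_cmult additive_on_exact) (auto simp: close_to_def)
    have Zsmall: "norm (Z x y) \<le> (C1 + C2 + C3 + c * d * (2 * b)) * dist x y powr (2 * \<alpha>)"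
      if seg: "closed_segment x y \<subseteq> attractor" for x y
    proof -
      let ?b1 = "bracket (\<lambda>x. f x * g x) h x y" and ?b2 = "bracket f (\<lambda>x. g x * h x) x y"
        and ?b3 = "bracket (\<lambda>x. h x * f x) g x y" and ?d = "dist x y"
      have xy: "x \<in> attractor" "y \<in> attractor" using seg by auto
      have Z: "Z x y = (Y1 x y - ?b1) - (Y2 x y - ?b2) + (Y3 x y - ?b3) + (f y - f x) * (g y - g x) * (h y - h x)"
        using bracket_cocycle[of f g h x y] by (simp add: Z_def u_def algebra_simps)
      have "norm (Z x y) \<le> norm (Y1 x y - ?b1) + norm (Y2 x y - ?b2) + norm (Y3 x y - ?b3)
          + norm ((f y - f x) * (g y - g x) * (h y - h x))"
        unfolding Z by (intro order_trans[OF norm_triangle_ineq] add_mono order_trans[OF norm_triangle_ineq]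
            norm_triangle_ineq4 order_refl)
      also have "\<dots> \<le> C1 * ?d powr (2 * \<alpha>) + C2 * ?d powr (2 * \<alpha>) + C3 * ?d powr (2 * \<alpha>)
          + c * ?d powr \<alpha> * (d * ?d powr \<alpha>) * (2 * b)"
      proof (intro add_mono C1 C2 C3 seg)
        \<comment> \<open>The increments of \<open>f\<close> and \<open>g\<close> already give order
          2\<alpha>; boundedness of the third factor is enough.\<close>
        have "norm (h y - h x) \<le> 2 * b"
          using norm_triangle_ineq4[of "h y" "h x"] b(2)[OF xy(1)] b(2)[OF xy(2)] by linarith
        moreover have "norm (f y - f x) \<le> c * ?d powr \<alpha>" "norm (g y - g x) \<le> d * ?d powr \<alpha>"
          using c(2) d(2) xy by (auto simp: hoelder_on_def dist_commute[of x y])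
        ultimately show "norm ((f y - f x) * (g y - g x) * (h y - h x)) \<le> c * ?d powr \<alpha> * (d * ?d powr \<alpha>) * (2 * b)"
          unfolding norm_mult using c(1) d(1) by (intro mult_mono) auto
      qed
      also have "c * ?d powr \<alpha> * (d * ?d powr \<alpha>) * (2 * b) = c * d * (2 * b) * (?d powr \<alpha> * ?d powr \<alpha>)"
        by simp
      also have "?d powr \<alpha> * ?d powr \<alpha> = ?d powr (2 * \<alpha>)"
        by (metis mult_2 powr_add)
      finally show ?thesis by (simp add: distrib_right)
    qed
    have seg: "closed_segment x y \<subseteq> attractor" if "(x, y) \<in> ?B" for x y
      using boundary_edges_Union[OF T0(1)] T0(2) frontier_P_attractor that by fastforce
    have "(\<Sum>(x,y)\<in>?B. Z x y) = 0"
      using additive_small_imp_zero[OF \<alpha> Zadd Zsmall] seg by (intro sum.neutral) auto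
    moreover have "(\<Sum>(x,y)\<in>?B. Z x y) = (\<Sum>(x,y)\<in>?B. Y1 x y) - (\<Sum>(x,y)\<in>?B. Y2 x y)
        + (\<Sum>(x,y)\<in>?B. Y3 x y) + (\<Sum>(x,y)\<in>?B. u y - u x)"
      by (simp add: Z_def case_prod_beta sum.distrib sum_subtractf)
    moreover have "(\<Sum>(x,y)\<in>?B. u y - u x) = 0" by (rule sum_boundary_edges_exact[OF T0(1)])
    ultimately show ?thesis
      using \<Phi>[OF fg h Y1] \<Phi>[OF f gh Y2] \<Phi>[OF hf g Y3] by (simp add: algebra_simps)
  qed
  have lin1: "linear_functional_on (Alg \<alpha>) (\<lambda>f. \<Phi> f g)" if "g \<in> Alg \<alpha>" for g
    using that add scale by (simp add: linear_functional_on_def)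
  have lin2: "linear_functional_on (Alg \<alpha>) (\<lambda>g. \<Phi> f g)" if f: "f \<in> Alg \<alpha>" for f
    unfolding linear_functional_on_def
  proof (intro conjI ballI allI)
    fix g h assume gh: "g \<in> Alg \<alpha>" "h \<in> Alg \<alpha>"
    show "\<Phi> f (\<lambda>x. g x + h x) = \<Phi> f g + \<Phi> f h"
      using anti[OF f Alg_add[OF gh]] anti[OF f gh(1)] anti[OF f gh(2)] add[OF gh f] by simp
  next
    fix c g assume g: "g \<in> Alg \<alpha>"
    show "\<Phi> f (\<lambda>x. c * g x) = c * \<Phi> f g"
      using anti[OF f Alg_cmult[OF g]] anti[OF f g] scale[OF g f] by simp
  qed
  show ?thesis unfolding cyclic_1_cocycles_def using lin1 lin2 anti cocycle by blast
qed

text \<open>Cut off outside the attractor, because elements of \<open>hoelder_algebra\<close> are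
  represented by their extension by zero.\<close>

definition coordinate :: "2 \<Rightarrow> plane \<Rightarrow> complex" where
  "coordinate i x = (if x \<in> attractor then of_real (x $ i) else 0)"

text \<open>\<open>dist x y\<close> is split into the powers 1 - \<alpha> and \<alpha>; the first is
  nonnegative, so the bounded diameter controls that factor.\<close>

lemma coordinate_Alg:
  assumes "0 < \<alpha>" "\<alpha> \<le> 1"
  shows "coordinate i \<in> Alg \<alpha>"
proof -
  obtain D where D: "D \<ge> 0" "\<And>x y. \<lbrakk>x \<in> P; y \<in> P\<rbrakk> \<Longrightarrow> dist x y \<le> D" using diameter_P by blast
  have "norm (coordinate i x - coordinate i y) \<le> D powr (1 - \<alpha>) * dist x y powr \<alpha>"
    if xy: "x \<in> attractor" "y \<in> attractor" for x y
  proof -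
    have "norm (coordinate i x - coordinate i y) = \<bar>(x - y) $ i\<bar>"
      using xy by (simp add: coordinate_def flip: of_real_diff)
    also have "\<dots> \<le> norm (x - y)" by (rule component_le_norm_cart)
    also have "\<dots> = dist x y powr (1 - \<alpha>) * dist x y powr \<alpha>"
      by (simp add: dist_norm flip: powr_add)
    also have "\<dots> \<le> D powr (1 - \<alpha>) * dist x y powr \<alpha>"
      using D(2)[of x y] xy attractor_subset assms by (intro mult_right_mono powr_mono2) auto
    finally show ?thesis .
  qed
  thus ?thesis by (auto simp: hoelder_algebra_def coordinate_def)
qed

text \<open>For the coordinate functions the boundary sum is twice the area of \<open>P\<close>.\<close>

lemma boundary_functional_coordinates:
  assumes \<alpha>: "0 < \<alpha>" "\<alpha> \<le> 1" and T0: "face_to_face \<T>0" "\<Union>\<T>0 = P"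
    and \<Phi>: "\<And>f g Y. \<lbrakk>f \<in> Alg \<alpha>; g \<in> Alg \<alpha>; close_to \<alpha> f g Y\<rbrakk> \<Longrightarrow> \<Phi> f g = - (\<Sum>(x,y)\<in>boundary_edges \<T>0. Y x y)"
  shows "\<Phi> (coordinate 1) (coordinate 2) \<noteq> 0"
proof -
  \<comment> \<open>For the coordinates the bracket itself is additive, so \<open>Y\<close> is
    explicit and the error is zero.\<close>
  define Y :: "plane \<Rightarrow> plane \<Rightarrow> complex" where "Y x y = of_real (x $ 1 * y $ 2 - x $ 2 * y $ 1)" for x y
  have "additive_on attractor Y" unfolding additive_on_def
  proof (intro allI impI)
    fix x y z :: plane assume "z \<in> closed_segment x y"
    then obtain t where z: "z = (1 - t) *\<^sub>R x + t *\<^sub>R y" by (auto simp: in_segment)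
    show "Y x y = Y x z + Y z y"
      unfolding Y_def z of_real_add[symmetric] by (rule arg_cong[of _ _ of_real]) (simp add: algebra_simps)
  qed
  moreover have "Y x y = bracket (coordinate 1) (coordinate 2) x y" if "closed_segment x y \<subseteq> attractor" for x y
  proof -
    have "x \<in> attractor" "y \<in> attractor" using that by auto
    thus ?thesis by (simp add: Y_def bracket_def coordinate_def)
  qed
  ultimately have "close_to \<alpha> (coordinate 1) (coordinate 2) Y"
    unfolding close_to_def by (intro conjI exI[of _ 0]) auto
  hence "\<Phi> (coordinate 1) (coordinate 2) = - (\<Sum>(x,y)\<in>boundary_edges \<T>0. Y x y)"
    using coordinate_Alg[OF \<alpha>] by (intro \<Phi>) auto
  also have "(\<Sum>(x,y)\<in>boundary_edges \<T>0. Y x y) = (\<Sum>K\<in>\<T>0. \<Sum>(x,y)\<in>triangle_edges K. Y x y)"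
    by (rule sum_triangle_edges_eq_boundary_edges[OF T0(1), symmetric])
      (simp add: Y_def algebra_simps flip: of_real_minus)
  also have "\<dots> = of_real (\<Sum>K\<in>\<T>0. \<Sum>(x,y)\<in>triangle_edges K. x $ 1 * y $ 2 - x $ 2 * y $ 1)"
    by (simp add: Y_def case_prod_beta)
  finally have eq: "\<Phi> (coordinate 1) (coordinate 2) =
      - of_real (\<Sum>K\<in>\<T>0. \<Sum>(x,y)\<in>triangle_edges K. x $ 1 * y $ 2 - x $ 2 * y $ 1)" .
  have "(\<Sum>K\<in>\<T>0. \<Sum>(x,y)\<in>triangle_edges K. x $ 1 * y $ 2 - x $ 2 * y $ 1) > 0"
  proof (rule sum_pos)
    show "finite \<T>0" using T0(1) by (simp add: face_to_face_def)
    show "\<T>0 \<noteq> {}" using T0(2) interior_P by auto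
    fix K assume "K \<in> \<T>0"
    then obtain a b c where abc: "orient a b c > 0" "K = convex hull {a, b, c}"
      by (rule face_to_faceE[OF T0(1)])
    have "a \<noteq> b" "b \<noteq> c" "c \<noteq> a" using triangle_distinct[OF abc(1)] by auto
    \<comment> \<open>The shoelace formula for one triangle.\<close>
    hence "(\<Sum>(x,y)\<in>triangle_edges K. x $ 1 * y $ 2 - x $ 2 * y $ 1) = orient a b c"
      by (simp add: abc(2) triangle_edges_triangle[OF abc(1)]) (simp add: orient_def algebra_simps)
    thus "(\<Sum>(x,y)\<in>triangle_edges K. x $ 1 * y $ 2 - x $ 2 * y $ 1) > 0" using abc(1) by simp
  qed
  thus ?thesis unfolding eq neg_equal_0_iff_equal of_real_eq_0_iff by simp
qed

text \<open>The truncated form is the bracket minus its outer part: the sums of the first tend to 0,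
  those of the second to the boundary sum. No choice made at a level above 0 enters the
  result.\<close>

lemma phi_eq_boundary_sum:
  assumes \<alpha>: "2 * \<alpha> > 1" and ratios: "(\<Sum>j\<in>S. r j powr (2 * \<alpha>)) < 1"
    and X: "\<Union>X = P" and T: "\<And>n. simplicial_complex (T n)" "\<And>n. adapted n {K \<in> T n. 2 simplex K}"
    and s: "\<And>n. admissible_chain (Q n) (T n) (s n)"
    and f: "f \<in> Alg \<alpha>" and g: "g \<in> Alg \<alpha>" and Y: "close_to \<alpha> f g Y"
  shows "phi X s f g = - (\<Sum>(x,y)\<in>boundary_edges {K \<in> T 0. 2 simplex K}. Y x y)"
proof -
  define \<T> where "\<T> n = {K \<in> T n. 2 simplex K}" for n
  have adapted: "adapted n (\<T> n)" for n using T(2) by (simp add: \<T>_def)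
  obtain c where c: "c \<ge> 0" "hoelder_on \<alpha> c attractor f" using Alg_hoelder[OF f] by blast
  obtain d where d: "d \<ge> 0" "hoelder_on \<alpha> d attractor g" using Alg_hoelder[OF g] by blast
  obtain C where C: "C \<ge> 0" "\<And>x y. closed_segment x y \<subseteq> attractor \<Longrightarrow>
      norm (Y x y - bracket f g x y) \<le> C * dist x y powr (2 * \<alpha>)" using Y by (auto simp: close_to_def)
  have Yadd: "additive_on attractor Y" using Y by (simp add: close_to_def)
  let ?\<eta> = "\<lambda>xs. if convex hull set xs \<subseteq> frontier P then 0 else edge_form f g xs"
  have \<eta>: "?\<eta> [x, y] = bracket f g x y - (if closed_segment x y \<subseteq> frontier P then bracket f g x y else 0)" for x y
    by (simp add: edge_form_def bracket_def segment_convex_hull algebra_simps)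
  have anti: "?\<eta> [x, y] = - ?\<eta> [y, x]" for x y
    unfolding \<eta> using bracket_antisym[of f g x y] by (simp add: closed_segment_commute)
  have level: "phi_level X s n f g = (\<Sum>K\<in>\<T> n. \<Sum>(x,y)\<in>triangle_edges K. bracket f g x y)
      - (\<Sum>K\<in>\<T> n. \<Sum>(x,y)\<in>triangle_edges K. if closed_segment x y \<subseteq> frontier P then bracket f g x y else 0)" for n
  proof -
    have "phi_level X s n f g = chain_eval ?\<eta> (chain_boundary (s n))"
      unfolding phi_level_def X by (rule chain_eval_inner_chain)
    also have "\<dots> = (\<Sum>K\<in>\<T> n. \<Sum>(x,y)\<in>triangle_edges K. ?\<eta> [x, y])"
      unfolding \<T>_def by (rule chain_eval_boundary_admissible[where \<eta> = ?\<eta>, OF T(1) s anti])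
    finally show ?thesis unfolding \<eta> by (simp add: case_prod_beta sum_subtractf)
  qed
  have "(\<lambda>n. phi_level X s n f g) \<longlonglongrightarrow> 0 - (\<Sum>(x,y)\<in>boundary_edges (\<T> 0). Y x y)"
    unfolding level
    by (intro tendsto_diff level_sum_tendsto_0[OF \<alpha> ratios c(2,1) d(2,1) adapted]
        outer_sum_tendsto[OF \<alpha> adapted Yadd C(2,1) bracket_antisym])
  thus ?thesis unfolding phi_def \<T>_def by (simp add: limI)
qed

end


section \<open>Subdivisions of cell complexes\<close>

lemma interior_finite_Union_empty:
  assumes "finite \<A>" "\<And>A. A \<in> \<A> \<Longrightarrow> closed A" "\<And>A. A \<in> \<A> \<Longrightarrow> interior A = {}"
  shows "interior (\<Union>\<A>) = {}"
  using assms
proof (induction \<A> rule: finite_induct)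
  case (insert A \<A>)
  hence "interior (\<Union>\<A> \<union> A) = interior (\<Union>\<A>)"
    by (intro interior_closed_Un_empty_interior closed_Union) auto
  thus ?case using insert by (simp add: Un_commute)
qed simp

lemma convex_cell_complexD:
  assumes "convex_cell_complex X"
  shows "finite X" "\<And>C. C \<in> X \<Longrightarrow> polytope C"
    "\<And>C D. \<lbrakk>C \<in> X; D face_of C; D \<noteq> {}\<rbrakk> \<Longrightarrow> D \<in> X"
  using assms unfolding convex_cell_complex_def by blast+

text \<open>A frontier point in a 2-cell is not interior to it, so it lies on a facet, which is
  again a cell of the complex.\<close>

lemma frontier_subset_skeleton:
  assumes X: "convex_cell_complex X"
  shows "frontier (\<Union>X) \<subseteq> cell_skeleton X 1"
proof
  note fin = convex_cell_complexD(1)[OF X] and poly = convex_cell_complexD(2)[OF X]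
    and face = convex_cell_complexD(3)[OF X]
  fix x assume x: "x \<in> frontier (\<Union>X)"
  have "closed (\<Union>X)" using fin poly polytope_imp_closed by (intro closed_Union) auto
  hence "x \<in> \<Union>X" using x frontier_subset_closed by blast
  then obtain C where C: "C \<in> X" "x \<in> C" by blast
  show "x \<in> cell_skeleton X 1"
  proof (cases "aff_dim C \<le> 1")
    case True
    thus ?thesis using C by (auto simp: cell_skeleton_def)
  next
    case False
    moreover have "aff_dim C \<le> 2" using aff_dim_le_DIM[of C] by simp
    ultimately have dim: "aff_dim C = 2" by simp
    hence "affine hull C = UNIV" using aff_dim_eq_full[of C] by simp
    hence "rel_interior C = interior C" by (rule rel_interior_interior)
    moreover have "x \<notin> interior C" using x interior_mono[of C "\<Union>X"] C(1) by (auto simp: frontier_def)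
    ultimately have "x \<in> rel_frontier C" using C(2) closure_subset by (auto simp: rel_frontier_def)
    then obtain D where D: "D facet_of C" "x \<in> D"
      using rel_frontier_of_polyhedron[OF polytope_imp_polyhedron[OF poly[OF C(1)]]] by auto
    hence "D \<in> X" "aff_dim D = 1" using face[OF C(1)] dim by (auto simp: facet_of_def)
    thus ?thesis using D(2) by (auto simp: cell_skeleton_def)
  qed
qed

lemma cell_skeleton_1:
  assumes X: "convex_cell_complex X"
  shows "compact (cell_skeleton X 1)" "interior (cell_skeleton X 1) = {}"
proof -
  note fin = convex_cell_complexD(1)[OF X] and poly = convex_cell_complexD(2)[OF X]
  show "compact (cell_skeleton X 1)"
    unfolding cell_skeleton_def using fin poly polytope_imp_compact by (intro compact_Union) auto
  show "interior (cell_skeleton X 1) = {}"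
    unfolding cell_skeleton_def
  proof (rule interior_finite_Union_empty)
    fix C assume C: "C \<in> {C \<in> X. aff_dim C \<le> int 1}"
    thus "closed C" using poly polytope_imp_closed by auto
    show "interior C = {}" using C aff_dim_nonempty_interior[of C] by auto
  qed (use fin in auto)
qed

lemma cell_skeleton_2: "cell_skeleton X 2 = \<Union>X"
proof -
  have "aff_dim C \<le> int 2" for C :: "plane set" using aff_dim_le_DIM[of C] by simp
  thus ?thesis by (simp add: cell_skeleton_def)
qed

lemma word_map_cong:
  assumes "\<And>j. j \<in> S \<Longrightarrow> F j ` P \<subseteq> P" "\<And>j x. j \<in> S \<Longrightarrow> x \<in> P \<Longrightarrow> G j x = F j x"
    and "set w \<subseteq> S" "x \<in> P"
  shows "word_map F w x = word_map G w x \<and> word_map F w x \<in> P"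
  using assms(3)
proof (induction w)
  case (Cons j w)
  hence "word_map F w x = word_map G w x" "word_map F w x \<in> P" "j \<in> S" by auto
  thus ?case using assms(1)[of j] assms(2)[of j "word_map F w x"] by auto
qed (simp add: assms(4))

lemma cellular_interior_nonempty:
  fixes X :: "plane set set"
  assumes X: "convex_cell_complex X" and C: "C \<in> X" "aff_dim C = 2"
  shows "interior (\<Union>X) \<noteq> {}"
proof -
  have C': "convex C" "C \<noteq> {}" using X C(1) polytope_imp_convex by (auto simp: convex_cell_complex_def)
  have "affine hull C = UNIV" using C(2) aff_dim_eq_full[of C] by simp
  hence "rel_interior C = interior C" by (rule rel_interior_interior)
  hence "interior C \<noteq> {}" using C' rel_interior_eq_empty[of C] by simp
  thus ?thesis using interior_mono[of C "\<Union>X"] C(1) by blast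
qed

lemma simplex_closed: "n simplex K \<Longrightarrow> closed (K :: plane set)"
  using simplex_imp_polytope polytope_imp_closed by blast

context self_similar_region
begin

text \<open>Frontiers of pieces lie in the 1-skeleton of the level, so a component of its complement
  does not cross them and each 2-cell lies in one piece. The triangles fill the level because
  everything else has empty interior.\<close>

lemma subdivision_adapted:
  assumes X: "convex_cell_complex X" and P: "\<Union>X = P"
    and skel: "\<And>k. level_skeleton X S F n k = (\<Union>w\<in>words S n. W w ` cell_skeleton X k)"
    and T: "level_subdivision X S F n T"
  shows "adapted n {K \<in> T. 2 simplex K}"
proof -
  let ?\<T> = "{K \<in> T. 2 simplex K}"
  define SK where "SK k = level_skeleton X S F n k" for k
  have T': "simplicial_complex T" "\<Union>T = \<Union>(level_cells X S F n)"
    "\<And>K. K \<in> T \<Longrightarrow> \<exists>C\<in>level_cells X S F n. K \<subseteq> C"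
    using T by (auto simp: level_subdivision_def simplicial_subdivision_def)
  have finT: "finite T" and simp: "\<And>K. K \<in> T \<Longrightarrow> \<exists>m. m simplex K"
    using T'(1) by (auto simp: simplicial_complex_def)
  have finW: "finite (words S n)" by (rule finite_words[OF finite_S])
  have SK2: "SK 2 = level n" by (simp add: SK_def skel cell_skeleton_2 P level_def)
  have SK1_closed: "closed (SK 1)"
    unfolding SK_def skel using finW cell_skeleton_1(1)[OF X] similarity_compact[OF W_similarity[OF words_set]]
    by (intro closed_UN) (auto intro!: compact_imp_closed)
  have SK1_int: "interior (SK 1) = {}"
    unfolding SK_def skel
  proof (rule interior_finite_Union_empty)
    fix A assume "A \<in> (\<lambda>w. W w ` cell_skeleton X 1) ` words S n"
    then obtain w where w: "w \<in> words S n" "A = W w ` cell_skeleton X 1" by blast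
    have sim: "similarity (ratio w) (W w)" by (rule W_similarity[OF words_set[OF w(1)]])
    show "closed A" unfolding w(2) by (rule compact_imp_closed[OF similarity_compact[OF sim cell_skeleton_1(1)[OF X]]])
    show "interior A = {}" unfolding w(2) unfolding similarity_interior[OF sim] cell_skeleton_1(2)[OF X] by simp
  qed (use finW in auto)
  have SK1_frontier: "frontier (W w ` P) \<subseteq> SK 1" if "w \<in> words S n" for w
    using frontier_subset_skeleton[OF X] that by (auto simp: W_frontier[OF words_set[OF that]] SK_def skel P)
  have comp: "\<exists>w\<in>words S n. closure c \<subseteq> W w ` P" if c: "c \<in> components (SK 2 - SK 1)" for c
  proof -
    have c': "connected c" "c \<noteq> {}" "c \<subseteq> SK 2 - SK 1"
      using in_components_connected[OF c] in_components_nonempty[OF c] in_components_subset[OF c] .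
    then obtain x where x: "x \<in> c" by blast
    hence "x \<in> level n" using c'(3) SK2 by auto
    then obtain w where w: "w \<in> words S n" "x \<in> W w ` P" by (auto simp: level_def)
    have "c \<inter> frontier (W w ` P) = {}" using SK1_frontier[OF w(1)] c'(3) by blast
    hence "c - W w ` P = {}" using connected_Int_frontier[OF c'(1), of "W w ` P"] x w(2) by blast
    moreover have "closed (W w ` P)" by (rule compact_imp_closed[OF W_compact[OF words_set[OF w(1)]]])
    ultimately have "closure c \<subseteq> W w ` P" by (intro closure_minimal) auto
    thus ?thesis using w(1) by blast
  qed
  \<comment> \<open>A triangle has interior points, so it is contained neither in a vertex nor in a
    cell inside the 1-skeleton.\<close>
  have piece: "\<exists>w\<in>words S n. K \<subseteq> W w ` P" if K: "K \<in> ?\<T>" for K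
  proof -
    have int: "interior K \<noteq> {}" using K triangle_interior_nonempty by auto
    obtain C where C: "C \<in> level_cells X S F n" "K \<subseteq> C" using T'(3) K by blast
    then consider v where "C = {v}" | c where "c \<in> components (SK 1 - SK 0)" "C = closure c"
      | c where "c \<in> components (SK 2 - SK 1)" "C = closure c"
      by (auto simp: level_cells_def SK_def)
    thus ?thesis
    proof cases
      case 1
      thus ?thesis using int interior_mono[OF C(2)] by simp
    next
      case 2
      have "c \<subseteq> SK 1" using in_components_subset[OF 2(1)] by blast
      hence "K \<subseteq> SK 1" using C(2) 2(2) closure_minimal[OF _ SK1_closed] by blast
      thus ?thesis using int interior_mono SK1_int by blast
    next
      case 3
      thus ?thesis using comp C(2) by blast
    qed
  qed
  have U: "\<Union>?\<T> = level n"
  proof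
    show "\<Union>?\<T> \<subseteq> level n" using piece by (auto simp: level_def) blast
    have closedU: "closed (\<Union>?\<T>)" using finT simplex_closed by (intro closed_Union) auto
    \<comment> \<open>\<open>N\<close> consists of the 1-skeleton and the simplices of lower
      dimension. What the triangles miss in the interior of a piece would be an open subset of
      \<open>N\<close>.\<close>
    define N where "N = \<Union>(insert (SK 1) {K \<in> T. \<not> 2 simplex K})"
    have N_int: "interior N = {}"
      unfolding N_def
    proof (rule interior_finite_Union_empty)
      show "finite (insert (SK 1) {K \<in> T. \<not> 2 simplex K})" using finT by simp
      fix A assume A: "A \<in> insert (SK 1) {K \<in> T. \<not> 2 simplex K}"
      show "closed A" using A SK1_closed simp simplex_closed by blast
      show "interior A = {}"
      proof (cases "A = SK 1")
        case False
        hence A': "A \<in> T" "\<not> 2 simplex A" using A by auto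
        then obtain m where m: "m simplex A" using simp by blast
        show ?thesis
        proof (rule ccontr)
          assume "interior A \<noteq> {}"
          hence "aff_dim A = 2" using aff_dim_nonempty_interior[of A] by simp
          hence "m = 2" using aff_dim_simplex[OF m] by simp
          thus False using m A'(2) by simp
        qed
      qed (use SK1_int in simp)
    qed
    have "interior (W w ` P) \<subseteq> \<Union>?\<T>" if w: "w \<in> words S n" for w
    proof
      fix x assume x: "x \<in> interior (W w ` P)"
      show "x \<in> \<Union>?\<T>"
      proof (rule ccontr)
        assume nx: "x \<notin> \<Union>?\<T>"
        let ?V = "interior (W w ` P) \<inter> - \<Union>?\<T>"
        have "?V \<subseteq> N"
        proof
          fix y assume y: "y \<in> ?V"
          have "y \<in> SK 2" using y w interior_subset by (fastforce simp: SK2 level_def)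
          show "y \<in> N"
          proof (cases "y \<in> SK 1")
            case False
            hence "y \<in> \<Union>(components (SK 2 - SK 1))" using \<open>y \<in> SK 2\<close> by (simp add: Union_components)
            then obtain c where c: "c \<in> components (SK 2 - SK 1)" "y \<in> c" by blast
            hence "closure c \<in> level_cells X S F n" by (auto simp: level_cells_def SK_def)
            hence "y \<in> \<Union>T" using c(2) closure_subset T'(2) by blast
            thus ?thesis using y by (auto simp: N_def)
          qed (simp add: N_def)
        qed
        moreover have "open ?V" using closedU by (intro open_Int open_interior open_Compl)
        ultimately have "?V \<subseteq> interior N" by (rule interior_maximal)
        thus False using N_int x nx by blast
      qed
    qed
    hence "closure (interior (W w ` P)) \<subseteq> \<Union>?\<T>" if "w \<in> words S n" for w
      using that closure_minimal[OF _ closedU] by blast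
    hence "W w ` P \<subseteq> \<Union>?\<T>" if "w \<in> words S n" for w
      using that W_closure_interior[OF words_set] by blast
    thus "level n \<subseteq> \<Union>?\<T>" unfolding level_def by blast
  qed
  have "face_to_face ?\<T>"
    using finT T'(1) by (auto simp: face_to_face_def simplicial_complex_def)
  thus ?thesis using U piece by (auto simp: adapted_def)
qed

end

section \<open>Nontriviality in cyclic cohomology and conclusion\<close>

lemma HC1_class_nontrivial:
  assumes \<phi>: "\<phi> \<in> cyclic_1_cocycles A" and fg: "f \<in> A" "g \<in> A" "\<phi> f g \<noteq> 0"
  shows "HC1_class A \<phi> \<in> HC1 A" "HC1_class A \<phi> \<noteq> HC1_class A (\<lambda>f g. 0)"
proof -
  show "HC1_class A \<phi> \<in> HC1 A" using \<phi> by (auto simp: HC1_def HC1_class_def quotient_def)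
  have "(\<phi>, \<phi>) \<in> HC1_rel A"
    using \<phi> by (auto simp: HC1_rel_def linear_functional_on_def intro!: exI[of _ "\<lambda>_. 0"])
  moreover have "(\<lambda>f g. 0, \<phi>) \<notin> HC1_rel A"
  proof
    assume "(\<lambda>f g. 0, \<phi>) \<in> HC1_rel A"
    then obtain \<psi> where "\<And>f g. \<lbrakk>f \<in> A; g \<in> A\<rbrakk> \<Longrightarrow> 0 - \<phi> f g = \<psi> (\<lambda>x. f x * g x) - \<psi> (\<lambda>x. g x * f x)"
      unfolding HC1_rel_def by auto
    from this[OF fg(1,2)] show False using fg(3) by (simp add: mult.commute)
  qed
  ultimately show "HC1_class A \<phi> \<noteq> HC1_class A (\<lambda>f g. 0)"
    unfolding HC1_class_def by blast
qed

text \<open>The subdivisions \<open>T n\<close> and the chains \<open>s n\<close> stand for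
  arbitrary admissible choices. Part (b) carries \<open>\<alpha> \<le> 1\<close>, which places the
  coordinate functions in the algebra; for larger \<alpha> its elements are constant on segments in
  the attractor and the class is zero.\<close>

theorem theorem1p4:
  fixes X :: "plane set set" and S :: "'j set" and F :: "'j \<Rightarrow> plane \<Rightarrow> plane"
    and \<alpha> :: real and T :: "nat \<Rightarrow> plane set set" and s :: "nat \<Rightarrow> chain"
  assumes "cellular_self_similar_structure X S F"
    and "card S \<ge> 2"
    and "\<alpha> > 0"
    and "hausdorff_dim (cellular_self_similar_set X S F) < ereal (2 * \<alpha>)"
    and "\<And>n. level_subdivision X S F n (T n)"
    and "\<And>n. admissible_chain (level_space X S F n) (T n) (s n)"
  defines "A \<equiv> hoelder_algebra \<alpha> (cellular_self_similar_set X S F)"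
  shows "phi X s \<in> cyclic_1_cocycles A \<and>
    (\<alpha> \<le> 1 \<and> \<Union>X \<noteq> (\<Union>j\<in>S. F j ` \<Union>X) \<longrightarrow>
       HC1_class A (phi X s) \<in> HC1 A \<and>
       HC1_class A (phi X s) \<noteq> HC1_class A (\<lambda>f g. 0))"
proof -
  define P where "P = \<Union>X"
  have css: "convex_cell_complex X" "\<exists>C\<in>X. aff_dim C = 2" "finite S"
    "\<And>j. j \<in> S \<Longrightarrow> similitude_on P (F j)"
    "frontier P \<subseteq> frontier (\<Union>j\<in>S. F j ` P)"
    "\<And>i j. \<lbrakk>i \<in> S; j \<in> S; i \<noteq> j\<rbrakk> \<Longrightarrow> interior (F i ` P) \<inter> interior (F j ` P) = {}"
    using assms(1) by (auto simp: cellular_self_similar_structure_def P_def)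
  have int: "interior P \<noteq> {}" using css(1,2) cellular_interior_nonempty unfolding P_def by blast
  have cpt: "compact P"
    using css(1) polytope_imp_compact unfolding P_def convex_cell_complex_def by (intro compact_Union) auto
  \<comment> \<open>The ball inside |X| allows each map \<open>F j\<close> to be extended to a
    similarity of the plane.\<close>
  obtain c e where ce: "ball c e \<subseteq> P" "e > 0"
    using int by (metis all_not_in_conv mem_interior)
  have Fim: "F j ` P \<subseteq> P" if "j \<in> S" for j using css(4)[OF that] by (simp add: similitude_on_def)
  have "\<exists>r G. similarity r G \<and> r \<le> 1 \<and> (\<forall>x\<in>P. G x = F j x)" if j: "j \<in> S" for j
  proof -
    obtain r where r: "0 < r" "r \<le> 1" "\<And>x y. \<lbrakk>x \<in> P; y \<in> P\<rbrakk> \<Longrightarrow> dist (F j x) (F j y) = r * dist x y"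
      using css(4)[OF j] by (auto simp: similitude_on_def)
    thus ?thesis using similitude_extends[OF ce r(1,3)] by blast
  qed
  then obtain r G where rG: "\<And>j. j \<in> S \<Longrightarrow> similarity (r j) (G j)" "\<And>j. j \<in> S \<Longrightarrow> r j \<le> 1"
    "\<And>j x. \<lbrakk>j \<in> S; x \<in> P\<rbrakk> \<Longrightarrow> G j x = F j x" by metis
  have im: "G j ` A = F j ` A" if "j \<in> S" "A \<subseteq> P" for j A
    using rG(3)[OF that(1)] that(2) by (intro image_cong) auto
  have imU: "(\<Union>j\<in>S. G j ` A) = (\<Union>j\<in>S. F j ` A)" if "A \<subseteq> P" for A
    using im that by simp
  interpret self_similar_region P S G r
  proof
    show "2 \<le> card S" by fact
    show "frontier P \<subseteq> frontier (\<Union>j\<in>S. G j ` P)" using css(5) imU[of P] by simp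
    show "\<And>j. j \<in> S \<Longrightarrow> G j ` P \<subseteq> P" using Fim im by simp
    show "\<And>i j. i \<in> S \<Longrightarrow> j \<in> S \<Longrightarrow> i \<noteq> j \<Longrightarrow> interior (G i ` P) \<inter> interior (G j ` P) = {}"
      using css(6) im by simp
  qed (use cpt int css(3) rG in auto)
  have Weq: "word_map F w ` A = W w ` A" if "w \<in> words S n" "A \<subseteq> P" for w n A
    using word_map_cong[of S F P G w] Fim rG(3) words_set[OF that(1)] that(2) by (intro image_cong) auto
  have K: "cellular_self_similar_set X S F = attractor"
    unfolding cellular_self_similar_set_def
  proof (rule the_equality)
    show "attractor \<noteq> {} \<and> compact attractor \<and> attractor \<subseteq> \<Union>X \<and> attractor = (\<Union>j\<in>S. F j ` attractor)"
      using attractor_nonempty attractor_compact attractor_subset attractor_fixed imU[OF attractor_subset]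
      by (simp add: P_def)
    fix K assume "K \<noteq> {} \<and> compact K \<and> K \<subseteq> \<Union>X \<and> K = (\<Union>j\<in>S. F j ` K)"
    thus "K = attractor" using imU[of K] by (intro fixed_eq_attractor) (auto simp: P_def)
  qed
  have skel: "level_skeleton X S F n k = (\<Union>w\<in>words S n. W w ` cell_skeleton X k)" for n k
  proof -
    have "cell_skeleton X k \<subseteq> P" by (auto simp: cell_skeleton_def P_def)
    thus ?thesis unfolding level_skeleton_def using Weq by simp
  qed
  have simplicial: "simplicial_complex (T n)" for n
    using assms(5)[of n] by (simp add: level_subdivision_def simplicial_subdivision_def)
  have adapted: "adapted n {K \<in> T n. 2 simplex K}" for n
    by (rule subdivision_adapted[OF css(1) P_def[symmetric] skel assms(5)])
  let ?\<T>0 = "{K \<in> T 0. 2 simplex K}"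
  have T0: "face_to_face ?\<T>0" "\<Union>?\<T>0 = P" using adapted[of 0] by (auto simp: adapted_def level_0)
  \<comment> \<open>The dimension is an infimum below 2\<alpha>, so some smaller exponent already
    gives measure zero; the strict gap is what the covering argument uses.\<close>
  obtain t where t: "0 \<le> t" "t < 2 * \<alpha>" "hausdorff_measure t attractor = 0"
    using assms(4) unfolding K hausdorff_dim_def Inf_less_iff by auto
  have \<alpha>: "2 * \<alpha> > 1"
  proof -
    \<comment> \<open>A boundary edge of the triangulation of level 0 supplies a segment in the
      attractor.\<close>
    obtain x y where xy: "(x, y) \<in> boundary_edges ?\<T>0"
      using boundary_edges_Union[OF T0(1)] T0(2) frontier_P_nonempty by fastforce
    have left: "left_edge P x y" using boundary_edge_left_edge[OF T0(1) xy] T0(2) by simp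
    have "closed_segment x y \<subseteq> attractor"
      using left_edge_frontier[OF left] frontier_P_attractor by (rule order_trans)
    moreover have "x \<noteq> y" using left by (simp add: left_edge_def)
    ultimately show ?thesis using segment_null_exponent[OF attractor_compact _ _ t(3,1,2)] by blast
  qed
  have ratios: "(\<Sum>j\<in>S. r j powr (2 * \<alpha>)) < 1" by (rule null_imp_ratio_sum_less_1[OF t(3,1,2)])
  have A: "A = Alg \<alpha>" by (simp add: A_def K)
  have \<Phi>: "phi X s f g = - (\<Sum>(x,y)\<in>boundary_edges ?\<T>0. Y x y)"
    if "f \<in> Alg \<alpha>" "g \<in> Alg \<alpha>" "close_to \<alpha> f g Y" for f g Y
    by (rule phi_eq_boundary_sum[OF \<alpha> ratios P_def[symmetric] simplicial adapted assms(6) that])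
  have cocycle: "phi X s \<in> cyclic_1_cocycles A"
    unfolding A by (rule boundary_functional_cocycle[OF \<alpha> T0 \<Phi>])
  have "HC1_class A (phi X s) \<in> HC1 A \<and> HC1_class A (phi X s) \<noteq> HC1_class A (\<lambda>f g. 0)" if "\<alpha> \<le> 1"
  proof -
    have "phi X s (coordinate 1) (coordinate 2) \<noteq> 0"
      by (rule boundary_functional_coordinates[OF assms(3) that T0 \<Phi>])
    thus ?thesis
      using HC1_class_nontrivial[OF cocycle] coordinate_Alg[OF assms(3) that] unfolding A by blast
  qed
  thus ?thesis using cocycle by blast
qed

end
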